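(* Let $k,l$ be coprime positive integers. Then $(\mathcal{A}_{k,l},\rho_{k,l})$ is a principal $\mathcal{O}(U(1))$-comodule algebra over $\mathcal{O}(S^2_{pq}(k,l^+))$ (i.e. a principal comodule algebra whose subalgebra of coinvariants is $\mathcal{O}(S^2_{pq}(k,l^+))$).
   Context: Fix real numbers $0<p,q,\theta<1$ with $\theta$ irrational. $\mathcal{O}(S^3_{pq\theta})$ is the unital complex $*$-algebra generated by $a,b$ subject to $$ab=e^{2\pi i\theta}ba,\quad ab^*=e^{-2\pi i\theta}b^*a,\quad a^*a-paa^*=1-p,\quad b^*b-qbb^*=1-q,\quad (1-aa^* )(1-bb^* )=0.$$ Put $A=1-aa^*$, $B=1-bb^*$. $\mathcal{O}(U(1))=\mathbb{C}[u,u^*]$ with $uu^*=u^*u=1$ is the Hopf $*$-algebra with $\Delta(u)=u\otimes u$, $\epsilon(u)=1$, $S(u)=u^*$; $\mathcal{O}(\mathbb{Z}_m)$ is its quotient by $u^m=1$. For coprime positive integers $k,l$: $\mathcal{O}(S^2_{pq}(k,l^+))$ is the algebra of $x\in\mathcal{O}(S^3_{pq\theta})$ with $\phi_{k,l}(x)=x\otimes1$, where $\phi_{k,l}:\mathcal{O}(S^3_{pq\theta})\to\mathcal{O}(S^3_{pq\theta})\otimes\mathcal{O}(U(1))$ is the $*$-algebra map $a\mapsto a\otimes u^k$, $b\mapsto b\otimes u^l$; it is generated as a $*$-algebra by $A$, $B$, $C_+=a^lb^{*k}$. $\mathcal{A}_{k,l}$ is the coinvariant subalgebra of $\mathcal{O}(S^3_{pq\theta})$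 under the $\mathcal{O}(\mathbb{Z}_{kl})$-coaction given by the $*$-algebra map $a\mapsto a\otimes u^k$, $b\mapsto b\otimes u^l$; it is the $*$-subalgebra generated by $x=a^l$, $y=b^k$, $z=A$, $w=B$. The $*$-algebra map $\rho_{k,l}:\mathcal{A}_{k,l}\to\mathcal{A}_{k,l}\otimes\mathcal{O}(U(1))$, $x\mapsto x\otimes u$, $y\mapsto y\otimes u$, $z\mapsto z\otimes1$, $w\mapsto w\otimes1$, makes $\mathcal{A}_{k,l}$ a right $\mathcal{O}(U(1))$-comodule algebra. Its coinvariants are generated by $w$, $z$, $xy^*$ and are identified with $\mathcal{O}(S^2_{pq}(k,l^+))$ via $w\mapsto B$, $z\mapsto A$, $xy^*\mapsto C_+$. Principal comodule algebra: for a Hopf algebra $\mathcal{H}$ and a right $\mathcal{H}$-comodule algebra $\mathcal{A}$ with coaction $\rho$ and coinvariant subalgebra $\mathcal{B}=\{c\in\mathcal{A}:\rho(c)=c\otimes1\}$, $\mathcal{A}$ is a principal comodule algebra if the canonical map $\mathcal{A}\otimes_{\mathcal{B}}\mathcal{A}\to\mathcal{A}\otimes\mathcal{H}$, $c\otimes c'\mapsto c\,\rho(c')$, is bijective and the multiplication map $\mathcal{B}\otimes\mathcal{A}\to\mathcal{A}$ splits as a left $\mathcal{B}$-module and right $\mathcal{H}$-comodule map. *)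

theory Defs
  imports
    Complex_Main
    "HOL-Algebra.Module"
    "HOL-Algebra.QuotRing"
    "HOL-Algebra.Algebraic_Closure_Type"
    "HOL-Library.Poly_Mapping"
    "HOL-Library.FuncSet"
begin

section \<open>Complex algebras and *-algebras with carriers\<close>

abbreviation complex_ring :: "complex ring"
  where "complex_ring \<equiv> ring_of_type_algebra"

text \<open>The library locale \<^locale>\<open>algebra\<close> is about commutative algebras only.\<close>

locale complex_algebra = module complex_ring A + ring A for A (structure) +
  assumes smult_mult_left:
      "\<lbrakk>x \<in> carrier A; y \<in> carrier A\<rbrakk> \<Longrightarrow> (c \<odot> x) \<otimes> y = c \<odot> (x \<otimes> y)"
    and smult_mult_right:
      "\<lbrakk>x \<in> carrier A; y \<in> carrier A\<rbrakk> \<Longrightarrow> x \<otimes> (c \<odot> y) = c \<odot> (x \<otimes> y)"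

definition alg_hom ::
    "(complex, 'a, 'm) module_scheme \<Rightarrow> (complex, 'b, 'n) module_scheme \<Rightarrow> ('a \<Rightarrow> 'b) set"
  where "alg_hom A B =
    {f \<in> ring_hom A B. \<forall>c. \<forall>x\<in>carrier A. f (c \<odot>\<^bsub>A\<^esub> x) = c \<odot>\<^bsub>B\<^esub> f x}"

record 'a star_alg = "(complex, 'a) module" +
  star :: "'a \<Rightarrow> 'a"

definition star_hom ::
    "('a, 'm) star_alg_scheme \<Rightarrow> ('b, 'n) star_alg_scheme \<Rightarrow> ('a \<Rightarrow> 'b) set"
  where "star_hom A B = {f \<in> alg_hom A B. \<forall>x\<in>carrier A. f (star A x) = star B (f x)}"

text \<open>
  The *-algebra map with prescribed values on generators, given as a set of pairs
  (generator, value). Restricting to \<^const>\<open>extensional\<close> functions makes the map unique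
  as a HOL function when the first components generate \<open>A\<close>; the definition carries
  information only where such a map is shown to exist.
\<close>

definition the_star_hom ::
    "('a, 'm) star_alg_scheme \<Rightarrow> ('b, 'n) star_alg_scheme \<Rightarrow> ('a \<times> 'b) set \<Rightarrow> 'a \<Rightarrow> 'b"
  where "the_star_hom A B G =
    (THE f. f \<in> star_hom A B \<and> f \<in> extensional (carrier A) \<and> (\<forall>(g, v)\<in>G. f g = v))"

definition type_star_alg ::
    "(complex \<Rightarrow> 'a \<Rightarrow> 'a) \<Rightarrow> ('a \<Rightarrow> 'a) \<Rightarrow> 'a::ring_1 star_alg"
  where "type_star_alg sc st =
    \<lparr>carrier = UNIV, monoid.mult = (*), one = 1, zero = 0, add = (+),
     module.smult = sc, star = st\<rparr>"

definition complex_star_alg :: "complex star_alg"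
  where "complex_star_alg = type_star_alg (*) cnj"


section \<open>Quotients\<close>

text \<open>The induced scalar multiplication; adding \<open>I\<close> is only needed for the scalar 0.\<close>

definition quot_alg ::
    "(complex, 'a, 'm) module_scheme \<Rightarrow> 'a set \<Rightarrow> (complex, 'a set) module"
  where "quot_alg A I =
    ring.extend (A Quot I)
      (module.fields (\<lambda>c K. I <+>\<^bsub>A\<^esub> ((\<lambda>x. c \<odot>\<^bsub>A\<^esub> x) ` K)))"

definition star_ideal :: "('a, 'm) star_alg_scheme \<Rightarrow> 'a set \<Rightarrow> 'a set"
  where "star_ideal A R = Idl\<^bsub>A\<^esub> (R \<union> star A ` R)"

definition star_quot :: "('a, 'm) star_alg_scheme \<Rightarrow> 'a set \<Rightarrow> 'a set star_alg"
  where "star_quot A R =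
    module.extend (quot_alg A (star_ideal A R)) (star_alg.fields (\<lambda>K. star A ` K))"

definition quot_class :: "('a, 'm) star_alg_scheme \<Rightarrow> 'a set \<Rightarrow> 'a \<Rightarrow> 'a set"
  where "quot_class A R x = star_ideal A R +>\<^bsub>A\<^esub> x"


section \<open>Finitely supported functions as complex vector spaces\<close>

definition cscale :: "complex \<Rightarrow> ('x \<Rightarrow>\<^sub>0 complex) \<Rightarrow> ('x \<Rightarrow>\<^sub>0 complex)"
  where "cscale c f = Poly_Mapping.map ((*) c) f"

lemma lookup_cscale [simp]: "Poly_Mapping.lookup (cscale c f) x = c * Poly_Mapping.lookup f x"
  by (simp add: cscale_def Poly_Mapping.map.rep_eq when_def)

interpretation free_cvs: vector_space cscale
  by unfold_locales
     (auto intro!: poly_mapping_eqI simp: lookup_add algebra_simps)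


section \<open>Tensor products\<close>

type_synonym ('a, 'b) tensor = "('a \<times> 'b \<Rightarrow>\<^sub>0 complex) set"

text \<open>
  The free vector space on \<open>carrier M \<times> carrier N\<close>, made an algebra by extending
  \<open>(x, y) (x', y') = (x x', y y')\<close> bilinearly. Dividing by the span of the bilinearity
  relations gives \<open>M \<otimes> N\<close> over the complex numbers, with the usual algebra structure.
\<close>

definition free_tensor ::
    "(complex, 'a, 'm) module_scheme \<Rightarrow> (complex, 'b, 'n) module_scheme
      \<Rightarrow> (complex, 'a \<times> 'b \<Rightarrow>\<^sub>0 complex) module"
  where "free_tensor M N =
    \<lparr>carrier = {t. Poly_Mapping.keys t \<subseteq> carrier M \<times> carrier N},
     monoid.mult = (\<lambda>s t. \<Sum>(x, y)\<in>Poly_Mapping.keys s. \<Sum>(x', y')\<in>Poly_Mapping.keys t.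
       Poly_Mapping.single (x \<otimes>\<^bsub>M\<^esub> x', y \<otimes>\<^bsub>N\<^esub> y')
         (Poly_Mapping.lookup s (x, y) * Poly_Mapping.lookup t (x', y'))),
     one = Poly_Mapping.single (\<one>\<^bsub>M\<^esub>, \<one>\<^bsub>N\<^esub>) 1,
     zero = 0,
     add = (+),
     module.smult = cscale\<rparr>"

abbreviation free_pair :: "'a \<Rightarrow> 'b \<Rightarrow> ('a \<times> 'b \<Rightarrow>\<^sub>0 complex)"
  where "free_pair x y \<equiv> Poly_Mapping.single (x, y) 1"

definition bilinear_rels ::
    "(complex, 'a, 'm) module_scheme \<Rightarrow> (complex, 'b, 'n) module_scheme
      \<Rightarrow> ('a \<times> 'b \<Rightarrow>\<^sub>0 complex) set"
  where "bilinear_rels M N =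
     {free_pair (x \<oplus>\<^bsub>M\<^esub> x') y - free_pair x y - free_pair x' y | x x' y.
        x \<in> carrier M \<and> x' \<in> carrier M \<and> y \<in> carrier N}
   \<union> {free_pair x (y \<oplus>\<^bsub>N\<^esub> y') - free_pair x y - free_pair x y' | x y y'.
        x \<in> carrier M \<and> y \<in> carrier N \<and> y' \<in> carrier N}
   \<union> {free_pair (c \<odot>\<^bsub>M\<^esub> x) y - cscale c (free_pair x y) | c x y.
        x \<in> carrier M \<and> y \<in> carrier N}
   \<union> {free_pair x (c \<odot>\<^bsub>N\<^esub> y) - cscale c (free_pair x y) | c x y.
        x \<in> carrier M \<and> y \<in> carrier N}"

definition tensor ::
    "(complex, 'a, 'm) module_scheme \<Rightarrow> (complex, 'b, 'n) module_scheme
      \<Rightarrow> (complex, ('a, 'b) tensor) module"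
  where "tensor M N = quot_alg (free_tensor M N) (free_cvs.span (bilinear_rels M N))"

definition pure ::
    "(complex, 'a, 'm) module_scheme \<Rightarrow> (complex, 'b, 'n) module_scheme
      \<Rightarrow> 'a \<Rightarrow> 'b \<Rightarrow> ('a, 'b) tensor"
  where "pure M N x y =
    free_cvs.span (bilinear_rels M N) +>\<^bsub>free_tensor M N\<^esub> free_pair x y"

text \<open>\<open>M \<otimes> N\<close> as a *-algebra, with \<open>(x \<otimes> y)\<^sup>* = x\<^sup>* \<otimes> y\<^sup>*\<close>.\<close>

definition star_tensor ::
    "('a, 'm) star_alg_scheme \<Rightarrow> ('b, 'n) star_alg_scheme \<Rightarrow> ('a, 'b) tensor star_alg"
  where "star_tensor M N = module.extend (tensor M N)
    (star_alg.fields (\<lambda>K. (\<lambda>t. \<Sum>(x, y)\<in>Poly_Mapping.keys t.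
       Poly_Mapping.single (star M x, star N y) (cnj (Poly_Mapping.lookup t (x, y)))) ` K))"

text \<open>\<open>A \<otimes>\<^sub>B A\<close> for a subalgebra of \<open>A\<close> with carrier \<open>B\<close>, as a set of cosets.\<close>

definition balanced_rels ::
    "(complex, 'a, 'm) module_scheme \<Rightarrow> 'a set \<Rightarrow> ('a \<times> 'a \<Rightarrow>\<^sub>0 complex) set"
  where "balanced_rels A B =
    {free_pair (x \<otimes>\<^bsub>A\<^esub> b) y - free_pair x (b \<otimes>\<^bsub>A\<^esub> y) | x b y.
       x \<in> carrier A \<and> b \<in> B \<and> y \<in> carrier A}"

definition balanced_tensor ::
    "(complex, 'a, 'm) module_scheme \<Rightarrow> 'a set \<Rightarrow> ('a, 'a) tensor set"
  where "balanced_tensor A B =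
    a_rcosets\<^bsub>free_tensor A A\<^esub> (free_cvs.span (bilinear_rels A A \<union> balanced_rels A B))"

text \<open>
  The linear map on a tensor product induced by a bilinear (and, over \<open>B\<close>, balanced)
  map \<open>f\<close> into \<open>V\<close>: extend \<open>f\<close> linearly to the free vector space; the extension is
  constant on every coset.
\<close>

definition tensor_lift ::
    "(complex, 'v, 'k) module_scheme \<Rightarrow> ('a \<Rightarrow> 'b \<Rightarrow> 'v) \<Rightarrow> ('a, 'b) tensor \<Rightarrow> 'v"
  where "tensor_lift V f K =
    the_elem ((\<lambda>t. finsum V
      (\<lambda>(x, y). Poly_Mapping.lookup t (x, y) \<odot>\<^bsub>V\<^esub> f x y) (Poly_Mapping.keys t)) ` K)"

definition tensor_map ::
    "(complex, 'c, 'm) module_scheme \<Rightarrow> (complex, 'd, 'n) module_scheme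
      \<Rightarrow> ('a \<Rightarrow> 'c) \<Rightarrow> ('b \<Rightarrow> 'd) \<Rightarrow> ('a, 'b) tensor \<Rightarrow> ('c, 'd) tensor"
  where "tensor_map M N f g = tensor_lift (tensor M N) (\<lambda>x y. pure M N (f x) (g y))"

definition tensor_assoc ::
    "(complex, 'a, 'm) module_scheme \<Rightarrow> (complex, 'b, 'n) module_scheme
      \<Rightarrow> (complex, 'c, 'k) module_scheme
      \<Rightarrow> (('a, 'b) tensor, 'c) tensor \<Rightarrow> ('a, ('b, 'c) tensor) tensor"
  where "tensor_assoc L M N =
    tensor_lift (tensor L (tensor M N))
      (\<lambda>t z. tensor_lift (tensor L (tensor M N))
        (\<lambda>x y. pure L (tensor M N) x (pure M N y z)) t)"


section \<open>Hopf algebras and principal comodule algebras\<close>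

locale hopf_algebra = complex_algebra H
  for H :: "(complex, 'h, 'n) module_scheme" (structure) +
  fixes \<Delta> :: "'h \<Rightarrow> ('h, 'h) tensor"
    and \<epsilon> :: "'h \<Rightarrow> complex"
    and S :: "'h \<Rightarrow> 'h"
  assumes comult_hom: "\<Delta> \<in> alg_hom H (tensor H H)"
    and counit_hom: "\<epsilon> \<in> alg_hom H complex_star_alg"
    and coassoc: "h \<in> carrier H \<Longrightarrow>
      tensor_assoc H H H (tensor_map (tensor H H) H \<Delta> (\<lambda>g. g) (\<Delta> h)) =
      tensor_map H (tensor H H) (\<lambda>g. g) \<Delta> (\<Delta> h)"
    and counit_left: "h \<in> carrier H \<Longrightarrow> tensor_lift H (\<lambda>g g'. \<epsilon> g \<odot> g') (\<Delta> h) = h"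
    and counit_right: "h \<in> carrier H \<Longrightarrow> tensor_lift H (\<lambda>g g'. \<epsilon> g' \<odot> g) (\<Delta> h) = h"
    and antipode_closed: "h \<in> carrier H \<Longrightarrow> S h \<in> carrier H"
    and antipode_add: "\<lbrakk>g \<in> carrier H; h \<in> carrier H\<rbrakk> \<Longrightarrow> S (g \<oplus> h) = S g \<oplus> S h"
    and antipode_smult: "h \<in> carrier H \<Longrightarrow> S (c \<odot> h) = c \<odot> S h"
    and antipode_left: "h \<in> carrier H \<Longrightarrow>
      tensor_lift H (\<lambda>g g'. S g \<otimes> g') (\<Delta> h) = \<epsilon> h \<odot> \<one>"
    and antipode_right: "h \<in> carrier H \<Longrightarrow>
      tensor_lift H (\<lambda>g g'. g \<otimes> S g') (\<Delta> h) = \<epsilon> h \<odot> \<one>"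

definition coinvariants ::
    "(complex, 'h, 'n) module_scheme \<Rightarrow> (complex, 'a, 'm) module_scheme
      \<Rightarrow> ('a \<Rightarrow> ('a, 'h) tensor) \<Rightarrow> 'a set"
  where "coinvariants H A \<rho> = {c \<in> carrier A. \<rho> c = pure A H c \<one>\<^bsub>H\<^esub>}"

locale comodule_algebra =
  H: hopf_algebra H \<Delta> \<epsilon> S + A: complex_algebra A
  for H :: "(complex, 'h, 'n) module_scheme" and \<Delta> \<epsilon> S
    and A :: "(complex, 'a, 'm) module_scheme" +
  fixes \<rho> :: "'a \<Rightarrow> ('a, 'h) tensor"
  assumes coaction_hom: "\<rho> \<in> alg_hom A (tensor A H)"
    and coaction_coassoc: "c \<in> carrier A \<Longrightarrow>
      tensor_assoc A H H (tensor_map (tensor A H) H \<rho> (\<lambda>h. h) (\<rho> c)) =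
      tensor_map A (tensor H H) (\<lambda>a. a) \<Delta> (\<rho> c)"
    and coaction_counit: "c \<in> carrier A \<Longrightarrow>
      tensor_lift A (\<lambda>a h. \<epsilon> h \<odot>\<^bsub>A\<^esub> a) (\<rho> c) = c"

definition canonical_map ::
    "(complex, 'h, 'n) module_scheme \<Rightarrow> (complex, 'a, 'm) module_scheme
      \<Rightarrow> ('a \<Rightarrow> ('a, 'h) tensor) \<Rightarrow> ('a, 'a) tensor \<Rightarrow> ('a, 'h) tensor"
  where "canonical_map H A \<rho> =
    tensor_lift (tensor A H) (\<lambda>c c'. pure A H c \<one>\<^bsub>H\<^esub> \<otimes>\<^bsub>tensor A H\<^esub> \<rho> c')"

text \<open>
  \<open>s\<close> is a left \<open>B\<close>-linear, right \<open>H\<close>-colinear section of the multiplication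
  \<open>B \<otimes> A \<rightarrow> A\<close>, where \<open>B\<close> is the carrier of a subalgebra of \<open>A\<close> and \<open>H\<close> coacts on
  the second factor of \<open>B \<otimes> A\<close>. Linearity over the complex numbers is a special case of
  \<open>B\<close>-linearity.
\<close>

definition mult_splitting ::
    "(complex, 'h, 'n) module_scheme \<Rightarrow> (complex, 'a, 'm) module_scheme
      \<Rightarrow> ('a \<Rightarrow> ('a, 'h) tensor) \<Rightarrow> 'a set \<Rightarrow> ('a \<Rightarrow> ('a, 'a) tensor) \<Rightarrow> bool"
  where "mult_splitting H A \<rho> B s \<longleftrightarrow>
    (let B' = A\<lparr>carrier := B\<rparr>; BA = tensor B' A in
      s \<in> carrier A \<rightarrow> carrier BA \<and>
      (\<forall>x\<in>carrier A. \<forall>y\<in>carrier A. s (x \<oplus>\<^bsub>A\<^esub> y) = s x \<oplus>\<^bsub>BA\<^esub> s y) \<and>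
      (\<forall>b\<in>B. \<forall>x\<in>carrier A.
        s (b \<otimes>\<^bsub>A\<^esub> x) = tensor_map B' A (\<lambda>b'. b \<otimes>\<^bsub>A\<^esub> b') (\<lambda>y. y) (s x)) \<and>
      (\<forall>x\<in>carrier A.
        tensor_assoc B' A H (tensor_map BA H s (\<lambda>h. h) (\<rho> x)) =
        tensor_map B' (tensor A H) (\<lambda>b. b) \<rho> (s x)) \<and>
      (\<forall>x\<in>carrier A. tensor_lift A (\<lambda>b y. b \<otimes>\<^bsub>A\<^esub> y) (s x) = x))"

locale principal_comodule_algebra = comodule_algebra +
  assumes canonical_bij:
      "bij_betw (canonical_map H A \<rho>)
        (balanced_tensor A (coinvariants H A \<rho>)) (carrier (tensor A H))"
    and splits: "\<exists>s. mult_splitting H A \<rho> (coinvariants H A \<rho>) s"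


section \<open>The Hopf *-algebra of U(1) and the cyclic quotients\<close>

text \<open>Laurent polynomials: \<open>Poly_Mapping.single n 1\<close> is \<open>u\<^sup>n\<close>, and \<open>u\<^sup>* = u\<^sup>-\<^sup>1\<close>.\<close>

definition OU1 :: "(int \<Rightarrow>\<^sub>0 complex) star_alg"
  where "OU1 = type_star_alg cscale
    (\<lambda>f. Poly_Mapping.map cnj (Poly_Mapping.map_key uminus f))"

definition u1 :: "int \<Rightarrow>\<^sub>0 complex"
  where "u1 = Poly_Mapping.single 1 1"

definition OU1_comult :: "(int \<Rightarrow>\<^sub>0 complex) \<Rightarrow> (int \<Rightarrow>\<^sub>0 complex, int \<Rightarrow>\<^sub>0 complex) tensor"
  where "OU1_comult = the_star_hom OU1 (star_tensor OU1 OU1) {(u1, pure OU1 OU1 u1 u1)}"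

definition OU1_counit :: "(int \<Rightarrow>\<^sub>0 complex) \<Rightarrow> complex"
  where "OU1_counit = the_star_hom OU1 complex_star_alg {(u1, 1)}"

definition OU1_antipode :: "(int \<Rightarrow>\<^sub>0 complex) \<Rightarrow> (int \<Rightarrow>\<^sub>0 complex)"
  where "OU1_antipode = the_star_hom OU1 OU1 {(u1, star OU1 u1)}"

definition OZ :: "nat \<Rightarrow> (int \<Rightarrow>\<^sub>0 complex) set star_alg"
  where "OZ m = star_quot OU1 {u1 ^ m - 1}"

definition uZ :: "nat \<Rightarrow> (int \<Rightarrow>\<^sub>0 complex) set"
  where "uZ m = quot_class OU1 {u1 ^ m - 1} u1"


section \<open>The quantum sphere\<close>

text \<open>Words in \<open>a, a\<^sup>*, b, b\<^sup>*\<close>: a letter \<open>(g, True)\<close> stands for the adjoint of \<open>g\<close>.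
  The wrapper is there to make words an (additively written) monoid, so that finitely
  supported functions on words form the free algebra.\<close>

datatype gen = Gen_a | Gen_b

datatype word = Word (letters: "(gen \<times> bool) list")

instantiation word :: monoid_add
begin
definition "0 = Word []"
definition "v + w = Word (letters v @ letters w)"
instance by standard (auto simp: zero_word_def plus_word_def)
end

definition word_adj :: "word \<Rightarrow> word"
  where "word_adj w = Word (rev (map (apsnd Not) (letters w)))"

type_synonym free_elem = "word \<Rightarrow>\<^sub>0 complex"

definition free_star_algebra :: "free_elem star_alg"
  where "free_star_algebra = type_star_alg cscale
    (\<lambda>f. Poly_Mapping.map cnj (Poly_Mapping.map_key word_adj f))"

definition free_gen :: "gen \<Rightarrow> bool \<Rightarrow> free_elem"
  where "free_gen g adj = Poly_Mapping.single (Word [(g, adj)]) 1"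

definition S3_rels :: "real \<Rightarrow> real \<Rightarrow> real \<Rightarrow> free_elem set"
  where "S3_rels p q \<theta> =
    (let a = free_gen Gen_a False; a' = free_gen Gen_a True;
         b = free_gen Gen_b False; b' = free_gen Gen_b True in
     {a * b - cscale (exp (2 * of_real pi * \<i> * of_real \<theta>)) (b * a),
      a * b' - cscale (exp (- 2 * of_real pi * \<i> * of_real \<theta>)) (b' * a),
      a' * a - cscale (of_real p) (a * a') - cscale (of_real (1 - p)) 1,
      b' * b - cscale (of_real q) (b * b') - cscale (of_real (1 - q)) 1,
      (1 - a * a') * (1 - b * b')})"

type_synonym sphere_elem = "free_elem set"

definition OS3 :: "real \<Rightarrow> real \<Rightarrow> real \<Rightarrow> sphere_elem star_alg"
  where "OS3 p q \<theta> = star_quot free_star_algebra (S3_rels p q \<theta>)"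

definition gen_a :: "real \<Rightarrow> real \<Rightarrow> real \<Rightarrow> sphere_elem"
  where "gen_a p q \<theta> = quot_class free_star_algebra (S3_rels p q \<theta>) (free_gen Gen_a False)"

definition gen_b :: "real \<Rightarrow> real \<Rightarrow> real \<Rightarrow> sphere_elem"
  where "gen_b p q \<theta> = quot_class free_star_algebra (S3_rels p q \<theta>) (free_gen Gen_b False)"

definition elem_A :: "real \<Rightarrow> real \<Rightarrow> real \<Rightarrow> sphere_elem"
  where "elem_A p q \<theta> = (let R = OS3 p q \<theta>; a = gen_a p q \<theta> in
    \<one>\<^bsub>R\<^esub> \<ominus>\<^bsub>R\<^esub> a \<otimes>\<^bsub>R\<^esub> star R a)"

definition elem_B :: "real \<Rightarrow> real \<Rightarrow> real \<Rightarrow> sphere_elem"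
  where "elem_B p q \<theta> = (let R = OS3 p q \<theta>; b = gen_b p q \<theta> in
    \<one>\<^bsub>R\<^esub> \<ominus>\<^bsub>R\<^esub> b \<otimes>\<^bsub>R\<^esub> star R b)"

text \<open>The coaction \<open>a \<mapsto> a \<otimes> v\<^sup>k\<close>, \<open>b \<mapsto> b \<otimes> v\<^sup>l\<close>, where \<open>v\<close> generates \<open>H\<close>.\<close>

definition weighted_coaction ::
    "real \<Rightarrow> real \<Rightarrow> real \<Rightarrow> nat \<Rightarrow> nat \<Rightarrow> 'h star_alg \<Rightarrow> 'h
      \<Rightarrow> sphere_elem \<Rightarrow> (sphere_elem, 'h) tensor"
  where "weighted_coaction p q \<theta> k l H v =
    (let R = OS3 p q \<theta>; a = gen_a p q \<theta>; b = gen_b p q \<theta> in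
     the_star_hom R (star_tensor R H)
       {(a, pure R H a (v [^]\<^bsub>H\<^esub> k)), (b, pure R H b (v [^]\<^bsub>H\<^esub> l))})"

text \<open>\<open>OS2\<close> and \<open>A_kl\<close> are both subalgebras of \<open>OS3\<close>, and
  \<open>a\<^sup>l (b\<^sup>k)\<^sup>*\<close> is literally the generator \<open>C\<^sub>+\<close> of \<open>OS2\<close>; so the identification of
  the coinvariants of \<open>rho_kl\<close> with \<open>OS2\<close> is an equality of subalgebras.\<close>

definition OS2 :: "real \<Rightarrow> real \<Rightarrow> real \<Rightarrow> nat \<Rightarrow> nat \<Rightarrow> sphere_elem star_alg"
  where "OS2 p q \<theta> k l = (OS3 p q \<theta>)
    \<lparr>carrier := coinvariants OU1 (OS3 p q \<theta>) (weighted_coaction p q \<theta> k l OU1 u1)\<rparr>"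

definition A_kl :: "real \<Rightarrow> real \<Rightarrow> real \<Rightarrow> nat \<Rightarrow> nat \<Rightarrow> sphere_elem star_alg"
  where "A_kl p q \<theta> k l = (OS3 p q \<theta>)
    \<lparr>carrier := coinvariants (OZ (k * l)) (OS3 p q \<theta>)
       (weighted_coaction p q \<theta> k l (OZ (k * l)) (uZ (k * l)))\<rparr>"

definition rho_kl ::
    "real \<Rightarrow> real \<Rightarrow> real \<Rightarrow> nat \<Rightarrow> nat
      \<Rightarrow> sphere_elem \<Rightarrow> (sphere_elem, int \<Rightarrow>\<^sub>0 complex) tensor"
  where "rho_kl p q \<theta> k l =
    (let R = A_kl p q \<theta> k l;
         x = gen_a p q \<theta> [^]\<^bsub>R\<^esub> l; y = gen_b p q \<theta> [^]\<^bsub>R\<^esub> k;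
         z = elem_A p q \<theta>; w = elem_B p q \<theta> in
     the_star_hom R (star_tensor R OU1)
       {(x, pure R OU1 x u1), (y, pure R OU1 y u1),
        (z, pure R OU1 z \<one>\<^bsub>OU1\<^esub>), (w, pure R OU1 w \<one>\<^bsub>OU1\<^esub>)})"

end

theory Submission
  imports Defs
begin

text \<open>The relations of the quantum sphere are homogeneous when \<open>a\<close> has degree \<open>(1, 0)\<close>, \<open>b\<close> has degree
  \<open>(0, 1)\<close> and adjoints have the opposite degrees, so the sphere is graded by pairs of integers, and
  the coaction with weights \<open>k\<close> and \<open>l\<close> sends an element \<open>x\<close> of degree \<open>(m, n)\<close> to
  \<open>x \<otimes> u\<^bsup>km + ln\<^esup>\<close>. Hence \<open>A_kl\<close> is the sum of the components with \<open>kl\<close> dividing \<open>km + ln\<close>. By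
  coprimality these are the components with \<open>m = li\<close> and \<open>n = kj\<close>, and \<open>rho_kl\<close> reads off \<open>i + j\<close>.
  In other words, \<open>A_kl\<close> is graded by the integers. Its degree-zero part consists of the components
  with \<open>km + ln = 0\<close>, which are the invariants of the coaction on the whole sphere.

  A comodule algebra over \<open>O(U(1))\<close> is principal as soon as its grading is strong: every \<open>n\<close> admits
  \<open>r\<^sub>i\<close> of degree \<open>-n\<close> and \<open>s\<^sub>i\<close> of degree \<open>n\<close> with \<open>1 = \<Sum> r\<^sub>i s\<^sub>i\<close>. The inverse of the canonical
  map then sends \<open>c \<otimes> u\<^bsup>n\<^esup>\<close> to \<open>\<Sum> c r\<^sub>i \<otimes> s\<^sub>i\<close>, and on elements \<open>c\<close> of degree \<open>n\<close> the same formula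
  splits the multiplication. This is \<open>strongly_graded_coaction.principal\<close>. It suffices to decompose
  the unit for \<open>n = 1\<close> and \<open>n = -1\<close>, since one decomposition can be inserted into another.

  For these two degrees let \<open>x = a\<^bsup>l\<^esup>\<close> and \<open>y = b\<^bsup>k\<^esup>\<close>. Both \<open>x x\<^sup>*\<close> and \<open>x\<^sup>* x\<close> are polynomials in \<open>A\<close>
  with constant term 1, and \<open>y y\<^sup>*\<close> and \<open>y\<^sup>* y\<close> are such polynomials in \<open>B\<close>. As \<open>A B = 0\<close>, the product
  \<open>(1 - x x\<^sup>*) (1 - y y\<^sup>*)\<close> vanishes, that is, \<open>1 = x x\<^sup>* + (1 - x x\<^sup>*) y y\<^sup>*\<close>, and likewise with the
  adjoints first (\<open>unit_decomposition\<close>).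

  All structure maps are specified as the unique *-homomorphism with given values, so their existence
  and uniqueness are part of the proof. Existence comes from the grading of words. Uniqueness
  of \<open>rho_kl\<close> holds because the sphere is spanned by the monomials \<open>A\<^bsup>r\<^esup> B\<^bsup>s\<^esup> a\<^bsup>m\<^esup> b\<^bsup>n\<^esup>\<close>, where negative
  exponents denote powers of the adjoint (\<open>monomials_span\<close>). Those of weight divisible by \<open>kl\<close>
  are products of the generators of \<open>A_kl\<close>. Linear maps out of a tensor product are compared on pure
  tensors of homogeneous elements throughout.\<close>

section \<open>Complex vector spaces with carriers\<close>

abbreviation keys :: "('x \<Rightarrow>\<^sub>0 complex) \<Rightarrow> 'x set" where "keys \<equiv> Poly_Mapping.keys"
abbreviation lookup :: "('x \<Rightarrow>\<^sub>0 complex) \<Rightarrow> 'x \<Rightarrow> complex" where "lookup \<equiv> Poly_Mapping.lookup"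
abbreviation single :: "'x \<Rightarrow> complex \<Rightarrow> ('x \<Rightarrow>\<^sub>0 complex)" where "single \<equiv> Poly_Mapping.single"

locale cspace = module complex_ring V for V (structure)
begin

lemma smultC [simp, intro]: "x \<in> carrier V \<Longrightarrow> c \<odot> x \<in> carrier V"
  using smult_closed by (simp add: ring_of_type_algebra_def)

lemma smult_add_left: "x \<in> carrier V \<Longrightarrow> (c + d) \<odot> x = c \<odot> x \<oplus> d \<odot> x"
  using smult_l_distr by (simp add: ring_of_type_algebra_def)

lemma smult_add_right: "\<lbrakk>x \<in> carrier V; y \<in> carrier V\<rbrakk> \<Longrightarrow> c \<odot> (x \<oplus> y) = c \<odot> x \<oplus> c \<odot> y"
  using smult_r_distr by (simp add: ring_of_type_algebra_def)

lemma smult_smult: "x \<in> carrier V \<Longrightarrow> c \<odot> (d \<odot> x) = (c * d) \<odot> x"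
  using smult_assoc1 by (simp add: ring_of_type_algebra_def)

lemma smult_1 [simp]: "x \<in> carrier V \<Longrightarrow> 1 \<odot> x = x"
  using smult_one by (simp add: ring_of_type_algebra_def)

lemma smult_0 [simp]: "x \<in> carrier V \<Longrightarrow> 0 \<odot> x = \<zero>"
  using smult_l_null by (simp add: ring_of_type_algebra_def)

lemma smult_zero [simp]: "c \<odot> \<zero> = \<zero>"
  using smult_r_null by (simp add: ring_of_type_algebra_def)

lemma smult_minus_1: "x \<in> carrier V \<Longrightarrow> (-1) \<odot> x = \<ominus> x"
proof -
  assume x: "x \<in> carrier V"
  have "(-1) \<odot> x \<oplus> x = (-1 + 1) \<odot> x"
    using x by (subst smult_add_left) auto
  then show ?thesis
    using x by (metis add.inv_equality add.left_inverse smult_0 smultC)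
qed

end

text \<open>Negatives and the neutrality of zero come for free: they are \<open>(-1) \<odot> x\<close> and the case
  \<open>0 + 1 = 1\<close> of distributivity.\<close>

lemma cspaceI:
  fixes V (structure)
  assumes closed: "\<zero> \<in> carrier V" "\<And>x y. \<lbrakk>x \<in> carrier V; y \<in> carrier V\<rbrakk> \<Longrightarrow> x \<oplus> y \<in> carrier V"
      "\<And>c x. x \<in> carrier V \<Longrightarrow> c \<odot> x \<in> carrier V"
    and add: "\<And>x y z. \<lbrakk>x \<in> carrier V; y \<in> carrier V; z \<in> carrier V\<rbrakk> \<Longrightarrow> (x \<oplus> y) \<oplus> z = x \<oplus> (y \<oplus> z)"
      "\<And>x y. \<lbrakk>x \<in> carrier V; y \<in> carrier V\<rbrakk> \<Longrightarrow> x \<oplus> y = y \<oplus> x"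
    and smult: "\<And>x. x \<in> carrier V \<Longrightarrow> 0 \<odot> x = \<zero>" "\<And>x. x \<in> carrier V \<Longrightarrow> 1 \<odot> x = x"
      "\<And>c d x. x \<in> carrier V \<Longrightarrow> (c + d) \<odot> x = c \<odot> x \<oplus> d \<odot> x"
      "\<And>c x y. \<lbrakk>x \<in> carrier V; y \<in> carrier V\<rbrakk> \<Longrightarrow> c \<odot> (x \<oplus> y) = c \<odot> x \<oplus> c \<odot> y"
      "\<And>c d x. x \<in> carrier V \<Longrightarrow> c \<odot> (d \<odot> x) = (c * d) \<odot> x"
  shows "cspace V"
proof -
  have "abelian_group V"
  proof (rule abelian_groupI)
    fix x assume x: "x \<in> carrier V"
    show "\<zero> \<oplus> x = x" using smult(3)[OF x, of 0 1] smult(1,2)[OF x] by simp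
    show "\<exists>y\<in>carrier V. y \<oplus> x = \<zero>"
      using smult(3)[OF x, of "-1" 1] smult(1,2)[OF x] closed(3)[OF x] by auto
  qed (use closed add in auto)
  then show ?thesis
    unfolding cspace_def
    by (rule moduleI[OF cring_from_type_algebra]) (use closed smult in \<open>auto simp: ring_of_type_algebra_def\<close>)
qed

sublocale complex_algebra \<subseteq> cspace A
  unfolding cspace_def by (rule module_axioms)

lemma complex_algebraI:
  fixes A (structure)
  assumes "cspace A" "\<one> \<in> carrier A" "\<And>x y. \<lbrakk>x \<in> carrier A; y \<in> carrier A\<rbrakk> \<Longrightarrow> x \<otimes> y \<in> carrier A"
    and "\<And>x y z. \<lbrakk>x \<in> carrier A; y \<in> carrier A; z \<in> carrier A\<rbrakk> \<Longrightarrow> (x \<otimes> y) \<otimes> z = x \<otimes> (y \<otimes> z)"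
    and "\<And>x. x \<in> carrier A \<Longrightarrow> \<one> \<otimes> x = x" "\<And>x. x \<in> carrier A \<Longrightarrow> x \<otimes> \<one> = x"
    and "\<And>x y z. \<lbrakk>x \<in> carrier A; y \<in> carrier A; z \<in> carrier A\<rbrakk> \<Longrightarrow> (x \<oplus> y) \<otimes> z = x \<otimes> z \<oplus> y \<otimes> z"
    and "\<And>x y z. \<lbrakk>x \<in> carrier A; y \<in> carrier A; z \<in> carrier A\<rbrakk> \<Longrightarrow> z \<otimes> (x \<oplus> y) = z \<otimes> x \<oplus> z \<otimes> y"
    and "\<And>c x y. \<lbrakk>x \<in> carrier A; y \<in> carrier A\<rbrakk> \<Longrightarrow> (c \<odot> x) \<otimes> y = c \<odot> (x \<otimes> y)"
    and "\<And>c x y. \<lbrakk>x \<in> carrier A; y \<in> carrier A\<rbrakk> \<Longrightarrow> x \<otimes> (c \<odot> y) = c \<odot> (x \<otimes> y)"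
  shows "complex_algebra A"
proof -
  interpret cspace A by fact
  interpret ring A
    by (rule ringI[OF M.abelian_group_axioms Group.monoidI]) (use assms in auto)
  show ?thesis
    by unfold_locales (use assms in auto)
qed

text \<open>The twist \<open>\<sigma>\<close> is the identity for linear maps and complex conjugation for star operations.\<close>

definition semilinear ::
  "(complex \<Rightarrow> complex) \<Rightarrow> (complex, 'a, 'm) module_scheme \<Rightarrow> (complex, 'b, 'n) module_scheme
    \<Rightarrow> ('a \<Rightarrow> 'b) \<Rightarrow> bool"
  where "semilinear \<sigma> V W f \<longleftrightarrow> f \<in> carrier V \<rightarrow> carrier W \<and>
    (\<forall>x\<in>carrier V. \<forall>y\<in>carrier V. f (x \<oplus>\<^bsub>V\<^esub> y) = f x \<oplus>\<^bsub>W\<^esub> f y) \<and>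
    (\<forall>c. \<forall>x\<in>carrier V. f (c \<odot>\<^bsub>V\<^esub> x) = \<sigma> c \<odot>\<^bsub>W\<^esub> f x)"

abbreviation "linmap \<equiv> semilinear (\<lambda>c. c)"

lemma semilinearI:
  assumes "\<And>x. x \<in> carrier V \<Longrightarrow> f x \<in> carrier W"
    and "\<And>x y. \<lbrakk>x \<in> carrier V; y \<in> carrier V\<rbrakk> \<Longrightarrow> f (x \<oplus>\<^bsub>V\<^esub> y) = f x \<oplus>\<^bsub>W\<^esub> f y"
    and "\<And>c x. x \<in> carrier V \<Longrightarrow> f (c \<odot>\<^bsub>V\<^esub> x) = \<sigma> c \<odot>\<^bsub>W\<^esub> f x"
  shows "semilinear \<sigma> V W f"
  using assms by (auto simp: semilinear_def)

lemma semilinearD: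
  assumes "semilinear \<sigma> V W f"
  shows "x \<in> carrier V \<Longrightarrow> f x \<in> carrier W"
    and "\<lbrakk>x \<in> carrier V; y \<in> carrier V\<rbrakk> \<Longrightarrow> f (x \<oplus>\<^bsub>V\<^esub> y) = f x \<oplus>\<^bsub>W\<^esub> f y"
    and "x \<in> carrier V \<Longrightarrow> f (c \<odot>\<^bsub>V\<^esub> x) = \<sigma> c \<odot>\<^bsub>W\<^esub> f x"
  using assms by (auto simp: semilinear_def)

lemma semilinear_zero:
  assumes "semilinear \<sigma> V W f" "cspace V" "cspace W"
  shows "f \<zero>\<^bsub>V\<^esub> = \<zero>\<^bsub>W\<^esub>"
proof -
  interpret V: cspace V by fact
  interpret W: cspace W by fact
  have "f \<zero>\<^bsub>V\<^esub> \<oplus>\<^bsub>W\<^esub> f \<zero>\<^bsub>V\<^esub> = f \<zero>\<^bsub>V\<^esub>"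
    using semilinearD(2)[OF assms(1), of "\<zero>\<^bsub>V\<^esub>" "\<zero>\<^bsub>V\<^esub>"] by simp
  then show ?thesis
    using semilinearD(1)[OF assms(1), of "\<zero>\<^bsub>V\<^esub>"] by simp
qed

lemma semilinear_minus:
  assumes "semilinear \<sigma> V W f" "cspace V" "cspace W" "x \<in> carrier V" "y \<in> carrier V"
  shows "f (x \<ominus>\<^bsub>V\<^esub> y) = f x \<ominus>\<^bsub>W\<^esub> f y"
proof -
  interpret V: cspace V by fact
  interpret W: cspace W by fact
  note D = semilinearD[OF assms(1)]
  have "f (\<ominus>\<^bsub>V\<^esub> y) \<oplus>\<^bsub>W\<^esub> f y = \<zero>\<^bsub>W\<^esub>"
    using assms D(2)[of "\<ominus>\<^bsub>V\<^esub> y" y] semilinear_zero[OF assms(1-3)] by (simp add: V.l_neg)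
  then have "f (\<ominus>\<^bsub>V\<^esub> y) = \<ominus>\<^bsub>W\<^esub> f y"
    using assms D(1) W.add.inv_equality by auto
  then show ?thesis
    using assms D by (simp add: V.minus_eq W.minus_eq)
qed

lemma semilinear_comp:
  assumes "semilinear \<sigma> U V f" "semilinear \<tau> V W g"
  shows "semilinear (\<lambda>c. \<tau> (\<sigma> c)) U W (\<lambda>x. g (f x))"
  using assms by (auto simp: semilinear_def Pi_iff)

lemma linmap_id: "linmap V V (\<lambda>x. x)"
  by (auto simp: semilinear_def)

lemma alg_hom_linmap: "f \<in> alg_hom A B \<Longrightarrow> linmap A B f"
  by (auto simp: alg_hom_def ring_hom_def semilinear_def)

text \<open>Adding one multiple of a generator at a time gives the induction with which two semilinear maps
  that agree on \<open>S\<close> are seen to agree on the span.\<close>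

inductive_set cspan :: "(complex, 'a, 'm) module_scheme \<Rightarrow> 'a set \<Rightarrow> 'a set"
  for V (structure) and S where
  zero: "\<zero> \<in> cspan V S"
| step: "\<lbrakk>x \<in> cspan V S; s \<in> S\<rbrakk> \<Longrightarrow> c \<odot> s \<oplus> x \<in> cspan V S"

lemma cspan_mono: "S \<subseteq> T \<Longrightarrow> cspan V S \<subseteq> cspan V T"
proof
  fix x assume "S \<subseteq> T" "x \<in> cspan V S"
  from this(2,1) show "x \<in> cspan V T"
    by induction (auto intro: cspan.intros)
qed

context cspace
begin

lemma cspan_carrier: 
  assumes "S \<subseteq> carrier V" "x \<in> cspan V S"
  shows "x \<in> carrier V"
  using assms(2) by induction (use assms in auto)

lemma cspan_base: "S \<subseteq> carrier V \<Longrightarrow> s \<in> S \<Longrightarrow> s \<in> cspan V S"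
  using cspan.step[OF cspan.zero, of s S V 1] by auto

lemma cspan_add:
  assumes "S \<subseteq> carrier V" "x \<in> cspan V S" "y \<in> cspan V S"
  shows "x \<oplus> y \<in> cspan V S"
  using assms(2)
proof induction
  case zero
  then show ?case using assms cspan_carrier by simp
next
  case (step x s c)
  have "(c \<odot> s \<oplus> x) \<oplus> y = c \<odot> s \<oplus> (x \<oplus> y)"
    using assms step cspan_carrier[OF assms(1)] by (intro a_assoc) auto
  then show ?case using step cspan.step by metis
qed

lemma cspan_smult:
  assumes "S \<subseteq> carrier V" "x \<in> cspan V S"
  shows "c \<odot> x \<in> cspan V S"
  using assms(2)
proof induction
  case zero
  then show ?case by (simp add: cspan.zero)
next
  case (step x s d)
  have "c \<odot> (d \<odot> s \<oplus> x) = (c * d) \<odot> s \<oplus> c \<odot> x"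
    using assms step cspan_carrier[OF assms(1) step(1)]
    by (subst smult_add_right) (auto simp: smult_smult)
  then show ?case using step cspan.step by metis
qed

end

lemma semilinear_cspan:
  assumes "semilinear \<sigma> V W f" "cspace V" "cspace W" "S \<subseteq> carrier V" "T \<subseteq> carrier W"
    and "\<And>s. s \<in> S \<Longrightarrow> f s \<in> cspan W T" "x \<in> cspan V S"
  shows "f x \<in> cspan W T"
proof -
  interpret V: cspace V by fact
  interpret W: cspace W by fact
  show ?thesis using assms(7)
  proof induction
    case zero
    then show ?case using semilinear_zero[OF assms(1-3)] by (simp add: cspan.zero)
  next
    case (step x s c)
    then show ?case
      using assms V.cspan_carrier[OF assms(4) step(1)]
      by (auto simp: semilinearD[OF assms(1)] subset_eq intro!: W.cspan_add W.cspan_smult)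
  qed
qed

lemma (in cspace) cspan_subset:
  assumes "T \<subseteq> carrier V" "S \<subseteq> cspan V T"
  shows "cspan V S \<subseteq> cspan V T"
proof
  fix x assume "x \<in> cspan V S"
  then show "x \<in> cspan V T"
    by (rule semilinear_cspan[OF linmap_id cspace_axioms cspace_axioms _ assms(1), rotated 2])
       (use assms cspan_carrier in auto)
qed

lemma semilinear_ext:
  assumes "semilinear \<sigma> V W f" "semilinear \<sigma> V W g" "cspace V" "cspace W" "S \<subseteq> carrier V"
    and "\<And>s. s \<in> S \<Longrightarrow> f s = g s" "x \<in> cspan V S"
  shows "f x = g x"
proof -
  interpret V: cspace V by fact
  show ?thesis using assms(7)
  proof induction
    case zero
    then show ?case using semilinear_zero assms by metis
  next
    case (step x s c)
    then show ?case
      using assms V.cspan_carrier[OF assms(5) step(1)]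
      by (auto simp: semilinearD[OF assms(1)] semilinearD[OF assms(2)] subset_eq)
  qed
qed

section \<open>Linear extension from a basis\<close>

lemma poly_mapping_keys_induct [consumes 1, case_names zero add]:
  assumes "keys t \<subseteq> K" "P 0"
    and "\<And>x c t. \<lbrakk>x \<in> K; keys t \<subseteq> K; P t\<rbrakk> \<Longrightarrow> P (single x c + t)"
  shows "P (t :: 'x \<Rightarrow>\<^sub>0 complex)"
  using assms(1)
proof (induction "card (keys t)" arbitrary: t)
  case 0
  then have "t = 0" by simp
  then show ?case using assms(2) by simp
next
  case (Suc n)
  then obtain x where x: "x \<in> keys t" by fastforce
  define u where "u = t - single x (lookup t x)"
  have k: "keys u = keys t - {x}"
    by (auto simp: u_def in_keys_iff lookup_minus lookup_single when_def split: if_splits)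
  have "P u"
    using Suc x by (intro Suc(1)) (auto simp: k)
  then have "P (single x (lookup t x) + u)"
    using Suc x k by (intro assms(3)) auto
  then show ?case by (simp add: u_def)
qed

text \<open>The linear extension of \<open>f\<close> from the point masses to finitely supported functions.\<close>

definition lin :: "(complex, 'v, 'm) module_scheme \<Rightarrow> ('x \<Rightarrow> 'v) \<Rightarrow> ('x \<Rightarrow>\<^sub>0 complex) \<Rightarrow> 'v"
  where "lin V f t = finsum V (\<lambda>p. lookup t p \<odot>\<^bsub>V\<^esub> f p) (keys t)"

context cspace
begin

lemma lin_superset:
  assumes "f \<in> K \<rightarrow> carrier V" "finite A" "keys t \<subseteq> A" "A \<subseteq> K"
  shows "lin V f t = finsum V (\<lambda>p. lookup t p \<odot> f p) A"
  unfolding lin_def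
  by (rule add.finprod_mono_neutral_cong_left)
     (use assms in \<open>auto simp: in_keys_iff Pi_iff subset_eq\<close>)

lemma lin_closed:
  assumes "f \<in> K \<rightarrow> carrier V" "keys t \<subseteq> K"
  shows "lin V f t \<in> carrier V"
  unfolding lin_def by (rule finsum_closed) (use assms in auto)

lemma lin_add:
  assumes "f \<in> K \<rightarrow> carrier V" "keys s \<subseteq> K" "keys t \<subseteq> K"
  shows "lin V f (s + t) = lin V f s \<oplus> lin V f t"
proof -
  let ?A = "keys s \<union> keys t"
  have A: "finite ?A" "?A \<subseteq> K" using assms by auto
  have "keys (s + t) \<subseteq> ?A" by (rule keys_add)
  then have "lin V f (s + t) = finsum V (\<lambda>p. lookup (s + t) p \<odot> f p) ?A"
    by (intro lin_superset[OF assms(1)]) (use A in auto)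
  also have "\<dots> = finsum V (\<lambda>p. lookup s p \<odot> f p \<oplus> lookup t p \<odot> f p) ?A"
    by (rule finsum_cong') (use assms in \<open>auto simp: lookup_add smult_add_left Pi_iff subset_eq\<close>)
  also have "\<dots> = finsum V (\<lambda>p. lookup s p \<odot> f p) ?A \<oplus>
      finsum V (\<lambda>p. lookup t p \<odot> f p) ?A"
    by (rule finsum_addf) (use assms in auto)
  also have "\<dots> = lin V f s \<oplus> lin V f t"
    using A lin_superset[OF assms(1), of ?A s] lin_superset[OF assms(1), of ?A t] by simp
  finally show ?thesis .
qed

lemma lin_zero [simp]: "lin V f 0 = \<zero>"
  by (simp add: lin_def)

lemma lin_single [simp]:
  assumes "f x \<in> carrier V"
  shows "lin V f (single x c) = c \<odot> f x"
  by (cases "c = 0") (use assms in \<open>auto simp: lin_def\<close>)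

end

lemma keys_cscale: "keys (cscale c t) \<subseteq> keys t"
  by (auto simp: in_keys_iff)

lemma cscale_simps [simp]:
  "cscale c 0 = 0" "cscale c (single x d) = single x (c * d)"
  "cscale 1 t = t"
  by (auto intro!: poly_mapping_eqI simp: lookup_single when_def)

lemma cscale_add: "cscale c (s + t) = cscale c s + cscale c t"
  by (auto intro!: poly_mapping_eqI simp: lookup_add algebra_simps)

context cspace
begin

lemma lin_cscale:
  assumes "f \<in> K \<rightarrow> carrier V" "keys t \<subseteq> K"
  shows "lin V f (cscale c t) = c \<odot> lin V f t"
  using assms(2)
proof (induction rule: poly_mapping_keys_induct)
  case zero
  then show ?case by simp
next
  case (add x d t)
  have 1: "keys (single x d) \<subseteq> K" 
    using add by auto
  have 3: "keys (single x (c*d)) \<subseteq> K" 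
    using add by auto
  have 2: "keys (cscale c t) \<subseteq> K"
    using keys_cscale[of c t] add by auto
  have f: "f x \<in> carrier V" using add assms by auto
  show ?case
    using add 1 2 3 f lin_closed[OF assms(1) add(2)]
    by (simp add: cscale_add lin_add[OF assms(1)] smult_add_right smult_smult)
qed

lemma lin_cong:
  assumes "\<And>p. p \<in> keys t \<Longrightarrow> f p = g p" "\<And>p. p \<in> keys t \<Longrightarrow> g p \<in> carrier V"
  shows "lin V f t = lin V g t"
  unfolding lin_def by (rule finsum_cong') (use assms in auto)

lemma lin_fun_add:
  assumes "\<And>p. p \<in> keys t \<Longrightarrow> f p \<in> carrier V"
    "\<And>p. p \<in> keys t \<Longrightarrow> g p \<in> carrier V"
  shows "lin V (\<lambda>p. f p \<oplus> g p) t = lin V f t \<oplus> lin V g t"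
proof -
  have "lin V (\<lambda>p. f p \<oplus> g p) t =
    finsum V (\<lambda>p. lookup t p \<odot> f p \<oplus> lookup t p \<odot> g p) (keys t)"
    unfolding lin_def by (rule finsum_cong') (use assms in \<open>auto simp: smult_add_right\<close>)
  also have "\<dots> = lin V f t \<oplus> lin V g t"
    unfolding lin_def by (rule finsum_addf) (use assms in auto)
  finally show ?thesis .
qed

end

lemma linmap_lin:
  assumes "linmap V W g" "cspace V" "cspace W" "\<And>p. p \<in> keys t \<Longrightarrow> f p \<in> carrier V"
  shows "g (lin V f t) = lin W (\<lambda>p. g (f p)) t"
proof -
  interpret V: cspace V by fact
  interpret W: cspace W by fact
  note D = semilinearD[OF assms(1)]
  define K where "K = {p. f p \<in> carrier V}"
  have f: "f \<in> K \<rightarrow> carrier V" "(\<lambda>p. g (f p)) \<in> K \<rightarrow> carrier W" using D by (auto simp: K_def)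
  have "keys t \<subseteq> K" using assms by (auto simp: K_def)
  then show ?thesis
  proof (induction rule: poly_mapping_keys_induct)
    case zero
    then show ?case using semilinear_zero[OF assms(1-3)] by simp
  next
    case (add x c t)
    have 1: "keys (single x c) \<subseteq> K" 
      using add by auto
    have "f x \<in> carrier V" using add f by auto
    then show ?case
      using add 1 D V.lin_closed[OF f(1)]
      by (simp add: V.lin_add[OF f(1)] W.lin_add[OF f(2)])
  qed
qed

lemma lin_fun_smult:
  assumes "cspace V" "\<And>p. p \<in> keys t \<Longrightarrow> f p \<in> carrier V"
  shows "lin V (\<lambda>p. c \<odot>\<^bsub>V\<^esub> f p) t = c \<odot>\<^bsub>V\<^esub> lin V f t"
proof -
  interpret cspace V by fact
  have "linmap V V (\<lambda>x. c \<odot>\<^bsub>V\<^esub> x)"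
    by (rule semilinearI) (auto simp: smult_add_right smult_smult mult.commute)
  from linmap_lin[OF this assms(1,1), of t f] assms(2) show ?thesis by simp
qed

section \<open>Quotients\<close>

definition linear_sub :: "(complex, 'a, 'm) module_scheme \<Rightarrow> 'a set \<Rightarrow> bool"
  where "linear_sub V W \<longleftrightarrow> W \<subseteq> carrier V \<and> \<zero>\<^bsub>V\<^esub> \<in> W \<and> (\<forall>x\<in>W. \<forall>y\<in>W. x \<oplus>\<^bsub>V\<^esub> y \<in> W) \<and>
    (\<forall>c. \<forall>x\<in>W. c \<odot>\<^bsub>V\<^esub> x \<in> W)"

text \<open>The value on a coset of a map that is constant on it.\<close>

definition qlift :: "('a \<Rightarrow> 'b) \<Rightarrow> 'a set \<Rightarrow> 'b"
  where "qlift f C = the_elem (f ` C)"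

lemma quot_alg_simps:
  "carrier (quot_alg A I) = a_rcosets\<^bsub>A\<^esub> I"
  "monoid.mult (quot_alg A I) = rcoset_mult A I"
  "one (quot_alg A I) = I +>\<^bsub>A\<^esub> \<one>\<^bsub>A\<^esub>"
  "zero (quot_alg A I) = I"
  "add (quot_alg A I) = set_add A"
  "module.smult (quot_alg A I) = (\<lambda>c K. I <+>\<^bsub>A\<^esub> ((\<lambda>x. c \<odot>\<^bsub>A\<^esub> x) ` K))"
  by (simp_all add: quot_alg_def ring.defs module.defs FactRing_def)

text \<open>The subspace need not be an ideal: the tensor product over a subalgebra is such a quotient without
  being an algebra.\<close>

locale cspace_quot = cspace V for V (structure) + fixes W
  assumes sub: "linear_sub V W"
begin

lemma additive_subgroup: "additive_subgroup W V"
  by (rule additive_subgroupI, rule add.subgroupI)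
     (use sub in \<open>force simp: linear_sub_def smult_minus_1[symmetric] subset_eq a_inv_def[symmetric]\<close>)+

sublocale W: abelian_subgroup W V
  by (rule abelian_subgroupI3[OF additive_subgroup M.abelian_group_axioms])

abbreviation "Q \<equiv> quot_alg V W"

lemma smultW: "w \<in> W \<Longrightarrow> c \<odot> w \<in> W"
  using sub by (auto simp: linear_sub_def)

lemma Q_carrier: "carrier Q = (\<lambda>x. W +> x) ` carrier V"
  by (auto simp: quot_alg_simps A_RCOSETS_def' a_r_coset_def')

lemma Q_closed [simp]: "x \<in> carrier V \<Longrightarrow> W +> x \<in> carrier Q"
  by (auto simp: Q_carrier)

lemma Q_add [simp]: "\<lbrakk>x \<in> carrier V; y \<in> carrier V\<rbrakk> \<Longrightarrow> (W +> x) \<oplus>\<^bsub>Q\<^esub> (W +> y) = W +> (x \<oplus> y)"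
  by (simp add: quot_alg_simps W.a_rcos_sum)

lemma Q_eq:
  assumes "x \<in> carrier V" "y \<in> carrier V"
  shows "(W +> x) = (W +> y) \<longleftrightarrow> x \<ominus> y \<in> W"
proof -
  have "(W +> x) = (W +> y) \<longleftrightarrow> x \<in> W +> y"
    using assms W.a_rcos_self[of x] W.a_repr_independence'[of x y] by auto
  also have "\<dots> \<longleftrightarrow> x \<ominus> y \<in> W"
    using W.a_rcos_module[of y x] assms by (simp add: minus_eq)
  finally show ?thesis .
qed

lemma Q_zero: "\<zero>\<^bsub>Q\<^esub> = W +> \<zero>"
  using sub by (simp add: quot_alg_simps linear_sub_def)

lemma Q_smult [simp]:
  assumes x: "x \<in> carrier V"
  shows "c \<odot>\<^bsub>Q\<^esub> (W +> x) = W +> (c \<odot> x)"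
proof -
  have "W <+> ((\<lambda>x. c \<odot> x) ` (W +> x)) = W +> (c \<odot> x)" (is "?L = ?R")
  proof (intro subset_antisym subsetI)
    fix z assume "z \<in> ?L"
    then obtain v w where vw: "v \<in> W" "w \<in> W" "z = v \<oplus> c \<odot> (w \<oplus> x)"
      by (auto simp: set_add_def' a_r_coset_def')
    then have "z = (v \<oplus> c \<odot> w) \<oplus> c \<odot> x"
      using x W.a_Hcarr smultW by (simp add: smult_add_right a_assoc)
    then show "z \<in> ?R"
      using vw smultW by (auto simp: a_r_coset_def')
  next
    fix z assume "z \<in> ?R"
    then obtain v where "v \<in> W" "z = v \<oplus> c \<odot> x"
      by (auto simp: a_r_coset_def')
    then show "z \<in> ?L"
      using W.a_rcos_self[OF x] by (auto simp: set_add_def')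
  qed
  then show ?thesis by (simp add: quot_alg_simps)
qed

lemma Q_cspace: "cspace Q"
  by (rule cspaceI) (auto simp: Q_carrier Q_zero a_ac smult_smult smult_add_left smult_add_right)

lemma proj_linmap: "linmap V Q (\<lambda>x. W +> x)"
  by (rule semilinearI) auto

lemma Q_in_cspan:
  assumes "S \<subseteq> carrier V" "carrier V \<subseteq> cspan V S" "z \<in> carrier Q"
  shows "z \<in> cspan Q ((\<lambda>x. W +> x) ` S)"
proof -
  obtain v where v: "v \<in> carrier V" "z = W +> v" using assms by (auto simp: Q_carrier)
  interpret Q: cspace Q by (rule Q_cspace)
  show ?thesis unfolding v(2)
    by (rule semilinear_cspan[OF proj_linmap cspace_axioms Q_cspace assms(1)])
       (use assms v in \<open>auto intro!: Q.cspan_base\<close>)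
qed

end

lemma qlift_coset:
  assumes "semilinear \<sigma> V U f" "cspace_quot V W" "cspace U" "\<And>w. w \<in> W \<Longrightarrow> f w = \<zero>\<^bsub>U\<^esub>" "x \<in> carrier V"
  shows "qlift f (W +>\<^bsub>V\<^esub> x) = f x"
proof -
  interpret cspace_quot V W by fact
  interpret U: cspace U by fact
  have "f ` (W +>\<^bsub>V\<^esub> x) = {f x}"
    using W.a_rcos_self[OF assms(5)] assms(4,5) semilinearD[OF assms(1)]
    by (auto simp: a_r_coset_def')
  then show ?thesis by (simp add: qlift_def)
qed

lemma qlift_semilinear:
  assumes "semilinear \<sigma> V U f" "cspace_quot V W" "cspace U" "\<And>w. w \<in> W \<Longrightarrow> f w = \<zero>\<^bsub>U\<^esub>"
  shows "semilinear \<sigma> (quot_alg V W) U (qlift f)"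
proof -
  interpret cspace_quot V W by fact
  note q = qlift_coset[OF assms]
  show ?thesis
    by (rule semilinearI) (auto simp: Q_carrier q semilinearD[OF assms(1)])
qed

locale algebra_quot = complex_algebra V for V (structure) + fixes W
  assumes ideal_ax: "ideal W V"
begin

lemma linear_sub: "linear_sub V W"
proof -
  interpret I: ideal W V by (rule ideal_ax)
  have "c \<odot> x \<in> W" if "x \<in> W" for c x
  proof -
    have "(c \<odot> \<one>) \<otimes> x \<in> W" using that by (intro I.I_l_closed) auto
    then show ?thesis using that by (simp add: smult_mult_left I.Icarr)
  qed
  then show ?thesis by (auto simp: linear_sub_def I.Icarr)
qed

sublocale cspace_quot V W
  by unfold_locales (rule linear_sub)

lemma Q_mult [simp]: "\<lbrakk>x \<in> carrier V; y \<in> carrier V\<rbrakk> \<Longrightarrow> (W +> x) \<otimes>\<^bsub>Q\<^esub> (W +> y) = W +> (x \<otimes> y)"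
  using ideal.rcoset_mult_add[OF ideal_ax] by (simp add: quot_alg_simps)

lemma Q_one: "\<one>\<^bsub>Q\<^esub> = W +> \<one>"
  by (simp add: quot_alg_simps)

lemma Q_algebra: "complex_algebra Q"
  by (rule complex_algebraI[OF Q_cspace])
     (auto simp: Q_carrier Q_one m_assoc l_distr r_distr smult_mult_left smult_mult_right)

end

section \<open>The free algebra underlying a tensor product\<close>

lemma free_tensor_simps:
  "carrier (free_tensor M N) = {t. keys t \<subseteq> carrier M \<times> carrier N}"
  "one (free_tensor M N) = single (\<one>\<^bsub>M\<^esub>, \<one>\<^bsub>N\<^esub>) 1"
  "zero (free_tensor M N) = 0"
  "add (free_tensor M N) = (+)"
  "module.smult (free_tensor M N) = cscale"
  by (simp_all add: free_tensor_def)

lemma keys_add_subset: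
  "\<lbrakk>keys s \<subseteq> K; keys t \<subseteq> K\<rbrakk> \<Longrightarrow> keys (s + t) \<subseteq> K"
  using keys_add[of s t] by blast

lemma keys_cscale_subset: "keys t \<subseteq> K \<Longrightarrow> keys (cscale c t) \<subseteq> K"
  using keys_cscale[of c t] by blast

lemma free_tensor_cspace: "cspace (free_tensor M N)"
  by (rule cspaceI)
     (auto simp: free_tensor_simps add_ac cscale_add free_cvs.scale_left_distrib
       intro!: keys_add_subset keys_cscale_subset del: subsetI)

lemma free_tensor_diff:
  assumes "s \<in> carrier (free_tensor M N)" "t \<in> carrier (free_tensor M N)"
  shows "s \<ominus>\<^bsub>free_tensor M N\<^esub> t = s - t"
proof -
  interpret F: cspace "free_tensor M N" by (rule free_tensor_cspace)
  have "\<ominus>\<^bsub>free_tensor M N\<^esub> t = - t"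
    using F.smult_minus_1[OF assms(2)] by (simp add: free_tensor_simps free_cvs.scale_minus_left)
  then show ?thesis by (simp add: F.minus_eq free_tensor_simps)
qed

lemma free_tensor_mult_superset:
  assumes "finite A" "finite B" "keys s \<subseteq> A" "keys t \<subseteq> B"
  shows "s \<otimes>\<^bsub>free_tensor M N\<^esub> t = (\<Sum>x\<in>A. \<Sum>y\<in>B.
    single (fst x \<otimes>\<^bsub>M\<^esub> fst y, snd x \<otimes>\<^bsub>N\<^esub> snd y)
      (lookup s x * lookup t y))"
proof -
  have "s \<otimes>\<^bsub>free_tensor M N\<^esub> t = (\<Sum>x\<in>keys s. \<Sum>y\<in>keys t.
    single (fst x \<otimes>\<^bsub>M\<^esub> fst y, snd x \<otimes>\<^bsub>N\<^esub> snd y)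
      (lookup s x * lookup t y))"
    by (simp add: free_tensor_def case_prod_beta)
  also have "\<dots> = (\<Sum>x\<in>keys s. \<Sum>y\<in>B.
    single (fst x \<otimes>\<^bsub>M\<^esub> fst y, snd x \<otimes>\<^bsub>N\<^esub> snd y)
      (lookup s x * lookup t y))"
    by (intro sum.cong sum.mono_neutral_left) (use assms in \<open>auto simp: in_keys_iff\<close>)
  also have "\<dots> = (\<Sum>x\<in>A. \<Sum>y\<in>B.
    single (fst x \<otimes>\<^bsub>M\<^esub> fst y, snd x \<otimes>\<^bsub>N\<^esub> snd y)
      (lookup s x * lookup t y))"
    by (intro sum.mono_neutral_left) (use assms in \<open>auto simp: in_keys_iff\<close>)
  finally show ?thesis .
qed

lemma free_tensor_mult_add_left:
  "(s + s') \<otimes>\<^bsub>free_tensor M N\<^esub> t = s \<otimes>\<^bsub>free_tensor M N\<^esub> t + s' \<otimes>\<^bsub>free_tensor M N\<^esub> t"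
proof -
  let ?A = "keys s \<union> keys s'"
  note S = free_tensor_mult_superset[of ?A "keys t", OF _ _ _ subset_refl]
  show ?thesis
    using keys_add[of s s']
    by (simp add: S lookup_add distrib_right single_add sum.distrib)
qed

lemma free_tensor_mult_add_right:
  "s \<otimes>\<^bsub>free_tensor M N\<^esub> (t + t') = s \<otimes>\<^bsub>free_tensor M N\<^esub> t + s \<otimes>\<^bsub>free_tensor M N\<^esub> t'"
proof -
  let ?A = "keys t \<union> keys t'"
  note S = free_tensor_mult_superset[of "keys s" ?A, OF _ _ subset_refl]
  show ?thesis
    using keys_add[of t t']
    by (simp add: S lookup_add distrib_left single_add sum.distrib)
qed

lemma cscale_sum: "cscale c (sum f A) = (\<Sum>x\<in>A. cscale c (f x))"
  by (rule free_cvs.scale_sum_right)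

lemma free_tensor_mult_cscale_left:
  "cscale c s \<otimes>\<^bsub>free_tensor M N\<^esub> t = cscale c (s \<otimes>\<^bsub>free_tensor M N\<^esub> t)"
  using free_tensor_mult_superset[OF finite_keys finite_keys keys_cscale subset_refl, of M N c s t]
  by (simp add: free_tensor_mult_superset[OF finite_keys finite_keys subset_refl subset_refl]
      cscale_sum mult.assoc)

lemma free_tensor_mult_cscale_right:
  "s \<otimes>\<^bsub>free_tensor M N\<^esub> cscale c t = cscale c (s \<otimes>\<^bsub>free_tensor M N\<^esub> t)"
  using free_tensor_mult_superset[OF finite_keys finite_keys subset_refl keys_cscale, of M N s c t]
  by (simp add: free_tensor_mult_superset[OF finite_keys finite_keys subset_refl subset_refl]
      cscale_sum mult.left_commute)

lemma free_tensor_mult_zero [simp]: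
  "0 \<otimes>\<^bsub>free_tensor M N\<^esub> t = 0" "t \<otimes>\<^bsub>free_tensor M N\<^esub> 0 = 0"
  by (simp_all add: free_tensor_def)

lemma free_tensor_mult_diff_left:
  "(s - s') \<otimes>\<^bsub>free_tensor M N\<^esub> t = s \<otimes>\<^bsub>free_tensor M N\<^esub> t - s' \<otimes>\<^bsub>free_tensor M N\<^esub> t"
  using free_tensor_mult_add_left[of M N "s - s'" s' t] by (simp add: algebra_simps)

lemma free_tensor_mult_diff_right:
  "s \<otimes>\<^bsub>free_tensor M N\<^esub> (t - t') = s \<otimes>\<^bsub>free_tensor M N\<^esub> t - s \<otimes>\<^bsub>free_tensor M N\<^esub> t'"
  using free_tensor_mult_add_right[of M N s "t - t'" t'] by (simp add: algebra_simps)

lemma free_tensor_mult_single [simp]: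
  "single (x, y) c \<otimes>\<^bsub>free_tensor M N\<^esub> single (x', y') d =
    single (x \<otimes>\<^bsub>M\<^esub> x', y \<otimes>\<^bsub>N\<^esub> y') (c * d)"
  by (cases "c = 0"; cases "d = 0") (simp_all add: free_tensor_def)

text \<open>The free vector space on \<open>carrier M \<times> carrier N\<close> is the monoid algebra of the product of the two
  multiplicative monoids, so the ring axioms reduce to point masses.\<close>

lemma free_tensor_algebra:
  assumes "complex_algebra M" "complex_algebra N"
  shows "complex_algebra (free_tensor M N)"
proof -
  interpret M: complex_algebra M by fact
  interpret N: complex_algebra N by fact
  let ?F = "free_tensor M N"
  let ?K = "carrier M \<times> carrier N"
  interpret F: cspace ?F by (rule free_tensor_cspace)
  have single: "single (x, y) c \<in> carrier ?F \<longleftrightarrow> x \<in> carrier M \<and> y \<in> carrier N \<or> c = 0" for x y c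
    by (auto simp: free_tensor_simps)
  have closed: "s \<otimes>\<^bsub>?F\<^esub> t \<in> carrier ?F" if s: "s \<in> carrier ?F" and t: "t \<in> carrier ?F" for s t
  proof -
    have "keys s \<subseteq> ?K" using s by (simp add: free_tensor_simps)
    then show ?thesis
    proof (induction rule: poly_mapping_keys_induct)
      case zero
      then show ?case by (simp add: free_tensor_simps)
    next
      case (add x c s)
      have "keys t \<subseteq> ?K" using t by (simp add: free_tensor_simps)
      then have "single x c \<otimes>\<^bsub>?F\<^esub> t \<in> carrier ?F"
      proof (induction rule: poly_mapping_keys_induct)
        case zero
        then show ?case by (simp add: free_tensor_simps)
      next
        case (add y d t)
        then have "single x c \<otimes>\<^bsub>?F\<^esub> single y d \<in> carrier ?F"
          using \<open>x \<in> ?K\<close> by (auto simp: single)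
        with add show ?case
          using F.a_closed by (simp add: free_tensor_mult_add_right free_tensor_simps(4))
      qed
      with add show ?case
        using F.a_closed by (simp add: free_tensor_mult_add_left free_tensor_simps(4))
    qed
  qed
  have assoc: "(s \<otimes>\<^bsub>?F\<^esub> t) \<otimes>\<^bsub>?F\<^esub> u = s \<otimes>\<^bsub>?F\<^esub> (t \<otimes>\<^bsub>?F\<^esub> u)"
    if s: "s \<in> carrier ?F" and t: "t \<in> carrier ?F" and u: "u \<in> carrier ?F" for s t u
  proof -
    have "keys s \<subseteq> ?K" using s by (simp add: free_tensor_simps)
    then show ?thesis
    proof (induction rule: poly_mapping_keys_induct)
      case (add x c s)
      note x = \<open>x \<in> ?K\<close>
      have "keys t \<subseteq> ?K" using t by (simp add: free_tensor_simps)
      then have "(single x c \<otimes>\<^bsub>?F\<^esub> t) \<otimes>\<^bsub>?F\<^esub> u = single x c \<otimes>\<^bsub>?F\<^esub> (t \<otimes>\<^bsub>?F\<^esub> u)"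
      proof (induction rule: poly_mapping_keys_induct)
        case (add y d t)
        note y = \<open>y \<in> ?K\<close>
        have "keys u \<subseteq> ?K" using u by (simp add: free_tensor_simps)
        then have "(single x c \<otimes>\<^bsub>?F\<^esub> single y d) \<otimes>\<^bsub>?F\<^esub> u =
            single x c \<otimes>\<^bsub>?F\<^esub> (single y d \<otimes>\<^bsub>?F\<^esub> u)"
        proof (induction rule: poly_mapping_keys_induct)
          case (add z e u)
          then show ?case
            using x y by (cases x; cases y; cases z)
              (auto simp: free_tensor_mult_add_right M.m_assoc N.m_assoc mult.assoc)
        qed simp
        with add show ?case by (simp add: free_tensor_mult_add_right free_tensor_mult_add_left)
      qed simp
      with add show ?case by (simp add: free_tensor_mult_add_left)
    qed simp
  qed
  have one: "\<one>\<^bsub>?F\<^esub> \<otimes>\<^bsub>?F\<^esub> s = s" "s \<otimes>\<^bsub>?F\<^esub> \<one>\<^bsub>?F\<^esub> = s" if s: "s \<in> carrier ?F" for s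
  proof -
    have "keys s \<subseteq> ?K" using s by (simp add: free_tensor_simps)
    then have "\<one>\<^bsub>?F\<^esub> \<otimes>\<^bsub>?F\<^esub> s = s \<and> s \<otimes>\<^bsub>?F\<^esub> \<one>\<^bsub>?F\<^esub> = s"
    proof (induction rule: poly_mapping_keys_induct)
      case (add x c s)
      then show ?case
        by (cases x) (auto simp: free_tensor_mult_add_left free_tensor_mult_add_right free_tensor_simps)
    qed (simp add: free_tensor_simps)
    then show "\<one>\<^bsub>?F\<^esub> \<otimes>\<^bsub>?F\<^esub> s = s" "s \<otimes>\<^bsub>?F\<^esub> \<one>\<^bsub>?F\<^esub> = s" by auto
  qed
  show ?thesis
    by (rule complex_algebraI[OF free_tensor_cspace])
       (use closed assoc one in \<open>auto simp: single free_tensor_simps(2,4,5) free_tensor_mult_add_left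
          free_tensor_mult_add_right free_tensor_mult_cscale_left free_tensor_mult_cscale_right\<close>)
qed

section \<open>Tensor products as vector spaces\<close>

definition cbilinear ::
  "(complex, 'a, 'm) module_scheme \<Rightarrow> (complex, 'b, 'n) module_scheme \<Rightarrow>
    (complex, 'u, 'k) module_scheme \<Rightarrow> ('a \<Rightarrow> 'b \<Rightarrow> 'u) \<Rightarrow> bool"
  where "cbilinear M N U f \<longleftrightarrow>
    (\<forall>x\<in>carrier M. linmap N U (f x)) \<and> (\<forall>y\<in>carrier N. linmap M U (\<lambda>x. f x y))"

lemma cbilinearI:
  assumes "\<And>x. x \<in> carrier M \<Longrightarrow> linmap N U (f x)" "\<And>y. y \<in> carrier N \<Longrightarrow> linmap M U (\<lambda>x. f x y)"
  shows "cbilinear M N U f"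
  using assms by (auto simp: cbilinear_def)

lemma cbilinearD:
  assumes "cbilinear M N U f" "x \<in> carrier M" "y \<in> carrier N"
  shows "f x y \<in> carrier U" "linmap N U (f x)" "linmap M U (\<lambda>x. f x y)"
  using assms by (auto simp: cbilinear_def semilinear_def)

lemma bilinear_relsI:
  "\<lbrakk>x \<in> carrier M; x' \<in> carrier M; y \<in> carrier N\<rbrakk> \<Longrightarrow>
    free_pair (x \<oplus>\<^bsub>M\<^esub> x') y - free_pair x y - free_pair x' y \<in> bilinear_rels M N"
  "\<lbrakk>x \<in> carrier M; y \<in> carrier N; y' \<in> carrier N\<rbrakk> \<Longrightarrow>
    free_pair x (y \<oplus>\<^bsub>N\<^esub> y') - free_pair x y - free_pair x y' \<in> bilinear_rels M N"
  "\<lbrakk>x \<in> carrier M; y \<in> carrier N\<rbrakk> \<Longrightarrow>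
    free_pair (c \<odot>\<^bsub>M\<^esub> x) y - cscale c (free_pair x y) \<in> bilinear_rels M N"
  "\<lbrakk>x \<in> carrier M; y \<in> carrier N\<rbrakk> \<Longrightarrow>
    free_pair x (c \<odot>\<^bsub>N\<^esub> y) - cscale c (free_pair x y) \<in> bilinear_rels M N"
  unfolding bilinear_rels_def by blast+

lemma bilinear_relsE [consumes 1]:
  assumes "r \<in> bilinear_rels M N"
  obtains (add_left) x x' y where "r = free_pair (x \<oplus>\<^bsub>M\<^esub> x') y - free_pair x y - free_pair x' y"
      "x \<in> carrier M" "x' \<in> carrier M" "y \<in> carrier N"
  | (add_right) x y y' where "r = free_pair x (y \<oplus>\<^bsub>N\<^esub> y') - free_pair x y - free_pair x y'"
      "x \<in> carrier M" "y \<in> carrier N" "y' \<in> carrier N"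
  | (smult_left) c x y where "r = free_pair (c \<odot>\<^bsub>M\<^esub> x) y - cscale c (free_pair x y)"
      "x \<in> carrier M" "y \<in> carrier N"
  | (smult_right) c x y where "r = free_pair x (c \<odot>\<^bsub>N\<^esub> y) - cscale c (free_pair x y)"
      "x \<in> carrier M" "y \<in> carrier N"
  using assms unfolding bilinear_rels_def by (elim UnE CollectE exE conjE) metis+

text \<open>The set \<open>R\<close> of relations is the set of bilinearity relations for \<open>M \<otimes> N\<close>, and contains the balancing
  relations as well for the tensor product over a subalgebra.\<close>

locale tensor_space = M: cspace M + N: cspace N
  for M :: "(complex, 'a, 'm) module_scheme" and N :: "(complex, 'b, 'n) module_scheme" +
  fixes R :: "('a \<times> 'b \<Rightarrow>\<^sub>0 complex) set"
  assumes rels: "bilinear_rels M N \<subseteq> R" "R \<subseteq> carrier (free_tensor M N)"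
begin

abbreviation "F \<equiv> free_tensor M N"
abbreviation "W \<equiv> free_cvs.span R"
abbreviation "T \<equiv> quot_alg F W"
definition "pu x y = W +>\<^bsub>F\<^esub> free_pair x y"

lemma subspace_carrier: "free_cvs.subspace (carrier F)"
  by (auto simp: free_cvs.subspace_def free_tensor_simps
      intro!: keys_add_subset keys_cscale_subset del: subsetI)

lemma span_csub: "linear_sub F W"
  using free_cvs.span_minimal[OF rels(2) subspace_carrier]
  by (auto simp: linear_sub_def free_tensor_simps(3-5) free_cvs.span_zero free_cvs.span_add free_cvs.span_scale)

sublocale Q: cspace_quot F W
  by (rule cspace_quot.intro[OF free_tensor_cspace]) (unfold_locales, rule span_csub)

lemma free_pair_closed: "\<lbrakk>x \<in> carrier M; y \<in> carrier N\<rbrakk> \<Longrightarrow> free_pair x y \<in> carrier F"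
  by (simp add: free_tensor_simps)

lemma pu_closed [simp]: "\<lbrakk>x \<in> carrier M; y \<in> carrier N\<rbrakk> \<Longrightarrow> pu x y \<in> carrier T"
  by (simp add: pu_def free_pair_closed)

lemma rel_eq:
  assumes "s \<in> carrier F" "t \<in> carrier F" "s - t \<in> R"
  shows "W +>\<^bsub>F\<^esub> s = W +>\<^bsub>F\<^esub> t"
  using assms by (subst Q.Q_eq) (auto simp: free_tensor_diff intro: free_cvs.span_base)

lemma pu_add_left:
  assumes "x \<in> carrier M" "x' \<in> carrier M" "y \<in> carrier N"
  shows "pu (x \<oplus>\<^bsub>M\<^esub> x') y = pu x y \<oplus>\<^bsub>T\<^esub> pu x' y"
proof -
  have "free_pair (x \<oplus>\<^bsub>M\<^esub> x') y - free_pair x y - free_pair x' y \<in> R"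
    using assms by (intro subsetD[OF rels(1)] bilinear_relsI)
  then have "W +>\<^bsub>F\<^esub> free_pair (x \<oplus>\<^bsub>M\<^esub> x') y = W +>\<^bsub>F\<^esub> (free_pair x y \<oplus>\<^bsub>F\<^esub> free_pair x' y)"
    using assms by (intro rel_eq Q.a_closed free_pair_closed) (auto simp: free_tensor_simps(4) diff_diff_eq)
  then show ?thesis using assms by (simp add: pu_def free_pair_closed)
qed

lemma pu_add_right:
  assumes "x \<in> carrier M" "y \<in> carrier N" "y' \<in> carrier N"
  shows "pu x (y \<oplus>\<^bsub>N\<^esub> y') = pu x y \<oplus>\<^bsub>T\<^esub> pu x y'"
proof -
  have "free_pair x (y \<oplus>\<^bsub>N\<^esub> y') - free_pair x y - free_pair x y' \<in> R"
    using assms by (intro subsetD[OF rels(1)] bilinear_relsI)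
  then have "W +>\<^bsub>F\<^esub> free_pair x (y \<oplus>\<^bsub>N\<^esub> y') = W +>\<^bsub>F\<^esub> (free_pair x y \<oplus>\<^bsub>F\<^esub> free_pair x y')"
    using assms by (intro rel_eq Q.a_closed free_pair_closed) (auto simp: free_tensor_simps(4) diff_diff_eq)
  then show ?thesis using assms by (simp add: pu_def free_pair_closed)
qed

lemma pu_smult_left:
  assumes "x \<in> carrier M" "y \<in> carrier N"
  shows "pu (c \<odot>\<^bsub>M\<^esub> x) y = c \<odot>\<^bsub>T\<^esub> pu x y"
proof -
  have "free_pair (c \<odot>\<^bsub>M\<^esub> x) y - cscale c (free_pair x y) \<in> R"
    using assms by (intro subsetD[OF rels(1)] bilinear_relsI)
  then have "W +>\<^bsub>F\<^esub> free_pair (c \<odot>\<^bsub>M\<^esub> x) y = W +>\<^bsub>F\<^esub> (c \<odot>\<^bsub>F\<^esub> free_pair x y)"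
    using assms by (intro rel_eq Q.smultC free_pair_closed) (auto simp: free_tensor_simps(5))
  then show ?thesis using assms by (simp add: pu_def free_pair_closed)
qed

lemma pu_smult_right:
  assumes "x \<in> carrier M" "y \<in> carrier N"
  shows "pu x (c \<odot>\<^bsub>N\<^esub> y) = c \<odot>\<^bsub>T\<^esub> pu x y"
proof -
  have "free_pair x (c \<odot>\<^bsub>N\<^esub> y) - cscale c (free_pair x y) \<in> R"
    using assms by (intro subsetD[OF rels(1)] bilinear_relsI)
  then have "W +>\<^bsub>F\<^esub> free_pair x (c \<odot>\<^bsub>N\<^esub> y) = W +>\<^bsub>F\<^esub> (c \<odot>\<^bsub>F\<^esub> free_pair x y)"
    using assms by (intro rel_eq Q.smultC free_pair_closed) (auto simp: free_tensor_simps(5))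
  then show ?thesis using assms by (simp add: pu_def free_pair_closed)
qed

lemma pu_bilinear: "cbilinear M N T pu"
  by (intro cbilinearI semilinearI)
     (auto simp: pu_add_left pu_add_right pu_smult_left pu_smult_right)

lemma T_cspace: "cspace T"
  by (rule Q.Q_cspace)

lemma T_span: "z \<in> carrier T \<Longrightarrow> z \<in> cspan T {pu x y | x y. x \<in> carrier M \<and> y \<in> carrier N}"
proof -
  assume z: "z \<in> carrier T"
  let ?S = "{free_pair x y | x y. x \<in> carrier M \<and> y \<in> carrier N}"
  have S: "?S \<subseteq> carrier F" by (auto simp: free_pair_closed)
  have "t \<in> cspan F ?S" if "t \<in> carrier F" for t
  proof -
    have "keys t \<subseteq> carrier M \<times> carrier N" using that by (simp add: free_tensor_simps)
    then show ?thesis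
    proof (induction rule: poly_mapping_keys_induct)
      case zero
      then show ?case using cspan.zero[of F ?S] by (simp add: free_tensor_simps)
    next
      case (add x c t)
      then obtain u v where uv: "x = (u, v)" "u \<in> carrier M" "v \<in> carrier N" by auto
      then have "c \<odot>\<^bsub>F\<^esub> free_pair u v \<oplus>\<^bsub>F\<^esub> t \<in> cspan F ?S"
        using add by (intro cspan.step) auto
      then show ?case using uv by (simp add: free_tensor_simps)
    qed
  qed
  then have "z \<in> cspan T ((\<lambda>x. W +>\<^bsub>F\<^esub> x) ` ?S)"
    using z S by (intro Q.Q_in_cspan) auto
  also have "(\<lambda>x. W +>\<^bsub>F\<^esub> x) ` ?S = {pu x y | x y. x \<in> carrier M \<and> y \<in> carrier N}"
    by (auto simp: pu_def)
  finally show ?thesis .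
qed

lemma T_span_spanning:
  assumes S: "SM \<subseteq> carrier M" "carrier M \<subseteq> cspan M SM" "SN \<subseteq> carrier N" "carrier N \<subseteq> cspan N SN"
    and z: "z \<in> carrier T"
  shows "z \<in> cspan T {pu x y | x y. x \<in> SM \<and> y \<in> SN}"
proof -
  interpret T: cspace T by (rule T_cspace)
  let ?S = "{pu x y | x y. x \<in> SM \<and> y \<in> SN}"
  have c: "?S \<subseteq> carrier T" using S by (auto intro!: pu_closed)
  have 1: "pu x y \<in> cspan T ?S" if "x \<in> SM" "y \<in> carrier N" for x y
    by (rule semilinear_cspan[of "\<lambda>c. c" N T "pu x" SN])
       (use S that c cbilinearD[OF pu_bilinear, of x y] N.cspace_axioms T_cspace in \<open>auto intro!: T.cspan_base\<close>)
  have 2: "pu x y \<in> cspan T ?S" if "x \<in> carrier M" "y \<in> carrier N" for x y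
    by (rule semilinear_cspan[of "\<lambda>c. c" M T "\<lambda>x. pu x y" SM])
       (use S that c cbilinearD[OF pu_bilinear, of x y] M.cspace_axioms T_cspace 1 in auto)
  show ?thesis
    using T_span[OF z] T.cspan_subset[OF c, of "{pu x y | x y. x \<in> carrier M \<and> y \<in> carrier N}"] 2 by blast
qed

text \<open>The working principle for identities between maps on tensor products: it is enough to test them
  on pure tensors of elements from spanning sets.\<close>

lemma T_ext:
  assumes "semilinear \<sigma> T U f" "semilinear \<sigma> T U g" "cspace U"
    and "SM \<subseteq> carrier M" "carrier M \<subseteq> cspan M SM" "SN \<subseteq> carrier N" "carrier N \<subseteq> cspan N SN"
    and "\<And>x y. \<lbrakk>x \<in> SM; y \<in> SN\<rbrakk> \<Longrightarrow> f (pu x y) = g (pu x y)" "z \<in> carrier T"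
  shows "f z = g z"
  by (rule semilinear_ext[OF assms(1,2) T_cspace assms(3) _ _ T_span_spanning[OF assms(4-7,9)]])
     (use assms in \<open>auto intro!: pu_closed\<close>)

lemma tensor_lift_qlift: "tensor_lift U f = qlift (lin U (case_prod f))"
  by (rule ext) (simp add: tensor_lift_def qlift_def lin_def case_prod_beta')

text \<open>The universal property: a bilinear map descends to the quotient when it also kills the relations
  beyond bilinearity.\<close>

context
  fixes U :: "(complex, 'u, 'k) module_scheme" and f
  assumes U: "cspace U" and bil: "cbilinear M N U f"
    and extra: "\<And>r. r \<in> R \<Longrightarrow> r \<in> bilinear_rels M N \<or> lin U (case_prod f) r = \<zero>\<^bsub>U\<^esub>"
begin

interpretation U: cspace U by (rule U)

lemma lin_closed_pair: "case_prod f \<in> carrier M \<times> carrier N \<rightarrow> carrier U"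
  using cbilinearD(1)[OF bil] by auto

lemma lin_linmap: "linmap F U (lin U (case_prod f))"
  by (rule semilinearI)
     (auto simp: free_tensor_simps U.lin_closed[OF lin_closed_pair] U.lin_add[OF lin_closed_pair]
        U.lin_cscale[OF lin_closed_pair])

lemma lin_rels: "r \<in> R \<Longrightarrow> lin U (case_prod f) r = \<zero>\<^bsub>U\<^esub>"
proof -
  assume r: "r \<in> R"
  have fp: "lin U (case_prod f) (free_pair x y) = f x y" if "x \<in> carrier M" "y \<in> carrier N" for x y
    using cbilinearD(1)[OF bil that] by simp
  have diff: "lin U (case_prod f) (s - t) = lin U (case_prod f) s \<ominus>\<^bsub>U\<^esub> lin U (case_prod f) t"
    if "s \<in> carrier F" "t \<in> carrier F" for s t
    using semilinear_minus[OF lin_linmap free_tensor_cspace U that] that by (simp add: free_tensor_diff)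
  have scale: "lin U (case_prod f) (cscale c t) = c \<odot>\<^bsub>U\<^esub> lin U (case_prod f) t" if "t \<in> carrier F" for c t
    using semilinearD(3)[OF lin_linmap that] by (simp add: free_tensor_simps)
  have d: "s - t \<in> carrier F" if "s \<in> carrier F" "t \<in> carrier F" for s t
    using that free_tensor_diff Q.M.minus_closed by metis
  have s: "cscale c t \<in> carrier F" if "t \<in> carrier F" for c t
    using that Q.smultC by (simp add: free_tensor_simps)
  note bD = cbilinearD[OF bil]
  note D1 = semilinearD[OF bD(2)] note D2 = semilinearD[OF bD(3)]
  have *: "a \<oplus>\<^bsub>U\<^esub> b \<ominus>\<^bsub>U\<^esub> a \<ominus>\<^bsub>U\<^esub> b = \<zero>\<^bsub>U\<^esub>" if "a \<in> carrier U" "b \<in> carrier U" for a b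
    using that by (simp add: U.minus_eq U.a_comm[of a b] U.a_assoc U.r_neg)
  have **: "a \<ominus>\<^bsub>U\<^esub> a = \<zero>\<^bsub>U\<^esub>" if "a \<in> carrier U" for a
    using that by (simp add: U.minus_eq U.r_neg)
  from extra[OF r] show ?thesis
  proof
    assume "r \<in> bilinear_rels M N"
    then show ?thesis
    proof (cases rule: bilinear_relsE)
      case (add_left x x' y)
      then show ?thesis
        by (simp add: diff fp free_pair_closed d semilinearD[OF bD(3)] bD(1) *)
    next
      case (add_right x y y')
      then show ?thesis
        by (simp add: diff fp free_pair_closed d semilinearD[OF bD(2)] bD(1) *)
    next
      case (smult_left c x y)
      then show ?thesis
        by (simp add: diff fp scale s free_pair_closed d semilinearD[OF bD(3)] bD(1) ** del: cscale_simps)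
    next
      case (smult_right c x y)
      then show ?thesis
        by (simp add: diff fp scale s free_pair_closed d semilinearD[OF bD(2)] bD(1) ** del: cscale_simps)
    qed
  qed
qed

lemma lin_W: "w \<in> W \<Longrightarrow> lin U (case_prod f) w = \<zero>\<^bsub>U\<^esub>"
proof -
  assume w: "w \<in> W"
  have "W \<subseteq> {t \<in> carrier F. lin U (case_prod f) t = \<zero>\<^bsub>U\<^esub>}"
  proof (rule free_cvs.span_minimal)
    show "free_cvs.subspace {t \<in> carrier F. lin U (case_prod f) t = \<zero>\<^bsub>U\<^esub>}"
      using subspace_carrier semilinearD[OF lin_linmap]
      by (auto simp: free_cvs.subspace_def free_tensor_simps(3-5))
  qed (use rels lin_rels in auto)
  then show ?thesis using w by auto
qed

lemma tensor_lift_pu: "\<lbrakk>x \<in> carrier M; y \<in> carrier N\<rbrakk> \<Longrightarrow> tensor_lift U f (pu x y) = f x y"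
  unfolding tensor_lift_qlift pu_def
  using qlift_coset[OF lin_linmap Q.cspace_quot_axioms U lin_W, of "free_pair x y"] cbilinearD(1)[OF bil]
  by (simp add: free_pair_closed)

lemma tensor_lift_linmap: "linmap T U (tensor_lift U f)"
  unfolding tensor_lift_qlift
  by (rule qlift_semilinear[OF lin_linmap Q.cspace_quot_axioms U lin_W])

end

end


lemma tensor_space_bilinear:
  assumes "cspace M" "cspace N"
  shows "tensor_space M N (bilinear_rels M N)"
proof -
  interpret M: cspace M by fact
  interpret N: cspace N by fact
  have c: "free_cvs.subspace (carrier (free_tensor M N))"
    by (auto simp: free_cvs.subspace_def free_tensor_simps
      intro!: keys_add_subset keys_cscale_subset del: subsetI)
  have p: "free_pair x y \<in> carrier (free_tensor M N)" if "x \<in> carrier M" "y \<in> carrier N" for x y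
    using that by (simp add: free_tensor_simps)
  show ?thesis
  proof
    show "bilinear_rels M N \<subseteq> carrier (free_tensor M N)"
      unfolding bilinear_rels_def
      by (intro Un_least subsetI; elim CollectE exE conjE; hypsubst;
          intro free_cvs.subspace_diff[OF c] free_cvs.subspace_scale[OF c] p) auto
  qed auto
qed

lemma tensor_space_balanced:
  assumes "complex_algebra A" "B \<subseteq> carrier A"
  shows "tensor_space A A (bilinear_rels A A \<union> balanced_rels A B)"
proof -
  interpret A: complex_algebra A by fact
  interpret T: tensor_space A A "bilinear_rels A A"
    by (rule tensor_space_bilinear) (rule A.cspace_axioms)+
  have "balanced_rels A B \<subseteq> carrier (free_tensor A A)"
    unfolding balanced_rels_def using assms(2)
    by (auto intro!: free_cvs.subspace_diff[OF T.subspace_carrier] T.free_pair_closed simp del: free_tensor_simps)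
  then show ?thesis
    using T.rels by unfold_locales auto
qed

locale tensor_pair = M: cspace M + N: cspace N
  for M :: "(complex, 'a, 'm) module_scheme" and N :: "(complex, 'b, 'n) module_scheme"
begin

sublocale tensor_space M N "bilinear_rels M N"
  by (rule tensor_space_bilinear) (rule M.cspace_axioms N.cspace_axioms)+

lemma tensor_eq: "tensor M N = T"
  by (simp add: tensor_def)

lemma pure_eq: "pure M N = pu"
  by (simp add: pure_def pu_def fun_eq_iff)

lemmas tensor_cspace = T_cspace[folded tensor_eq]
lemmas pure_closed [simp] = pu_closed[folded tensor_eq pure_eq]
lemmas pure_bilinear = pu_bilinear[folded tensor_eq pure_eq]
lemmas pure_add_left = pu_add_left[folded tensor_eq pure_eq]
lemmas pure_add_right = pu_add_right[folded tensor_eq pure_eq]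
lemmas pure_smult_left = pu_smult_left[folded tensor_eq pure_eq]
lemmas pure_smult_right = pu_smult_right[folded tensor_eq pure_eq]
lemmas tensor_ext = T_ext[folded tensor_eq pure_eq]

lemma lift_linmap: "\<lbrakk>cspace U; cbilinear M N U f\<rbrakk> \<Longrightarrow> linmap (tensor M N) U (tensor_lift U f)"
  unfolding tensor_eq by (rule tensor_lift_linmap; (rule disjI1)?; assumption)

lemma lift_pure [simp]: "\<lbrakk>cspace U; cbilinear M N U f; x \<in> carrier M; y \<in> carrier N\<rbrakk> \<Longrightarrow>
    tensor_lift U f (pure M N x y) = f x y"
  unfolding pure_eq by (rule tensor_lift_pu) auto

end

lemma cbilinear_comp:
  assumes "cbilinear M N U h" "linmap M' M f" "linmap N' N g"
  shows "cbilinear M' N' U (\<lambda>x y. h (f x) (g y))"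
  using assms unfolding cbilinear_def semilinear_def Pi_iff by simp

lemma cbilinear_post:
  assumes "cbilinear M N U h" "linmap U V f"
  shows "cbilinear M N V (\<lambda>x y. f (h x y))"
  using assms unfolding cbilinear_def semilinear_def Pi_iff by simp

lemma tensor_map_linmap:
  assumes "cspace M" "cspace N" "cspace M'" "cspace N'" "linmap M' M f" "linmap N' N g"
  shows "linmap (tensor M' N') (tensor M N) (tensor_map M N f g)"
    and "\<lbrakk>x \<in> carrier M'; y \<in> carrier N'\<rbrakk> \<Longrightarrow> tensor_map M N f g (pure M' N' x y) = pure M N (f x) (g y)"
proof -
  interpret T: tensor_pair M N using assms by (simp add: tensor_pair_def)
  interpret T': tensor_pair M' N' using assms by (simp add: tensor_pair_def)
  note b = cbilinear_comp[OF T.pure_bilinear assms(5,6)]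
  show "linmap (tensor M' N') (tensor M N) (tensor_map M N f g)"
    unfolding tensor_map_def by (rule T'.lift_linmap[OF T.tensor_cspace b])
  show "\<lbrakk>x \<in> carrier M'; y \<in> carrier N'\<rbrakk> \<Longrightarrow> tensor_map M N f g (pure M' N' x y) = pure M N (f x) (g y)"
    unfolding tensor_map_def by (rule T'.lift_pure[OF T.tensor_cspace b])
qed

text \<open>The inner lift has to be bilinear in the element of \<open>L \<otimes> M\<close> and the element \<open>z\<close> of \<open>N\<close>. Linearity
  in \<open>z\<close> is a statement about lifts and is tested on pure tensors.\<close>

lemma tensor_assoc_linmap:
  assumes "cspace L" "cspace M" "cspace N"
  shows "linmap (tensor (tensor L M) N) (tensor L (tensor M N)) (tensor_assoc L M N)"
    and "\<lbrakk>x \<in> carrier L; y \<in> carrier M; z \<in> carrier N\<rbrakk> \<Longrightarrow>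
      tensor_assoc L M N (pure (tensor L M) N (pure L M x y) z) = pure L (tensor M N) x (pure M N y z)"
proof -
  interpret LM: tensor_pair L M using assms by (simp add: tensor_pair_def)
  interpret MN: tensor_pair M N using assms by (simp add: tensor_pair_def)
  interpret L1: tensor_pair L "tensor M N" using assms MN.tensor_cspace by (simp add: tensor_pair_def)
  interpret L2: tensor_pair "tensor L M" N using assms LM.tensor_cspace by (simp add: tensor_pair_def)
  let ?U = "tensor L (tensor M N)"
  interpret U: cspace ?U by (rule L1.tensor_cspace)
  define f where "f z = tensor_lift ?U (\<lambda>x y. pure L (tensor M N) x (pure M N y z))" for z
  have b: "cbilinear L M ?U (\<lambda>x y. pure L (tensor M N) x (pure M N y z))" if "z \<in> carrier N" for z
    using MN.pure_bilinear that
    by (intro cbilinear_comp[OF L1.pure_bilinear linmap_id]) (auto simp: cbilinear_def)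
  have f1: "linmap (tensor L M) ?U (f z)" if "z \<in> carrier N" for z
    unfolding f_def by (rule LM.lift_linmap[OF U.cspace_axioms b[OF that]])
  have f2: "f z (pure L M x y) = pure L (tensor M N) x (pure M N y z)"
    if "x \<in> carrier L" "y \<in> carrier M" "z \<in> carrier N" for x y z
    unfolding f_def using that by (intro LM.lift_pure[OF U.cspace_axioms b])
  have f3: "f (z \<oplus>\<^bsub>N\<^esub> z') t = f z t \<oplus>\<^bsub>?U\<^esub> f z' t"
    if t: "t \<in> carrier (tensor L M)" and z: "z \<in> carrier N" "z' \<in> carrier N" for t z z'
  proof (rule LM.tensor_ext[of "\<lambda>c. c" ?U "f (z \<oplus>\<^bsub>N\<^esub> z')" "\<lambda>t. f z t \<oplus>\<^bsub>?U\<^esub> f z' t" "carrier L" "carrier M"])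
    show "linmap (tensor L M) ?U (\<lambda>t. f z t \<oplus>\<^bsub>?U\<^esub> f z' t)"
      using semilinearD[OF f1[OF z(1)]] semilinearD[OF f1[OF z(2)]]
      by (intro semilinearI) (auto simp: U.a_ac U.smult_add_right)
  qed (use t z in \<open>auto simp: f1 f2 MN.pure_add_right L1.pure_add_right U.cspace_axioms intro: LM.M.cspan_base LM.N.cspan_base\<close>)
  have f4: "f (c \<odot>\<^bsub>N\<^esub> z) t = c \<odot>\<^bsub>?U\<^esub> f z t"
    if t: "t \<in> carrier (tensor L M)" and z: "z \<in> carrier N" for t z c
  proof (rule LM.tensor_ext[of "\<lambda>c. c" ?U "f (c \<odot>\<^bsub>N\<^esub> z)" "\<lambda>t. c \<odot>\<^bsub>?U\<^esub> f z t" "carrier L" "carrier M"])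
    show "linmap (tensor L M) ?U (\<lambda>t. c \<odot>\<^bsub>?U\<^esub> f z t)"
      using semilinearD[OF f1[OF z]]
      by (intro semilinearI) (auto simp: U.smult_add_right U.smult_smult mult.commute)
  qed (use t z in \<open>auto simp: f1 f2 MN.pure_smult_right L1.pure_smult_right U.cspace_axioms intro: LM.M.cspan_base LM.N.cspan_base\<close>)
  have b2: "cbilinear (tensor L M) N ?U (\<lambda>t z. f z t)"
    using f1 f3 f4 semilinearD(1)[OF f1] by (intro cbilinearI) (auto intro!: semilinearI)
  have a: "tensor_assoc L M N = tensor_lift ?U (\<lambda>t z. f z t)"
    by (simp add: tensor_assoc_def f_def)
  show "linmap (tensor (tensor L M) N) ?U (tensor_assoc L M N)"
    unfolding a by (rule L2.lift_linmap[OF U.cspace_axioms b2])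
  show "\<lbrakk>x \<in> carrier L; y \<in> carrier M; z \<in> carrier N\<rbrakk> \<Longrightarrow>
      tensor_assoc L M N (pure (tensor L M) N (pure L M x y) z) = pure L (tensor M N) x (pure M N y z)"
    unfolding a by (subst L2.lift_pure[OF U.cspace_axioms b2]) (auto simp: f2)
qed

section \<open>Tensor products of algebras\<close>

locale tensor_algebras = M: complex_algebra M + N: complex_algebra N
  for M :: "(complex, 'a, 'm) module_scheme" and N :: "(complex, 'b, 'n) module_scheme"
begin

sublocale tensor_pair M N
  by unfold_locales

text \<open>Multiplying a bilinearity relation by a pair from either side gives a bilinearity relation again.\<close>

lemma free_ideal: "ideal W F"
proof -
  interpret F: complex_algebra F
    by (rule free_tensor_algebra) (rule M.complex_algebra_axioms N.complex_algebra_axioms)+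
  have sub: "free_cvs.subspace W" by (rule free_cvs.subspace_span)
  have left: "single p c \<otimes>\<^bsub>F\<^esub> r \<in> W" and right: "r \<otimes>\<^bsub>F\<^esub> single p c \<in> W"
    if r: "r \<in> bilinear_rels M N" and pc: "p \<in> carrier M \<times> carrier N" for p c r
  proof -
    obtain u v where p: "p = (u, v)" "u \<in> carrier M" "v \<in> carrier N" using pc by blast
    have c: "single p c = cscale c (free_pair u v)" by (simp add: p)
    have "free_pair u v \<otimes>\<^bsub>F\<^esub> r \<in> bilinear_rels M N \<and> r \<otimes>\<^bsub>F\<^esub> free_pair u v \<in> bilinear_rels M N"
      using r
    proof (cases rule: bilinear_relsE)
      case (add_left x x' y)
      then show ?thesis
        using p bilinear_relsI(1)[of "u \<otimes>\<^bsub>M\<^esub> x" M "u \<otimes>\<^bsub>M\<^esub> x'" "v \<otimes>\<^bsub>N\<^esub> y" N]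
          bilinear_relsI(1)[of "x \<otimes>\<^bsub>M\<^esub> u" M "x' \<otimes>\<^bsub>M\<^esub> u" "y \<otimes>\<^bsub>N\<^esub> v" N]
        by (simp add: free_tensor_mult_diff_left free_tensor_mult_diff_right M.l_distr M.r_distr)
    next
      case (add_right x y y')
      then show ?thesis
        using p bilinear_relsI(2)[of "u \<otimes>\<^bsub>M\<^esub> x" M "v \<otimes>\<^bsub>N\<^esub> y" N "v \<otimes>\<^bsub>N\<^esub> y'"]
          bilinear_relsI(2)[of "x \<otimes>\<^bsub>M\<^esub> u" M "y \<otimes>\<^bsub>N\<^esub> v" N "y' \<otimes>\<^bsub>N\<^esub> v"]
        by (simp add: free_tensor_mult_diff_left free_tensor_mult_diff_right N.l_distr N.r_distr)
    next
      case (smult_left d x y)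
      then show ?thesis
        using p bilinear_relsI(3)[of "u \<otimes>\<^bsub>M\<^esub> x" M "v \<otimes>\<^bsub>N\<^esub> y" N d]
          bilinear_relsI(3)[of "x \<otimes>\<^bsub>M\<^esub> u" M "y \<otimes>\<^bsub>N\<^esub> v" N d]
        by (simp add: free_tensor_mult_diff_left free_tensor_mult_diff_right
            M.smult_mult_left M.smult_mult_right)
    next
      case (smult_right d x y)
      then show ?thesis
        using p bilinear_relsI(4)[of "u \<otimes>\<^bsub>M\<^esub> x" M "v \<otimes>\<^bsub>N\<^esub> y" N d]
          bilinear_relsI(4)[of "x \<otimes>\<^bsub>M\<^esub> u" M "y \<otimes>\<^bsub>N\<^esub> v" N d]
        by (simp add: free_tensor_mult_diff_left free_tensor_mult_diff_right
            N.smult_mult_left N.smult_mult_right)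
    qed
    then show "single p c \<otimes>\<^bsub>F\<^esub> r \<in> W" "r \<otimes>\<^bsub>F\<^esub> single p c \<in> W"
      unfolding c free_tensor_mult_cscale_left free_tensor_mult_cscale_right
      by (auto intro!: free_cvs.span_scale intro: free_cvs.span_base)
  qed
  have W: "single p c \<otimes>\<^bsub>F\<^esub> w \<in> W \<and> w \<otimes>\<^bsub>F\<^esub> single p c \<in> W"
    if "w \<in> W" "p \<in> carrier M \<times> carrier N" for p c w
  proof -
    have "W \<subseteq> {w. single p c \<otimes>\<^bsub>F\<^esub> w \<in> W \<and> w \<otimes>\<^bsub>F\<^esub> single p c \<in> W}"
      by (rule free_cvs.span_minimal)
         (auto simp: left right that free_cvs.subspace_def free_tensor_mult_add_left free_tensor_mult_add_right
            free_tensor_mult_cscale_left free_tensor_mult_cscale_right free_cvs.span_zero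
            intro: free_cvs.span_add free_cvs.span_scale)
    then show ?thesis using that by blast
  qed
  have W2: "t \<otimes>\<^bsub>F\<^esub> w \<in> W \<and> w \<otimes>\<^bsub>F\<^esub> t \<in> W" if w: "w \<in> W" and t: "t \<in> carrier F" for w t
  proof -
    have "keys t \<subseteq> carrier M \<times> carrier N" using t by (simp add: free_tensor_simps)
    then show ?thesis
      by (induction rule: poly_mapping_keys_induct)
         (auto simp: free_tensor_mult_add_left free_tensor_mult_add_right free_cvs.span_zero
           W[OF w] intro!: free_cvs.span_add)
  qed
  show ?thesis
    by (rule idealI) (use W2 Q.W.a_subgroup F.ring_axioms in auto)
qed

sublocale A: algebra_quot F W
  by (intro algebra_quot.intro algebra_quot_axioms.intro free_ideal free_tensor_algebra
     M.complex_algebra_axioms N.complex_algebra_axioms)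

lemmas tensor_algebra = A.Q_algebra[folded tensor_eq]

lemma pure_mult [simp]:
  "\<lbrakk>x \<in> carrier M; x' \<in> carrier M; y \<in> carrier N; y' \<in> carrier N\<rbrakk> \<Longrightarrow>
    pure M N x y \<otimes>\<^bsub>tensor M N\<^esub> pure M N x' y' = pure M N (x \<otimes>\<^bsub>M\<^esub> x') (y \<otimes>\<^bsub>N\<^esub> y')"
  by (simp add: tensor_eq pure_eq pu_def free_pair_closed)

lemma tensor_one: "\<one>\<^bsub>tensor M N\<^esub> = pure M N \<one>\<^bsub>M\<^esub> \<one>\<^bsub>N\<^esub>"
  by (simp add: tensor_eq pure_eq pu_def A.Q_one free_tensor_simps)

end

section \<open>Star algebras\<close>

locale star_algebra = complex_algebra A for A :: "('a, 'm) star_alg_scheme" (structure) +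
  assumes star_semilinear: "semilinear cnj A A (star A)"
    and star_star [simp]: "x \<in> carrier A \<Longrightarrow> star A (star A x) = x"
    and star_mult: "\<lbrakk>x \<in> carrier A; y \<in> carrier A\<rbrakk> \<Longrightarrow> star A (x \<otimes> y) = star A y \<otimes> star A x"
begin

lemmas star_closed [simp] = semilinearD(1)[OF star_semilinear]
lemmas star_add = semilinearD(2)[OF star_semilinear]
lemmas star_smult = semilinearD(3)[OF star_semilinear]

lemma star_one [simp]: "star A \<one> = \<one>"
  by (metis one_closed r_one star_closed star_mult star_star)

lemma star_zero [simp]: "star A \<zero> = \<zero>"
  by (rule semilinear_zero[OF star_semilinear cspace_axioms cspace_axioms])

lemma star_minus: "\<lbrakk>x \<in> carrier A; y \<in> carrier A\<rbrakk> \<Longrightarrow> star A (x \<ominus> y) = star A x \<ominus> star A y"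
  by (rule semilinear_minus[OF star_semilinear cspace_axioms cspace_axioms])

end

lemma star_homD:
  assumes "f \<in> star_hom A B"
  shows "linmap A B f"
    and "\<lbrakk>x \<in> carrier A; y \<in> carrier A\<rbrakk> \<Longrightarrow> f (x \<otimes>\<^bsub>A\<^esub> y) = f x \<otimes>\<^bsub>B\<^esub> f y"
    and "f \<one>\<^bsub>A\<^esub> = \<one>\<^bsub>B\<^esub>"
    and "x \<in> carrier A \<Longrightarrow> f (star A x) = star B (f x)"
    and "x \<in> carrier A \<Longrightarrow> f x \<in> carrier B"
  using assms by (auto simp: star_hom_def alg_hom_def ring_hom_def semilinear_def)

lemma star_homI:
  assumes "linmap A B f"
    and "\<And>x y. \<lbrakk>x \<in> carrier A; y \<in> carrier A\<rbrakk> \<Longrightarrow> f (x \<otimes>\<^bsub>A\<^esub> y) = f x \<otimes>\<^bsub>B\<^esub> f y"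
    and "f \<one>\<^bsub>A\<^esub> = \<one>\<^bsub>B\<^esub>"
    and "\<And>x. x \<in> carrier A \<Longrightarrow> f (star A x) = star B (f x)"
  shows "f \<in> star_hom A B"
  using assms by (auto simp: star_hom_def alg_hom_def ring_hom_def semilinear_def)

lemma star_hom_restrict:
  assumes "star_algebra A" "f \<in> star_hom A B"
  shows "restrict f (carrier A) \<in> star_hom A B"
proof -
  interpret star_algebra A by fact
  note D = star_homD[OF assms(2)] semilinearD[OF star_homD(1)[OF assms(2)]]
  show ?thesis
    by (rule star_homI) (auto simp: D intro!: semilinearI)
qed

text \<open>Two extensional maps that agree on the carrier are equal, so a pointwise comparison on the carrier
  is all that the definite description needs.\<close>

lemma the_star_hom_eq:
  assumes "star_algebra A" "f \<in> star_hom A B" "fst ` G \<subseteq> carrier A"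
    and "\<And>g v. (g, v) \<in> G \<Longrightarrow> f g = v"
    and uniq: "\<And>h x. \<lbrakk>h \<in> star_hom A B; \<And>g v. (g, v) \<in> G \<Longrightarrow> h g = v; x \<in> carrier A\<rbrakk> \<Longrightarrow> h x = f x"
  shows "the_star_hom A B G = restrict f (carrier A)"
  unfolding the_star_hom_def
proof (rule the_equality)
  show "restrict f (carrier A) \<in> star_hom A B \<and> restrict f (carrier A) \<in> extensional (carrier A) \<and>
      (\<forall>(g, v)\<in>G. restrict f (carrier A) g = v)"
    using star_hom_restrict[OF assms(1,2)] assms(3,4) by force
next
  fix h assume h: "h \<in> star_hom A B \<and> h \<in> extensional (carrier A) \<and> (\<forall>(g, v)\<in>G. h g = v)"
  then have "h x = f x" if "x \<in> carrier A" for x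
    using that by (intro uniq) auto
  then show "h = restrict f (carrier A)"
    using h by (intro extensionalityI[of _ "carrier A"]) auto
qed

lemma sub_algebra:
  fixes A (structure)
  assumes "complex_algebra A" "linear_sub A B" "\<one> \<in> B" "\<And>x y. \<lbrakk>x \<in> B; y \<in> B\<rbrakk> \<Longrightarrow> x \<otimes> y \<in> B"
  shows "complex_algebra (A\<lparr>carrier := B\<rparr>)"
proof -
  interpret complex_algebra A by fact
  have B: "B \<subseteq> carrier A" "\<zero> \<in> B" "\<And>x y. \<lbrakk>x \<in> B; y \<in> B\<rbrakk> \<Longrightarrow> x \<oplus> y \<in> B" "\<And>c x. x \<in> B \<Longrightarrow> c \<odot> x \<in> B"
    using assms(2) by (auto simp: linear_sub_def)
  have c: "x \<in> B \<Longrightarrow> x \<in> carrier A" for x using B by auto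
  have "cspace (A\<lparr>carrier := B\<rparr>)"
    by (rule cspaceI) (auto simp: B c a_ac smult_add_left smult_add_right smult_smult)
  then show ?thesis
    by (rule complex_algebraI) (auto simp: assms c m_assoc l_distr r_distr smult_mult_left smult_mult_right)
qed

lemma sub_star_algebra:
  fixes A :: "('a, 'm) star_alg_scheme" (structure)
  assumes "star_algebra A" "linear_sub A B" "\<one> \<in> B" "\<And>x y. \<lbrakk>x \<in> B; y \<in> B\<rbrakk> \<Longrightarrow> x \<otimes> y \<in> B"
    and "\<And>x. x \<in> B \<Longrightarrow> star A x \<in> B"
  shows "star_algebra (A\<lparr>carrier := B\<rparr>)"
proof -
  interpret star_algebra A by fact
  interpret B: complex_algebra "A\<lparr>carrier := B\<rparr>"
    by (rule sub_algebra[OF complex_algebra_axioms assms(2-4)])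
  have c: "x \<in> B \<Longrightarrow> x \<in> carrier A" for x using assms(2) by (auto simp: linear_sub_def)
  show ?thesis
    by unfold_locales (auto simp: c assms star_add star_smult star_mult intro!: semilinearI)
qed

section \<open>The star operation on tensor products and quotients\<close>

lemma star_tensor_simps:
  "carrier (star_tensor M N) = carrier (tensor M N)"
  "monoid.mult (star_tensor M N) = monoid.mult (tensor M N)"
  "one (star_tensor M N) = one (tensor M N)"
  "zero (star_tensor M N) = zero (tensor M N)"
  "add (star_tensor M N) = add (tensor M N)"
  "module.smult (star_tensor M N) = module.smult (tensor M N)"
  by (simp_all add: star_tensor_def module.defs)

lemma linmap_star_tensor: "linmap A (star_tensor M N) f = linmap A (tensor M N) f"
  by (simp add: semilinear_def star_tensor_simps)

lemma alg_hom_star_tensor: "alg_hom A (star_tensor M N) = alg_hom A (tensor M N)"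
  by (simp add: alg_hom_def ring_hom_def star_tensor_simps)

locale star_algebras = M: star_algebra M + N: star_algebra N
  for M :: "('a, 'm) star_alg_scheme" and N :: "('b, 'n) star_alg_scheme"
begin

sublocale tensor_algebras M N
  by unfold_locales

text \<open>The star operation before passing to the quotient.\<close>

definition J :: "('a \<times> 'b \<Rightarrow>\<^sub>0 complex) \<Rightarrow> ('a \<times> 'b \<Rightarrow>\<^sub>0 complex)"
  where "J t = (\<Sum>(x, y)\<in>keys t.
       single (star M x, star N y) (cnj (lookup t (x, y))))"

lemma J_superset:
  assumes "finite A" "keys t \<subseteq> A"
  shows "J t = (\<Sum>p\<in>A. single (star M (fst p), star N (snd p)) (cnj (lookup t p)))"
  unfolding J_def case_prod_beta prod.collapse
  by (rule sum.mono_neutral_left) (use assms in \<open>auto simp: in_keys_iff\<close>)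

lemma J_add: "J (s + t) = J s + J t"
proof -
  let ?A = "keys s \<union> keys t"
  note S = J_superset[of ?A]
  show ?thesis using keys_add[of s t]
    by (simp add: S lookup_add single_add sum.distrib)
qed

lemma J_zero [simp]: "J 0 = 0"
  by (simp add: J_def)

lemma J_diff: "J (s - t) = J s - J t"
  using J_add[of "s - t" t] by (simp add: algebra_simps)

lemma J_cscale: "J (cscale c t) = cscale (cnj c) (J t)"
  using J_superset[OF finite_keys keys_cscale, of c t] J_superset[OF finite_keys subset_refl, of t]
  by (simp add: cscale_sum)

lemma J_single [simp]: "J (single (x, y) c) = single (star M x, star N y) (cnj c)"
  by (cases "c = 0") (auto simp: J_def)

lemma J_carrier: "t \<in> carrier F \<Longrightarrow> J t \<in> carrier F \<and> J (J t) = t"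
proof -
  assume "t \<in> carrier F"
  then have "keys t \<subseteq> carrier M \<times> carrier N" by (simp add: free_tensor_simps)
  then show ?thesis
  proof (induction rule: poly_mapping_keys_induct)
    case (add x c t)
    then show ?case
      by (cases x) (auto simp: J_add free_tensor_simps intro!: keys_add_subset del: subsetI)
  qed (simp add: free_tensor_simps)
qed

lemma J_rels:
  assumes "r \<in> bilinear_rels M N"
  shows "J r \<in> bilinear_rels M N"
  using assms
proof (cases rule: bilinear_relsE)
  case (add_left x x' y)
  then show ?thesis using bilinear_relsI(1)[of "star M x" M "star M x'" "star N y" N]
    by (simp add: J_diff M.star_add)
next
  case (add_right x y y')
  then show ?thesis using bilinear_relsI(2)[of "star M x" M "star N y" N "star N y'"]
    by (simp add: J_diff N.star_add)
next
  case (smult_left c x y)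
  then show ?thesis using bilinear_relsI(3)[of "star M x" M "star N y" N "cnj c"]
    by (simp add: J_diff M.star_smult)
next
  case (smult_right c x y)
  then show ?thesis using bilinear_relsI(4)[of "star M x" M "star N y" N "cnj c"]
    by (simp add: J_diff N.star_smult)
qed

lemma J_W: "w \<in> W \<Longrightarrow> J w \<in> W"
proof -
  have "W \<subseteq> {w. J w \<in> W}"
    by (rule free_cvs.span_minimal)
       (auto simp: J_rels J_add J_cscale free_cvs.subspace_def free_cvs.span_zero
        intro: free_cvs.span_add free_cvs.span_scale free_cvs.span_base)
  then show "w \<in> W \<Longrightarrow> J w \<in> W" by auto
qed

text \<open>The image of a coset is the full coset of the image because \<open>J\<close> is an involution that maps the
  relations to relations.\<close>

lemma star_tensor_coset:
  assumes t: "t \<in> carrier F"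
  shows "star (star_tensor M N) (W +>\<^bsub>F\<^esub> t) = W +>\<^bsub>F\<^esub> J t"
proof -
  have "star (star_tensor M N) (W +>\<^bsub>F\<^esub> t) = J ` (W +>\<^bsub>F\<^esub> t)"
    by (simp add: star_tensor_def module.defs star_alg.defs J_def[abs_def])
  also have "\<dots> = W +>\<^bsub>F\<^esub> J t"
  proof (intro subset_antisym subsetI)
    fix z assume "z \<in> J ` (W +>\<^bsub>F\<^esub> t)"
    then show "z \<in> W +>\<^bsub>F\<^esub> J t"
      by (auto simp: a_r_coset_def' free_tensor_simps(4) J_add J_W)
  next
    fix z assume "z \<in> W +>\<^bsub>F\<^esub> J t"
    then obtain w where w: "w \<in> W" "z = w + J t"
      by (auto simp: a_r_coset_def' free_tensor_simps(4))
    then have "z = J (J w + t)"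
      using J_carrier[of w] span_csub by (auto simp: J_add linear_sub_def)
    then show "z \<in> J ` (W +>\<^bsub>F\<^esub> t)"
      using J_W[OF w(1)] by (auto simp: a_r_coset_def' free_tensor_simps(4))
  qed
  finally show ?thesis .
qed

lemma star_tensor_pure [simp]:
  "\<lbrakk>x \<in> carrier M; y \<in> carrier N\<rbrakk> \<Longrightarrow>
    star (star_tensor M N) (pure M N x y) = pure M N (star M x) (star N y)"
  by (simp add: pure_eq pu_def star_tensor_coset free_pair_closed)

lemma star_tensor_semilinear: "semilinear cnj (tensor M N) (tensor M N) (star (star_tensor M N))"
proof (rule semilinearI; unfold tensor_eq Q.Q_carrier; elim imageE; hypsubst)
  fix s assume s: "s \<in> carrier F"
  then show "star (star_tensor M N) (W +>\<^bsub>F\<^esub> s) \<in> (+>\<^bsub>F\<^esub>) W ` carrier F"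
    using J_carrier[OF s] by (simp add: star_tensor_coset)
  show "star (star_tensor M N) (c \<odot>\<^bsub>T\<^esub> (W +>\<^bsub>F\<^esub> s)) = cnj c \<odot>\<^bsub>T\<^esub> star (star_tensor M N) (W +>\<^bsub>F\<^esub> s)" for c
    using J_carrier[OF s] s by (simp add: star_tensor_coset) (simp add: free_tensor_simps J_cscale)
  fix t assume t: "t \<in> carrier F"
  show "star (star_tensor M N) ((W +>\<^bsub>F\<^esub> s) \<oplus>\<^bsub>T\<^esub> (W +>\<^bsub>F\<^esub> t)) =
      star (star_tensor M N) (W +>\<^bsub>F\<^esub> s) \<oplus>\<^bsub>T\<^esub> star (star_tensor M N) (W +>\<^bsub>F\<^esub> t)"
    using J_carrier[OF s] J_carrier[OF t] s t by (simp add: star_tensor_coset) (simp add: free_tensor_simps J_add)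
qed

end

lemma star_quot_simps:
  "carrier (star_quot A R) = carrier (quot_alg A (star_ideal A R))"
  "monoid.mult (star_quot A R) = monoid.mult (quot_alg A (star_ideal A R))"
  "one (star_quot A R) = one (quot_alg A (star_ideal A R))"
  "zero (star_quot A R) = zero (quot_alg A (star_ideal A R))"
  "add (star_quot A R) = add (quot_alg A (star_ideal A R))"
  "module.smult (star_quot A R) = module.smult (quot_alg A (star_ideal A R))"
  "star (star_quot A R) = (\<lambda>K. star A ` K)"
  by (simp_all add: star_quot_def module.defs star_alg.defs)

lemma linmap_star_quot: "semilinear \<sigma> (star_quot A R) V f = semilinear \<sigma> (quot_alg A (star_ideal A R)) V f"
  by (simp add: semilinear_def star_quot_simps)

locale star_quotient = star_algebra V for V (structure) + fixes R
  assumes R_carrier: "R \<subseteq> carrier V"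
begin

abbreviation "I \<equiv> star_ideal V R"

lemma gens_carrier: "R \<union> star V ` R \<subseteq> carrier V"
  using R_carrier star_closed by blast

lemma ideal: "ideal I V"
  unfolding star_ideal_def by (rule genideal_ideal[OF gens_carrier])

sublocale algebra_quot V I
  by (intro algebra_quot.intro algebra_quot_axioms.intro complex_algebra_axioms ideal)

lemma relation_in_ideal: "r \<in> R \<Longrightarrow> r \<in> I"
proof -
  have "R \<union> star V ` R \<subseteq> I"
    unfolding star_ideal_def by (rule genideal_self[OF gens_carrier])
  then show "r \<in> R \<Longrightarrow> r \<in> I" by auto
qed

lemma I_minimal:
  assumes "ideal L V" "R \<subseteq> L" "star V ` R \<subseteq> L"
  shows "I \<subseteq> L"
  unfolding star_ideal_def by (rule genideal_minimal[OF assms(1) Un_least[OF assms(2,3)]])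

text \<open>The elements whose star lies in \<open>I\<close> form an ideal, and it contains the relations and their stars.\<close>

lemma I_star:
  assumes x: "x \<in> I"
  shows "star V x \<in> I"
proof -
  interpret I: ideal I V by (rule ideal)
  define L where "L = {x \<in> carrier V. star V x \<in> I}"
  have L: "x \<in> L \<longleftrightarrow> x \<in> carrier V \<and> star V x \<in> I" for x
    by (simp add: L_def)
  have "linear_sub V L"
    unfolding linear_sub_def
  proof (intro conjI ballI allI)
    show "L \<subseteq> carrier V" by (auto simp: L)
    show "\<zero> \<in> L" by (simp add: L)
    show "x \<oplus> y \<in> L" if "x \<in> L" "y \<in> L" for x y
      using that by (simp add: L star_add)
    show "c \<odot> x \<in> L" if "x \<in> L" for c x
      using that by (simp add: L star_smult smultW)
  qed
  then interpret L: cspace_quot V L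
    by unfold_locales
  have "ideal L V"
  proof (rule idealI[OF ring_axioms])
    show "subgroup L (add_monoid V)"
      by (rule L.W.a_subgroup)
    show "y \<otimes> x \<in> L" "x \<otimes> y \<in> L" if "x \<in> L" "y \<in> carrier V" for x y
      using that by (simp_all add: L star_mult I.I_l_closed I.I_r_closed)
  qed
  moreover have 1: "R \<union> star V ` R \<subseteq> I"
    unfolding star_ideal_def by (rule genideal_self[OF gens_carrier])
  have "R \<subseteq> L" "star V ` R \<subseteq> L"
    using 1 R_carrier by (auto simp: L subset_eq)
  ultimately have "I \<subseteq> L"
    by (rule I_minimal)
  then show ?thesis using x L by blast
qed

lemma quot_star [simp]:
  assumes x: "x \<in> carrier V"
  shows "star (star_quot V R) (I +> x) = I +> star V x"
proof -
  interpret I: ideal I V by (rule ideal)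
  have "star V ` (I +> x) = I +> star V x" (is "?L = ?R")
  proof (intro subset_antisym subsetI)
    fix z assume "z \<in> ?L"
    then show "z \<in> ?R" using x
      by (auto simp: a_r_coset_def' star_add I.Icarr I_star)
  next
    fix z assume "z \<in> ?R"
    then obtain w where w: "w \<in> I" "z = w \<oplus> star V x"
      by (auto simp: a_r_coset_def')
    then have "z = star V (star V w \<oplus> x)" using x by (simp add: star_add I.Icarr)
    then show "z \<in> ?L" using I_star[OF w(1)] by (auto simp: a_r_coset_def')
  qed
  then show ?thesis by (simp add: star_quot_simps)
qed

abbreviation "S \<equiv> star_quot V R"

lemma S_carrier: "carrier S = (\<lambda>x. I +> x) ` carrier V"
  by (simp add: star_quot_simps Q_carrier)

lemma S_simps [simp]:
  "x \<in> carrier V \<Longrightarrow> I +> x \<in> carrier S"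
  "\<lbrakk>x \<in> carrier V; y \<in> carrier V\<rbrakk> \<Longrightarrow> (I +> x) \<oplus>\<^bsub>S\<^esub> (I +> y) = I +> (x \<oplus> y)"
  "\<lbrakk>x \<in> carrier V; y \<in> carrier V\<rbrakk> \<Longrightarrow> (I +> x) \<otimes>\<^bsub>S\<^esub> (I +> y) = I +> (x \<otimes> y)"
  "x \<in> carrier V \<Longrightarrow> c \<odot>\<^bsub>S\<^esub> (I +> x) = I +> (c \<odot> x)"
  "\<one>\<^bsub>S\<^esub> = I +> \<one>" "\<zero>\<^bsub>S\<^esub> = I +> \<zero>"
  by (simp_all add: star_quot_simps Q_one Q_zero)

lemma S_star_algebra: "star_algebra S"
proof -
  have "cspace S"
    by (rule cspaceI) (auto simp: S_carrier a_ac smult_smult smult_add_left smult_add_right)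
  then interpret S: complex_algebra S
    by (rule complex_algebraI) (auto simp: S_carrier m_assoc l_distr r_distr smult_mult_left smult_mult_right)
  show ?thesis
    by unfold_locales (auto simp: S_carrier star_mult star_add star_smult intro!: semilinearI)
qed

end

section \<open>Monoid algebras with a star\<close>

abbreviation monoid_star_alg :: "('w \<Rightarrow> 'w) \<Rightarrow> ('w::monoid_add \<Rightarrow>\<^sub>0 complex) star_alg"
  where "monoid_star_alg \<nu> \<equiv> type_star_alg cscale (\<lambda>f. Poly_Mapping.map cnj (Poly_Mapping.map_key \<nu> f))"

lemma type_star_alg_simps:
  "carrier (type_star_alg sc st) = UNIV"
  "monoid.mult (type_star_alg sc st) = (*)"
  "one (type_star_alg sc st) = 1"
  "zero (type_star_alg sc st) = 0"
  "add (type_star_alg sc st) = (+)"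
  "module.smult (type_star_alg sc st) = sc"
  "star (type_star_alg sc st) = st"
  by (simp_all add: type_star_alg_def)

lemmas CC_simps = type_star_alg_simps[of "(*)" cnj, folded complex_star_alg_def]

lemma cscale_mult_left: "cscale c f * g = cscale c (f * g)" for f g :: "'w::monoid_add \<Rightarrow>\<^sub>0 complex"
  unfolding cscale_def mult_map_scale_conv_mult by (simp add: mult.assoc)

lemma poly_mapping_induct [case_names zero add]:
  fixes t :: "'x \<Rightarrow>\<^sub>0 complex"
  assumes "P 0" "\<And>x c t. P t \<Longrightarrow> P (single x c + t)"
  shows "P t"
  using subset_UNIV by (rule poly_mapping_keys_induct) (use assms in auto)

lemma cscale_mult_right: "f * cscale c g = cscale c (f * g)" for f g :: "'w::monoid_add \<Rightarrow>\<^sub>0 complex"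
proof (induction f rule: poly_mapping_induct)
  case (add x d f)
  have "single x d * cscale c g = cscale c (single x d * g)"
    by (induction g rule: poly_mapping_induct) (simp_all add: cscale_add distrib_left mult_single mult.left_commute)
  with add show ?case by (simp add: distrib_right cscale_add)
qed simp

text \<open>Both the Laurent polynomials (integers with negation) and the free *-algebra (words with
  reversal and exchange of adjoints) are monoid algebras with such an involution.\<close>

locale monoid_involution =
  fixes \<nu> :: "'w::monoid_add \<Rightarrow> 'w"
  assumes invol [simp]: "\<nu> (\<nu> w) = w" and anti: "\<nu> (v + w) = \<nu> w + \<nu> v"
begin

lemma inj: "inj \<nu>"
  by (metis injI invol)

abbreviation "st f \<equiv> Poly_Mapping.map cnj (Poly_Mapping.map_key \<nu> f)"

lemma lookup_st [simp]: "lookup (st f) w = cnj (lookup f (\<nu> w))"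
  using inj by (simp add: Poly_Mapping.map.rep_eq map_key.rep_eq when_def)

lemma st_single [simp]: "st (single w c) = single (\<nu> w) (cnj c)"
  by (rule poly_mapping_eqI) (auto simp: lookup_single when_def)

lemma st_add: "st (f + g) = st f + st g"
  by (rule poly_mapping_eqI) (simp add: lookup_add)

lemma st_zero [simp]: "st 0 = 0"
  by (rule poly_mapping_eqI) simp

lemma st_mult: "st (f * g) = st g * st f"
proof (induction f rule: poly_mapping_induct)
  case (add x d f)
  have "st (single x d * g) = st g * st (single x d)"
    by (induction g rule: poly_mapping_induct)
       (simp_all add: distrib_left distrib_right mult_single st_add anti mult.commute)
  with add show ?case by (simp add: distrib_left distrib_right st_add)
qed simp

lemma star_algebra: "star_algebra (monoid_star_alg \<nu>)"
proof -
  let ?A = "monoid_star_alg \<nu>"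
  have "cspace ?A"
    by (rule cspaceI) (auto simp: type_star_alg_simps add_ac cscale_add free_cvs.scale_left_distrib)
  then interpret complex_algebra ?A
    by (rule complex_algebraI)
       (auto simp: type_star_alg_simps mult.assoc distrib_left distrib_right cscale_mult_left cscale_mult_right)
  have "st (cscale c x) = cscale (cnj c) (st x)" for c x
    by (rule poly_mapping_eqI) simp
  moreover have "st (st x) = x" for x
    by (rule poly_mapping_eqI) simp
  ultimately show ?thesis
    by unfold_locales (auto simp: type_star_alg_simps st_add st_mult intro!: semilinearI)
qed

text \<open>The universal property of a monoid algebra: multiplicativity and compatibility with the star need
  to be known only on the monoid.\<close>

lemma star_hom_lin:
  assumes B: "complex_algebra B" "semilinear cnj B B (star B)"
    and g: "\<And>w. g w \<in> carrier B" "g 0 = \<one>\<^bsub>B\<^esub>" "\<And>v w. g (v + w) = g v \<otimes>\<^bsub>B\<^esub> g w" "\<And>w. star B (g w) = g (\<nu> w)"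
  shows "lin B g \<in> star_hom (monoid_star_alg \<nu>) B"
proof -
  interpret B: complex_algebra B by fact
  let ?A = "monoid_star_alg \<nu>"
  interpret A: star_algebra ?A by (rule star_algebra)
  have gU: "g \<in> UNIV \<rightarrow> carrier B" using g by auto
  note closed = B.lin_closed[OF gU subset_UNIV]
  note add = B.lin_add[OF gU subset_UNIV subset_UNIV]
  have single: "lin B g (single w c) = c \<odot>\<^bsub>B\<^esub> g w" for w c
    using g by simp
  have lm: "linmap ?A B (lin B g)"
    by (rule semilinearI) (auto simp: type_star_alg_simps closed add B.lin_cscale[OF gU])
  show ?thesis
  proof (rule star_homI[OF lm])
    show "lin B g \<one>\<^bsub>?A\<^esub> = \<one>\<^bsub>B\<^esub>"
      using single[of 0 1] by (simp add: type_star_alg_simps g)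
    have sm: "lin B g (single w c * y) = lin B g (single w c) \<otimes>\<^bsub>B\<^esub> lin B g y" for w c y
    proof (induction y rule: poly_mapping_induct)
      case (add v d y)
      then show ?case
        by (simp add: distrib_left B.lin_add[OF gU] mult_single single closed g B.r_distr
            B.smult_mult_left B.smult_mult_right B.smult_smult mult.commute)
    qed (simp add: single g)
    have "lin B g (x * y) = lin B g x \<otimes>\<^bsub>B\<^esub> lin B g y" for x y
    proof (induction x rule: poly_mapping_induct)
      case (add v d x)
      then show ?case
        by (simp add: distrib_right B.lin_add[OF gU] sm B.l_distr closed)
    qed (simp add: closed)
    then show "lin B g (x \<otimes>\<^bsub>?A\<^esub> y) = lin B g x \<otimes>\<^bsub>B\<^esub> lin B g y" for x y
      by (simp add: type_star_alg_simps)
    have "lin B g (st x) = star B (lin B g x)" for x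
    proof (induction x rule: poly_mapping_induct)
      case zero
      then show ?case using semilinear_zero[OF B(2) B.cspace_axioms B.cspace_axioms] by simp
    next
      case (add v d x)
      then show ?case
        by (simp add: st_add B.lin_add[OF gU] closed single g semilinearD[OF B(2)])
    qed
    then show "lin B g (star ?A x) = star B (lin B g x)" for x
      by (simp add: type_star_alg_simps)
  qed
qed

lemma span_singles: "x \<in> cspan (monoid_star_alg \<nu>) (range (\<lambda>w. single w 1))"
proof (induction x rule: poly_mapping_induct)
  case zero
  then show ?case using cspan.zero[of "monoid_star_alg \<nu>"] by (simp add: type_star_alg_simps)
next
  case (add w c x)
  then show ?case using cspan.step[OF add, of "single w 1" c] by (simp add: type_star_alg_simps)
qed

end

section \<open>The Hopf algebra of Laurent polynomials\<close>

abbreviation upow :: "int \<Rightarrow> (int \<Rightarrow>\<^sub>0 complex)"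
  where "upow n \<equiv> single n 1"

lemma OU1_eq: "OU1 = monoid_star_alg uminus"
  by (simp add: OU1_def)

lemma OU1_simps:
  "carrier OU1 = UNIV"
  "monoid.mult OU1 = (*)"
  "one OU1 = 1"
  "zero OU1 = 0"
  "add OU1 = (+)"
  "module.smult OU1 = cscale"
  "star OU1 = (\<lambda>f. Poly_Mapping.map cnj (Poly_Mapping.map_key uminus f))"
  by (simp_all add: OU1_def type_star_alg_simps)

interpretation ZI: monoid_involution "uminus :: int \<Rightarrow> int"
  by unfold_locales auto

interpretation OU1: star_algebra OU1
  unfolding OU1_eq by (rule ZI.star_algebra)

lemmas OU1_star_hom_lin = ZI.star_hom_lin[folded OU1_eq]
lemmas OU1_span = ZI.span_singles[folded OU1_eq]

lemma OU1_carrier [simp]: "carrier OU1 = UNIV"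
  by (simp add: OU1_simps)

lemma upow_mult [simp]: "upow m \<otimes>\<^bsub>OU1\<^esub> upow n = upow (m + n)"
  by (simp add: OU1_simps mult_single)

lemma upow_star [simp]: "star OU1 (upow n) = upow (- n)"
  by (simp add: OU1_simps ZI.st_single)

lemma OU1_one: "\<one>\<^bsub>OU1\<^esub> = upow 0"
  by (simp add: OU1_simps)

lemma OU1_ext:
  assumes "linmap OU1 V f" "linmap OU1 V g" "cspace V" "\<And>n. f (upow n) = g (upow n)"
  shows "f h = g h"
  by (rule semilinear_ext[OF assms(1,2) OU1.cspace_axioms assms(3) _ _ OU1_span]) (use assms in auto)

text \<open>All powers of \<open>u\<close> arise from multiplication by \<open>u\<close> and by its adjoint, which is its inverse.\<close>

lemma OU1_hom_unique:
  assumes "f \<in> star_hom OU1 B" "g \<in> star_hom OU1 B" "complex_algebra B" "f u1 = g u1"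
  shows "f h = g h"
proof (rule OU1_ext[OF star_homD(1)[OF assms(1)] star_homD(1)[OF assms(2)]])
  interpret B: complex_algebra B by fact
  show "cspace B" by (rule B.cspace_axioms)
  note f = star_homD[OF assms(1)] note g = star_homD[OF assms(2)]
  have 1: "f (upow 1) = g (upow 1)" using assms(4) by (simp add: u1_def)
  have m1: "f (upow (-1)) = g (upow (-1))"
    using f(4)[of "upow 1"] g(4)[of "upow 1"] 1 by simp
  show "f (upow n) = g (upow n)" for n
  proof (induction n rule: int_induct[where k = 0])
    case base
    then show ?case using f(3) g(3) by (simp add: OU1_one)
  next
    case (step1 n)
    then show ?case using f(2)[of "upow n" "upow 1"] g(2)[of "upow n" "upow 1"] 1 by simp
  next
    case (step2 n)
    then show ?case using f(2)[of "upow n" "upow (-1)"] g(2)[of "upow n" "upow (-1)"] m1 by simp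
  qed
qed

lemma OU1_the_star_hom:
  assumes B: "complex_algebra B" "semilinear cnj B B (star B)"
    and g: "\<And>w. g w \<in> carrier B" "g 0 = \<one>\<^bsub>B\<^esub>" "\<And>v w. g (v + w) = g v \<otimes>\<^bsub>B\<^esub> g w" "\<And>w. star B (g w) = g (- w)"
    and v: "g 1 = v"
  shows "the_star_hom OU1 B {(u1, v)} = lin B g"
proof -
  interpret B: complex_algebra B by fact
  have h: "lin B g \<in> star_hom OU1 B" by (rule OU1_star_hom_lin[OF B g])
  have gv: "lin B g u1 = v" using g(1)[of 1] v by (simp add: u1_def)
  have "the_star_hom OU1 B {(u1, v)} = restrict (lin B g) (carrier OU1)"
  proof (rule the_star_hom_eq[OF OU1.star_algebra_axioms h])
    fix k x assume k: "k \<in> star_hom OU1 B" "\<And>g' v'. (g', v') \<in> {(u1, v)} \<Longrightarrow> k g' = v'"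
    show "k x = lin B g x"
      by (rule OU1_hom_unique[OF k(1) h B(1)]) (use k(2) gv in auto)
  qed (use gv in auto)
  then show ?thesis by (simp add: restrict_def)
qed

interpretation UU: star_algebras OU1 OU1
  by unfold_locales

interpretation CC: complex_algebra complex_star_alg
proof (rule complex_algebraI)
  show "cspace complex_star_alg"
    by (rule cspaceI) (auto simp: CC_simps algebra_simps)
qed (auto simp: CC_simps algebra_simps)

lemma star_tensor_algebra:
  assumes "star_algebra M" "star_algebra N"
  shows "complex_algebra (star_tensor M N)"
    and "semilinear cnj (star_tensor M N) (star_tensor M N) (star (star_tensor M N))"
proof -
  interpret star_algebras M N using assms by (simp add: star_algebras_def)
  interpret T: complex_algebra "tensor M N" by (rule tensor_algebra)
  have "cspace (star_tensor M N)"
    by (rule cspaceI)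
       (auto simp: star_tensor_simps T.a_ac T.smult_add_left T.smult_add_right T.smult_smult)
  then show "complex_algebra (star_tensor M N)"
    by (rule complex_algebraI)
       (auto simp: star_tensor_simps T.m_assoc T.l_distr T.r_distr T.smult_mult_left T.smult_mult_right)
  show "semilinear cnj (star_tensor M N) (star_tensor M N) (star (star_tensor M N))"
    using star_tensor_semilinear by (simp add: semilinear_def star_tensor_simps)
qed

lemma lin_star_tensor: "lin (star_tensor M N) f = lin (tensor M N) f"
  by (rule ext) (simp add: lin_def star_tensor_simps finsum_def finprod_def)

lemma OU1_comult_eq: "OU1_comult = lin (tensor OU1 OU1) (\<lambda>n. pure OU1 OU1 (upow n) (upow n))"
  unfolding OU1_comult_def lin_star_tensor[symmetric]
  by (rule OU1_the_star_hom)
     (auto simp: star_tensor_algebra OU1.star_algebra_axioms star_tensor_simps UU.tensor_one OU1_one u1_def)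

lemma OU1_comult_hom: "OU1_comult \<in> star_hom OU1 (star_tensor OU1 OU1)"
  unfolding OU1_comult_eq lin_star_tensor[symmetric]
  by (rule OU1_star_hom_lin)
     (auto simp: star_tensor_algebra OU1.star_algebra_axioms star_tensor_simps UU.tensor_one OU1_one u1_def)

lemma complex_star_semilinear: "semilinear cnj complex_star_alg complex_star_alg (star complex_star_alg)"
  by (rule semilinearI) (auto simp: CC_simps)

lemma OU1_counit_eq: "OU1_counit = lin complex_star_alg (\<lambda>n. 1)"
  unfolding OU1_counit_def
  by (rule OU1_the_star_hom[OF CC.complex_algebra_axioms complex_star_semilinear])
     (auto simp: CC_simps)

lemma OU1_counit_hom: "OU1_counit \<in> star_hom OU1 complex_star_alg"
  unfolding OU1_counit_eq
  by (rule OU1_star_hom_lin[OF CC.complex_algebra_axioms complex_star_semilinear])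
     (auto simp: CC_simps)

lemma OU1_antipode_eq: "OU1_antipode = lin OU1 (\<lambda>n. upow (- n))"
  unfolding OU1_antipode_def
  by (rule OU1_the_star_hom[OF OU1.complex_algebra_axioms OU1.star_semilinear])
     (auto simp: OU1_one u1_def)

lemma OU1_antipode_hom: "OU1_antipode \<in> star_hom OU1 OU1"
  unfolding OU1_antipode_eq
  by (rule OU1_star_hom_lin[OF OU1.complex_algebra_axioms OU1.star_semilinear])
     (auto simp: OU1_one u1_def)

lemma OU1_comult_upow [simp]: "OU1_comult (upow n) = pure OU1 OU1 (upow n) (upow n)"
proof -
  interpret T: cspace "tensor OU1 OU1" by (rule UU.tensor_cspace)
  show ?thesis by (simp add: OU1_comult_eq)
qed

lemma OU1_counit_upow [simp]: "OU1_counit (upow n) = 1"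
proof -
  have "1 \<in> carrier complex_star_alg" by (simp add: CC_simps)
  then have "OU1_counit (upow n) = 1 \<odot>\<^bsub>complex_star_alg\<^esub> 1"
    unfolding OU1_counit_eq by (rule CC.lin_single)
  then show ?thesis
    by (simp add: CC_simps)
qed

lemma OU1_antipode_upow [simp]: "OU1_antipode (upow n) = upow (- n)"
  by (simp add: OU1_antipode_eq)

lemma OU1_comult_linmap: "linmap OU1 (tensor OU1 OU1) OU1_comult"
  using star_homD(1)[OF OU1_comult_hom] by (simp add: linmap_star_tensor)

text \<open>Used to contract a tensor factor with a linear functional.\<close>

lemma functional_bilinear:
  assumes "cspace V" "linmap H complex_star_alg \<chi>"
  shows "cbilinear V H V (\<lambda>v h. \<chi> h \<odot>\<^bsub>V\<^esub> v)" "cbilinear H V V (\<lambda>h v. \<chi> h \<odot>\<^bsub>V\<^esub> v)"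
proof -
  interpret cspace V by fact
  have 1: "linmap H V (\<lambda>h. \<chi> h \<odot>\<^bsub>V\<^esub> v)" if "v \<in> carrier V" for v
    using that semilinearD[OF assms(2)]
    by (intro semilinearI) (auto simp: smult_add_left smult_smult CC_simps)
  have 2: "linmap V V (\<lambda>v. \<chi> h \<odot>\<^bsub>V\<^esub> v)" for h
    by (intro semilinearI) (auto simp: smult_add_right smult_smult mult.commute)
  show "cbilinear V H V (\<lambda>v h. \<chi> h \<odot>\<^bsub>V\<^esub> v)" "cbilinear H V V (\<lambda>h v. \<chi> h \<odot>\<^bsub>V\<^esub> v)"
    using 1 2 by (auto simp: cbilinear_def)
qed

lemmas counit_bilinear = functional_bilinear[OF _ star_homD(1)[OF OU1_counit_hom]]

lemma mult_bilinear:
  assumes "complex_algebra A"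
  shows "cbilinear A A A (\<lambda>x y. x \<otimes>\<^bsub>A\<^esub> y)"
proof -
  interpret complex_algebra A by fact
  show ?thesis
    by (intro cbilinearI semilinearI) (auto simp: l_distr r_distr smult_mult_left smult_mult_right)
qed

lemma linmap_lift:
  assumes "linmap A (tensor M N) f" "cspace M" "cspace N" "cspace U" "cbilinear M N U b"
  shows "linmap A U (\<lambda>x. tensor_lift U b (f x))"
proof -
  interpret tensor_pair M N using assms by (simp add: tensor_pair_def)
  show ?thesis
    using semilinear_comp[OF assms(1) lift_linmap[OF assms(4,5)]] .
qed

text \<open>Every axiom is an identity of linear maps, hence holds once it holds for the powers of \<open>u\<close>, which
  are group-like.\<close>

interpretation OU1_hopf: hopf_algebra OU1 OU1_comult OU1_counit OU1_antipode
proof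
  interpret T: cspace "tensor OU1 OU1" by (rule UU.tensor_cspace)
  interpret UT: tensor_pair OU1 "tensor OU1 OU1" by unfold_locales
  interpret TU: tensor_pair "tensor OU1 OU1" OU1 by unfold_locales
  interpret UT: cspace "tensor OU1 (tensor OU1 OU1)" by (rule UT.tensor_cspace)
  note U = OU1.cspace_axioms note T = T.cspace_axioms
  note ap = semilinearD[OF star_homD(1)[OF OU1_antipode_hom]]
  show "OU1_comult \<in> alg_hom OU1 (tensor OU1 OU1)"
    using OU1_comult_hom by (simp add: star_hom_def alg_hom_star_tensor)
  show "OU1_counit \<in> alg_hom OU1 complex_star_alg"
    using OU1_counit_hom by (simp add: star_hom_def)
  show "OU1_antipode h \<in> carrier OU1" for h by simp
  show "OU1_antipode (g \<oplus>\<^bsub>OU1\<^esub> h) = OU1_antipode g \<oplus>\<^bsub>OU1\<^esub> OU1_antipode h" for g h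
    using ap by simp
  show "OU1_antipode (c \<odot>\<^bsub>OU1\<^esub> h) = c \<odot>\<^bsub>OU1\<^esub> OU1_antipode h" for c h
    using ap by simp
  show "tensor_assoc OU1 OU1 OU1 (tensor_map (tensor OU1 OU1) OU1 OU1_comult (\<lambda>g. g) (OU1_comult h)) =
      tensor_map OU1 (tensor OU1 OU1) (\<lambda>g. g) OU1_comult (OU1_comult h)" for h
  proof (rule OU1_ext[OF _ _ UT.cspace_axioms])
    note m1 = tensor_map_linmap[OF T U U U OU1_comult_linmap linmap_id]
    note m2 = tensor_map_linmap[OF U T U U linmap_id OU1_comult_linmap]
    note as = tensor_assoc_linmap[OF U U U]
    show "linmap OU1 (tensor OU1 (tensor OU1 OU1)) (\<lambda>h. tensor_assoc OU1 OU1 OU1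
        (tensor_map (tensor OU1 OU1) OU1 OU1_comult (\<lambda>g. g) (OU1_comult h)))"
      using semilinear_comp[OF semilinear_comp[OF OU1_comult_linmap m1(1)] as(1)] .
    show "linmap OU1 (tensor OU1 (tensor OU1 OU1)) (\<lambda>h. tensor_map OU1 (tensor OU1 OU1) (\<lambda>g. g) OU1_comult (OU1_comult h))"
      using semilinear_comp[OF OU1_comult_linmap m2(1)] .
    show "tensor_assoc OU1 OU1 OU1 (tensor_map (tensor OU1 OU1) OU1 OU1_comult (\<lambda>g. g) (OU1_comult (upow n))) =
      tensor_map OU1 (tensor OU1 OU1) (\<lambda>g. g) OU1_comult (OU1_comult (upow n))" for n
      by (simp add: m1(2) m2(2) as(2))
  qed
  note lift = linmap_lift[OF OU1_comult_linmap U U U]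
  show "tensor_lift OU1 (\<lambda>g g'. OU1_counit g \<odot>\<^bsub>OU1\<^esub> g') (OU1_comult h) = h" for h
    by (rule OU1_ext[OF lift[OF counit_bilinear(2)[OF U]] linmap_id U])
       (simp add: UU.lift_pure[OF U counit_bilinear(2)[OF U]])
  show "tensor_lift OU1 (\<lambda>g g'. OU1_counit g' \<odot>\<^bsub>OU1\<^esub> g) (OU1_comult h) = h" for h
    by (rule OU1_ext[OF lift[OF counit_bilinear(1)[OF U]] linmap_id U])
       (simp add: UU.lift_pure[OF U counit_bilinear(1)[OF U]])
  have e: "linmap OU1 OU1 (\<lambda>h. OU1_counit h \<odot>\<^bsub>OU1\<^esub> \<one>\<^bsub>OU1\<^esub>)"
    using cbilinearD(3)[OF counit_bilinear(2)[OF U], of undefined "\<one>\<^bsub>OU1\<^esub>"] by simp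
  note M = mult_bilinear[OF OU1.complex_algebra_axioms]
  note S1 = cbilinear_comp[OF M star_homD(1)[OF OU1_antipode_hom] linmap_id]
  note S2 = cbilinear_comp[OF M linmap_id star_homD(1)[OF OU1_antipode_hom]]
  show "tensor_lift OU1 (\<lambda>g g'. OU1_antipode g \<otimes>\<^bsub>OU1\<^esub> g') (OU1_comult h) = OU1_counit h \<odot>\<^bsub>OU1\<^esub> \<one>\<^bsub>OU1\<^esub>" for h
    by (rule OU1_ext[OF lift[OF S1] e U]) (simp add: UU.lift_pure[OF U S1] OU1_one)
  show "tensor_lift OU1 (\<lambda>g g'. g \<otimes>\<^bsub>OU1\<^esub> OU1_antipode g') (OU1_comult h) = OU1_counit h \<odot>\<^bsub>OU1\<^esub> \<one>\<^bsub>OU1\<^esub>" for h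
    by (rule OU1_ext[OF lift[OF S2] e U]) (simp add: UU.lift_pure[OF U S2] OU1_one)
qed

section \<open>Strongly graded algebras are principal\<close>

lemma cspan_image_lin:
  assumes "cspace V" "f \<in> K \<rightarrow> carrier V" "x \<in> cspan V (f ` K)"
  shows "\<exists>t. keys t \<subseteq> K \<and> lin V f t = x"
proof -
  interpret cspace V by fact
  show ?thesis using assms(3)
  proof induction
    case zero
    show ?case by (rule exI[of _ 0]) simp
  next
    case (step x s c)
    then obtain t p where t: "keys t \<subseteq> K" "lin V f t = x" "p \<in> K" "s = f p" by auto
    have "keys (single p c) \<subseteq> K" using t by auto
    moreover have "f p \<in> carrier V" using assms t by auto
    ultimately show ?case
      using t by (intro exI[of _ "single p c + t"])
        (auto simp: lin_add[OF assms(2)] intro!: keys_add_subset del: subsetI)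
  qed
qed

lemma linmap_param:
  assumes "cspace V" "cspace A" "\<And>p. p \<in> keys t \<Longrightarrow> linmap A V (\<lambda>a. f a p)"
  shows "linmap A V (\<lambda>a. lin V (f a) t)"
proof -
  interpret V: cspace V by fact
  interpret A: cspace A by fact
  note D = semilinearD[OF assms(3)]
  show ?thesis
  proof (rule semilinearI)
    fix x assume x: "x \<in> carrier A"
    show "lin V (f x) t \<in> carrier V"
      by (rule V.lin_closed[of _ "keys t"]) (use x D in auto)
    show "lin V (f (c \<odot>\<^bsub>A\<^esub> x)) t = c \<odot>\<^bsub>V\<^esub> lin V (f x) t" for c
      using lin_fun_smult[OF assms(1), of t "f x" c] V.lin_cong[of t "f (c \<odot>\<^bsub>A\<^esub> x)" "\<lambda>p. c \<odot>\<^bsub>V\<^esub> f x p"] x D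
      by simp
    fix y assume y: "y \<in> carrier A"
    show "lin V (f (x \<oplus>\<^bsub>A\<^esub> y)) t = lin V (f x) t \<oplus>\<^bsub>V\<^esub> lin V (f y) t"
      using V.lin_fun_add[of t "f x" "f y"] V.lin_cong[of t "f (x \<oplus>\<^bsub>A\<^esub> y)" "\<lambda>p. f x p \<oplus>\<^bsub>V\<^esub> f y p"] x y D
      by simp
  qed
qed

lemma OU1_lin_linmap:
  assumes "cspace V" "\<And>n. g n \<in> carrier V"
  shows "linmap OU1 V (lin V g)"
proof -
  interpret V: cspace V by fact
  have g: "g \<in> UNIV \<rightarrow> carrier V" using assms by auto
  show ?thesis
    by (rule semilinearI) (auto simp: OU1_simps V.lin_closed[OF g] V.lin_add[OF g] V.lin_cscale[OF g])
qed

text \<open>A coaction of the Laurent polynomials is a grading whose component of degree \<open>n\<close> consists of the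
  \<open>x\<close> with \<open>\<rho> x = x \<otimes> u\<^bsup>n\<^esup>\<close>. The components are independent, since \<open>\<rho>\<close> separates the terms of a
  relation \<open>\<Sum> x\<^sub>n = 0\<close>. That they span is the hypothesis.\<close>

locale graded_coaction = A: complex_algebra A
  for A :: "(complex, 'a, 'm) module_scheme" (structure) +
  fixes \<rho> :: "'a \<Rightarrow> ('a, int \<Rightarrow>\<^sub>0 complex) tensor"
  assumes coaction: "\<rho> \<in> alg_hom A (tensor A OU1)"
    and spanned: "carrier A \<subseteq> cspan A (\<Union>n. {x \<in> carrier A. \<rho> x = pure A OU1 x (upow n)})"
begin

definition H :: "int \<Rightarrow> 'a set"
  where "H n = {x \<in> carrier A. \<rho> x = pure A OU1 x (upow n)}"

lemma H_carrier: "x \<in> H n \<Longrightarrow> x \<in> carrier A"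
  by (simp add: H_def)

lemma H_coaction: "x \<in> H n \<Longrightarrow> \<rho> x = pure A OU1 x (upow n)"
  by (simp add: H_def)

lemma H_span: "x \<in> carrier A \<Longrightarrow> x \<in> cspan A (\<Union>n. H n)"
  using spanned by (auto simp: H_def)

lemma H_subset: "(\<Union>n. H n) \<subseteq> carrier A"
  by (auto simp: H_def)

interpretation T: tensor_algebras A OU1
  by unfold_locales

interpretation AU: complex_algebra "tensor A OU1"
  by (rule T.tensor_algebra)

lemma coaction_linmap: "linmap A (tensor A OU1) \<rho>"
  using coaction by (rule alg_hom_linmap)

lemma coaction_mult: "\<lbrakk>x \<in> carrier A; y \<in> carrier A\<rbrakk> \<Longrightarrow> \<rho> (x \<otimes> y) = \<rho> x \<otimes>\<^bsub>tensor A OU1\<^esub> \<rho> y"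
  using coaction by (auto simp: alg_hom_def ring_hom_def)

lemma H_mult: "\<lbrakk>x \<in> H m; y \<in> H n\<rbrakk> \<Longrightarrow> x \<otimes> y \<in> H (m + n)"
  by (simp add: H_def coaction_mult)

lemma H_one: "\<one> \<in> H 0"
  using coaction by (auto simp: H_def alg_hom_def ring_hom_def T.tensor_one OU1_one)

lemma H_csub: "linear_sub A (H n)"
proof -
  note D = semilinearD[OF coaction_linmap]
  have "\<rho> \<zero> = pure A OU1 \<zero> (upow n)"
    using D(3)[of \<zero> 0] T.pure_smult_left[of \<zero> "upow n" 0] D(1)[of \<zero>] by simp
  then show ?thesis
    by (auto simp: linear_sub_def H_def D T.pure_add_left T.pure_smult_left)
qed

lemma coinvariants_eq: "coinvariants OU1 A \<rho> = H 0"
  by (simp add: coinvariants_def H_def OU1_one)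

lemma homogeneous_ext:
  assumes "semilinear \<sigma> A V f" "semilinear \<sigma> A V g" "cspace V" "\<And>n x. x \<in> H n \<Longrightarrow> f x = g x" "x \<in> carrier A"
  shows "f x = g x"
  by (rule semilinear_ext[OF assms(1,2) A.cspace_axioms assms(3) H_subset _ H_span[OF assms(5)]])
     (use assms(4) in auto)

lemma comodule_algebra: "comodule_algebra OU1 OU1_comult OU1_counit OU1_antipode A \<rho>"
proof
  show "\<rho> \<in> alg_hom A (tensor A OU1)" by (rule coaction)
  interpret U2: cspace "tensor OU1 OU1" by (rule UU.tensor_cspace)
  interpret A3: tensor_pair A "tensor OU1 OU1" by unfold_locales
  interpret A4: tensor_pair "tensor A OU1" OU1 by unfold_locales
  note U = OU1.cspace_axioms and A = A.cspace_axioms and AU = T.tensor_cspace and U2 = U2.cspace_axioms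
  fix c assume c: "c \<in> carrier A"
  show "tensor_assoc A OU1 OU1 (tensor_map (tensor A OU1) OU1 \<rho> (\<lambda>h. h) (\<rho> c)) =
      tensor_map A (tensor OU1 OU1) (\<lambda>a. a) OU1_comult (\<rho> c)"
  proof (rule homogeneous_ext[OF _ _ A3.tensor_cspace _ c])
    note m1 = tensor_map_linmap[OF AU U A U coaction_linmap linmap_id]
    note m2 = tensor_map_linmap[OF A U2 A U linmap_id OU1_comult_linmap]
    note as = tensor_assoc_linmap[OF A U U]
    show "linmap A (tensor A (tensor OU1 OU1)) (\<lambda>c. tensor_assoc A OU1 OU1 (tensor_map (tensor A OU1) OU1 \<rho> (\<lambda>h. h) (\<rho> c)))"
      using semilinear_comp[OF semilinear_comp[OF coaction_linmap m1(1)] as(1)] .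
    show "linmap A (tensor A (tensor OU1 OU1)) (\<lambda>c. tensor_map A (tensor OU1 OU1) (\<lambda>a. a) OU1_comult (\<rho> c))"
      using semilinear_comp[OF coaction_linmap m2(1)] .
    fix n x assume "x \<in> H n"
    then show "tensor_assoc A OU1 OU1 (tensor_map (tensor A OU1) OU1 \<rho> (\<lambda>h. h) (\<rho> x)) =
      tensor_map A (tensor OU1 OU1) (\<lambda>a. a) OU1_comult (\<rho> x)"
      by (simp add: H_coaction H_carrier m1(2) m2(2) as(2))
  qed
  show "tensor_lift A (\<lambda>a h. OU1_counit h \<odot> a) (\<rho> c) = c"
  proof (rule homogeneous_ext[OF linmap_lift[OF coaction_linmap A U A counit_bilinear(1)[OF A]] linmap_id A _ c])
    fix n x assume "x \<in> H n"
    then show "tensor_lift A (\<lambda>a h. OU1_counit h \<odot> a) (\<rho> x) = x"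
      by (simp add: H_coaction H_carrier T.lift_pure[OF A counit_bilinear(1)[OF A]])
  qed
qed

text \<open>The projection onto the degree-zero component along all others, obtained by contracting the
  coaction with the coefficient functional of \<open>u\<^bsup>0\<^esup>\<close>.\<close>

definition proj0 :: "'a \<Rightarrow> 'a"
  where "proj0 x = tensor_lift A (\<lambda>a h. lookup h 0 \<odot> a) (\<rho> x)"

lemma lookup_linmap: "linmap OU1 complex_star_alg (\<lambda>h. lookup h n)"
  by (rule semilinearI) (auto simp: OU1_simps CC_simps lookup_add)

lemma proj0_linmap: "linmap A A proj0"
  unfolding proj0_def
  by (rule linmap_lift[OF coaction_linmap A.cspace_axioms OU1.cspace_axioms A.cspace_axioms
        functional_bilinear(1)[OF A.cspace_axioms lookup_linmap]])

lemma proj0_H: "x \<in> H n \<Longrightarrow> proj0 x = (if n = 0 then x else \<zero>)"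
  by (simp add: proj0_def H_coaction H_carrier lookup_single when_def
      T.lift_pure[OF A.cspace_axioms functional_bilinear(1)[OF A.cspace_axioms lookup_linmap]])

lemma proj0_in_H0: "x \<in> carrier A \<Longrightarrow> proj0 x \<in> H 0"
proof -
  assume x: "x \<in> carrier A"
  have H0: "H 0 \<subseteq> carrier A" by (auto simp: H_carrier)
  interpret H0: cspace_quot A "H 0" by unfold_locales (rule H_csub)
  have "proj0 x \<in> cspan A (H 0)"
    by (rule semilinear_cspan[OF proj0_linmap A.cspace_axioms A.cspace_axioms H_subset H0 _ H_span[OF x]])
       (use H0 in \<open>auto simp: proj0_H cspan.zero intro: A.cspan_base\<close>)
  moreover have "y \<in> H 0" if "y \<in> cspan A (H 0)" for y
    using that by induction (use H_csub[of 0] in \<open>auto simp: linear_sub_def\<close>)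
  ultimately show ?thesis by blast
qed

abbreviation "B' \<equiv> A\<lparr>carrier := H 0\<rparr>"

lemma B_algebra: "complex_algebra B'"
  using H_mult[of _ 0 _ 0] by (intro sub_algebra[OF A.complex_algebra_axioms H_csub H_one]) auto

lemma proj0_linmap_B: "linmap A B' proj0"
  using semilinearD[OF proj0_linmap] by (intro semilinearI) (auto simp: proj0_in_H0)

end

locale strongly_graded_coaction = graded_coaction +
  assumes strong_pos: "\<one> \<in> cspan A {r \<otimes> s | r s. r \<in> H (-1) \<and> s \<in> H 1}"
    and strong_neg: "\<one> \<in> cspan A {r \<otimes> s | r s. r \<in> H 1 \<and> s \<in> H (-1)}"
begin

abbreviation "D n \<equiv> {r \<otimes> s | r s. r \<in> H (-n) \<and> s \<in> H n}"

lemma D_carrier: "D n \<subseteq> carrier A"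
  by (auto simp: H_carrier)

text \<open>Write \<open>1 = \<Sum> r s\<close> in degree \<open>m\<close> and insert a decomposition \<open>1 = \<Sum> r' s'\<close> in degree \<open>n\<close> between the
  factors: \<open>1 = \<Sum> (r r') (s' s)\<close>.\<close>

lemma unit_step:
  assumes "\<one> \<in> cspan A (D m)" "\<one> \<in> cspan A (D n)"
  shows "\<one> \<in> cspan A (D (m + n))"
proof -
  have "r \<otimes> s \<in> cspan A (D (m + n))" if r: "r \<in> H (-m)" and s: "s \<in> H m" for r s
  proof -
    have rs: "r \<in> carrier A" "s \<in> carrier A" using r s by (auto simp: H_carrier)
    have lm: "linmap A A (\<lambda>x. r \<otimes> (x \<otimes> s))"
      using rs by (intro semilinearI) (auto simp: A.l_distr A.r_distr A.smult_mult_left A.smult_mult_right)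
    have "r \<otimes> (\<one> \<otimes> s) \<in> cspan A (D (m + n))"
    proof (rule semilinear_cspan[OF lm A.cspace_axioms A.cspace_axioms D_carrier D_carrier _ assms(2)])
      fix x assume "x \<in> D n"
      then obtain r' s' where x: "x = r' \<otimes> s'" "r' \<in> H (-n)" "s' \<in> H n" by auto
      have "r \<otimes> (x \<otimes> s) = (r \<otimes> r') \<otimes> (s' \<otimes> s)"
        using rs x H_carrier by (simp add: A.m_assoc)
      moreover have "r \<otimes> r' \<in> H (-(m+n))" "s' \<otimes> s \<in> H (m+n)"
        using H_mult[OF r x(2)] H_mult[OF x(3) s] by (simp_all add: add.commute)
      ultimately show "r \<otimes> (x \<otimes> s) \<in> cspan A (D (m + n))"
        by (intro A.cspan_base[OF D_carrier]) auto
    qed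
    then show ?thesis using rs by simp
  qed
  then have "D m \<subseteq> cspan A (D (m + n))" by blast
  from A.cspan_subset[OF D_carrier this] assms(1) show ?thesis by blast
qed

lemma unit_in_D: "\<one> \<in> cspan A (D n)"
proof (induction n rule: int_induct[where k = 0])
  case base
  have "\<one> \<otimes> \<one> \<in> D 0" using H_one by force
  then show ?case using A.cspan_base[OF D_carrier, of "\<one> \<otimes> \<one>" 0] by simp
next
  case (step1 n)
  show ?case by (rule unit_step[OF step1(2)]) (use strong_pos in simp)
next
  case (step2 n)
  show ?case using unit_step[OF step2(2), of "-1"] strong_neg by simp
qed

lemma strong_element:
  "\<exists>t. keys t \<subseteq> H (-n) \<times> H n \<and> lin A (\<lambda>p. fst p \<otimes> snd p) t = \<one>"
proof (rule cspan_image_lin[OF A.cspace_axioms])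
  show "(\<lambda>p. fst p \<otimes> snd p) \<in> H (- n) \<times> H n \<rightarrow> carrier A" by (auto simp: H_carrier)
  have "D n = (\<lambda>p. fst p \<otimes> snd p) ` (H (- n) \<times> H n)" by force
  then show "\<one> \<in> cspan A ((\<lambda>p. fst p \<otimes> snd p) ` (H (- n) \<times> H n))" using unit_in_D[of n] by simp
qed

text \<open>A decomposition of the unit in degree \<open>n\<close>, stored as a formal sum of pairs.\<close>

definition \<tau> :: "int \<Rightarrow> ('a \<times> 'a \<Rightarrow>\<^sub>0 complex)"
  where "\<tau> n = (SOME t. keys t \<subseteq> H (-n) \<times> H n \<and> lin A (\<lambda>p. fst p \<otimes> snd p) t = \<one>)"

lemma tau:
  "p \<in> keys (\<tau> n) \<Longrightarrow> fst p \<in> H (- n)"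
  "p \<in> keys (\<tau> n) \<Longrightarrow> snd p \<in> H n"
  "lin A (\<lambda>p. fst p \<otimes> snd p) (\<tau> n) = \<one>"
  using someI_ex[OF strong_element[of n], folded \<tau>_def] by auto

lemma tau_carrier:
  "p \<in> keys (\<tau> n) \<Longrightarrow> fst p \<in> carrier A"
  "p \<in> keys (\<tau> n) \<Longrightarrow> snd p \<in> carrier A"
  using tau(1,2) H_carrier by blast+

lemma lin_tau:
  assumes "cspace V" "linmap A V g" "\<And>p. p \<in> keys (\<tau> n) \<Longrightarrow> f p = g (fst p \<otimes> snd p)"
  shows "lin V f (\<tau> n) = g \<one>"
proof -
  interpret V: cspace V by fact
  have "lin V f (\<tau> n) = lin V (\<lambda>p. g (fst p \<otimes> snd p)) (\<tau> n)"
    by (rule V.lin_cong) (use assms tau_carrier semilinearD[OF assms(2)] in auto)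
  also have "\<dots> = g (lin A (\<lambda>p. fst p \<otimes> snd p) (\<tau> n))"
    by (rule linmap_lin[symmetric, OF assms(2) A.cspace_axioms assms(1)]) (use tau_carrier in auto)
  finally show ?thesis by (simp add: tau)
qed

interpretation T: tensor_algebras A OU1
  by unfold_locales

interpretation AU: complex_algebra "tensor A OU1"
  by (rule T.tensor_algebra)

text \<open>Sends \<open>a \<otimes> u\<^bsup>n\<^esup>\<close> to the sum of \<open>f (a r) s\<close> over the decomposition \<open>1 = \<Sum> r s\<close> in degree \<open>n\<close>. For
  \<open>a = 1\<close> and the pure tensor map \<open>f\<close> into the tensor product over the coinvariants, this is the
  translation map of the Hopf-Galois extension.\<close>

definition translate :: "(complex, 'v, 'k) module_scheme \<Rightarrow> ('a \<Rightarrow> 'a \<Rightarrow> 'v) \<Rightarrow> ('a, int \<Rightarrow>\<^sub>0 complex) tensor \<Rightarrow> 'v"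
  where "translate V f = tensor_lift V (\<lambda>a. lin V (\<lambda>n. lin V (\<lambda>p. f (a \<otimes> fst p) (snd p)) (\<tau> n)))"

lemma translate:
  assumes V: "cspace V" and f: "cbilinear A A V f"
  shows "linmap (tensor A OU1) V (translate V f)"
    and "a \<in> carrier A \<Longrightarrow> translate V f (pure A OU1 a (upow n)) = lin V (\<lambda>p. f (a \<otimes> fst p) (snd p)) (\<tau> n)"
proof -
  interpret V: cspace V by fact
  let ?g = "\<lambda>a n. lin V (\<lambda>p. f (a \<otimes> fst p) (snd p)) (\<tau> n)"
  have g: "linmap A V (\<lambda>a. ?g a n)" for n
  proof (rule linmap_param[OF V A.cspace_axioms])
    fix p assume p: "p \<in> keys (\<tau> n)"
    have 1: "linmap A A (\<lambda>a. a \<otimes> fst p)"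
      using tau_carrier[OF p] by (intro semilinearI) (auto simp: A.l_distr A.smult_mult_left)
    have 2: "linmap A V (\<lambda>x. f x (snd p))"
      using tau_carrier[OF p] f by (auto simp: cbilinear_def)
    show "linmap A V (\<lambda>a. f (a \<otimes> fst p) (snd p))"
      using semilinear_comp[OF 1 2] .
  qed
  have gc: "?g a n \<in> carrier V" if "a \<in> carrier A" for a n
    using semilinearD(1)[OF g that] .
  have b: "cbilinear A OU1 V (\<lambda>a. lin V (?g a))"
  proof (rule cbilinearI)
    show "linmap OU1 V (lin V (?g x))" if "x \<in> carrier A" for x
      by (rule OU1_lin_linmap[OF V gc[OF that]])
    show "linmap A V (\<lambda>x. lin V (?g x) y)" for y
      by (rule linmap_param[OF V A.cspace_axioms g])
  qed
  show "linmap (tensor A OU1) V (translate V f)"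
    unfolding translate_def by (rule T.lift_linmap[OF V b])
  show "translate V f (pure A OU1 a (upow n)) = lin V (\<lambda>p. f (a \<otimes> fst p) (snd p)) (\<tau> n)" if "a \<in> carrier A"
    unfolding translate_def using that gc[OF that] by (subst T.lift_pure[OF V b]) auto
qed

text \<open>On the one hand \<open>\<Sum> c r s \<otimes> u\<^bsup>n\<^esup> = c \<otimes> u\<^bsup>n\<^esup>\<close>. On the other hand, for \<open>c'\<close> of degree \<open>n\<close> the elements
  \<open>c' r\<close> have degree zero and may cross the balanced tensor sign:
  \<open>\<Sum> c c' r \<otimes> s = c \<otimes> \<Sum> c' r s = c \<otimes> c'\<close>.\<close>

lemma canonical_bijective:
  "bij_betw (canonical_map OU1 A \<rho>) (balanced_tensor A (H 0)) (carrier (tensor A OU1))"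
proof -
  let ?R = "bilinear_rels A A \<union> balanced_rels A (H 0)"
  interpret S: tensor_space A A ?R
    by (rule tensor_space_balanced[OF A.complex_algebra_axioms]) (auto simp: H_carrier)
  let ?c = "\<lambda>c c'. pure A OU1 c \<one>\<^bsub>OU1\<^esub> \<otimes>\<^bsub>tensor A OU1\<^esub> \<rho> c'"
  have car: "balanced_tensor A (H 0) = carrier S.T"
    by (simp add: balanced_tensor_def quot_alg_simps)
  have "linmap A (tensor A OU1) (\<lambda>c. pure A OU1 c \<one>\<^bsub>OU1\<^esub>)"
    by (rule cbilinearD(3)[OF T.pure_bilinear, of \<zero>]) auto
  from cbilinear_comp[OF mult_bilinear[OF AU.complex_algebra_axioms] this coaction_linmap]
  have bil: "cbilinear A A (tensor A OU1) ?c" .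
  have cH: "?c c c' = pure A OU1 (c \<otimes> c') (upow m)" if "c \<in> carrier A" "c' \<in> H m" for c c' m
    using that by (simp add: H_coaction H_carrier OU1_simps)
  have extra: "r \<in> bilinear_rels A A \<or> lin (tensor A OU1) (case_prod ?c) r = \<zero>\<^bsub>tensor A OU1\<^esub>" if r: "r \<in> ?R" for r
  proof (cases "r \<in> bilinear_rels A A")
    case False
    with r obtain x b y where r: "r = free_pair (x \<otimes> b) y - free_pair x (b \<otimes> y)"
      and xy: "x \<in> carrier A" "b \<in> H 0" "y \<in> carrier A"
      by (auto simp: balanced_rels_def)
    have b: "b \<in> carrier A" using xy H_carrier by auto
    have "?c (x \<otimes> b) y = ?c x (b \<otimes> y)"
      using xy b coaction_mult[OF b xy(3)] H_coaction[OF xy(2)] semilinearD(1)[OF coaction_linmap xy(3)]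
      by (simp add: OU1_simps AU.m_assoc[symmetric])
    moreover have "?c x (b \<otimes> y) \<in> carrier (tensor A OU1)"
      using cbilinearD(1)[OF bil] xy b by auto
    moreover have r': "r = single (x \<otimes> b, y) 1 + single (x, b \<otimes> y) (-1)"
      by (simp add: r single_uminus)
    moreover have "case_prod ?c \<in> carrier A \<times> carrier A \<rightarrow> carrier (tensor A OU1)"
      using cbilinearD(1)[OF bil] by auto
    ultimately have "lin (tensor A OU1) (case_prod ?c) r = \<zero>\<^bsub>tensor A OU1\<^esub>"
      using xy b unfolding r'
      by (subst AU.lin_add) (auto simp: AU.smult_minus_1 AU.r_neg)
    then show ?thesis by simp
  qed simp
  let ?can = "canonical_map OU1 A \<rho>"
  have can1: "linmap S.T (tensor A OU1) ?can"
    unfolding canonical_map_def by (rule S.tensor_lift_linmap[OF AU.cspace_axioms bil extra])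
  have can2: "?can (S.pu x y) = ?c x y" if "x \<in> carrier A" "y \<in> carrier A" for x y
    unfolding canonical_map_def using that by (intro S.tensor_lift_pu[OF AU.cspace_axioms bil extra]) auto
  let ?inv = "translate S.T S.pu"
  note inv = translate[OF S.T_cspace S.pu_bilinear]
  have balanced: "S.pu (x \<otimes> b) y = S.pu x (b \<otimes> y)" if "x \<in> carrier A" "b \<in> H 0" "y \<in> carrier A" for x b y
    unfolding S.pu_def using that H_carrier
    by (intro S.rel_eq S.free_pair_closed) (auto simp: balanced_rels_def)
  have H_all: "carrier A \<subseteq> cspan A (\<Union>n. H n)" "carrier A \<subseteq> cspan A (carrier A)"
    using H_span A.cspan_base by auto
  have U_all: "carrier OU1 \<subseteq> cspan OU1 (range upow)"
    using OU1_span by auto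
  have left: "?inv (?can z) = z" if z: "z \<in> carrier S.T" for z
  proof (rule S.T_ext[OF semilinear_comp[OF can1 inv(1)] linmap_id S.T_cspace subset_refl H_all(2) H_subset H_all(1) _ z])
    fix x y assume x: "x \<in> carrier A" and "y \<in> (\<Union>n. H n)"
    then obtain m where m: "y \<in> H m" by auto
    then have y: "y \<in> carrier A" by (rule H_carrier)
    have "?inv (?can (S.pu x y)) = lin S.T (\<lambda>p. S.pu ((x \<otimes> y) \<otimes> fst p) (snd p)) (\<tau> m)"
      using x y by (simp add: can2 cH[OF x m] inv(2))
    also have "\<dots> = S.pu x (y \<otimes> \<one>)"
    proof (rule lin_tau[OF S.T_cspace])
      have "linmap A A (\<lambda>v. y \<otimes> v)"
        using y by (intro semilinearI) (auto simp: A.r_distr A.smult_mult_right)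
      from semilinear_comp[OF this cbilinearD(2)[OF S.pu_bilinear x x]]
      show "linmap A S.T (\<lambda>v. S.pu x (y \<otimes> v))" .
      fix p assume p: "p \<in> keys (\<tau> m)"
      have "y \<otimes> fst p \<in> H 0" using H_mult[OF m tau(1)[OF p]] by simp
      then show "S.pu ((x \<otimes> y) \<otimes> fst p) (snd p) = S.pu x (y \<otimes> (fst p \<otimes> snd p))"
        using balanced[OF x, of "y \<otimes> fst p" "snd p"] x y tau_carrier[OF p] by (simp add: A.m_assoc)
    qed
    finally show "?inv (?can (S.pu x y)) = S.pu x y" using y by simp
  qed
  have right: "?can (?inv z) = z" if z: "z \<in> carrier (tensor A OU1)" for z
  proof (rule T.tensor_ext[OF semilinear_comp[OF inv(1) can1] linmap_id AU.cspace_axioms subset_refl H_all(2) _ U_all _ z])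
    show "range upow \<subseteq> carrier OU1" by simp
    fix x y assume x: "x \<in> carrier A" and "y \<in> range upow"
    then obtain n where y: "y = upow n" by auto
    have "?can (?inv (pure A OU1 x y)) = ?can (lin S.T (\<lambda>p. S.pu (x \<otimes> fst p) (snd p)) (\<tau> n))"
      using x by (simp add: y inv(2))
    also have "\<dots> = lin (tensor A OU1) (\<lambda>p. ?can (S.pu (x \<otimes> fst p) (snd p))) (\<tau> n)"
      by (rule linmap_lin[OF can1 S.T_cspace AU.cspace_axioms]) (use x tau_carrier in auto)
    also have "\<dots> = pure A OU1 (x \<otimes> \<one>) y"
    proof (rule lin_tau[OF AU.cspace_axioms])
      have "linmap A A (\<lambda>v. x \<otimes> v)"
        using x by (intro semilinearI) (auto simp: A.r_distr A.smult_mult_right)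
      from semilinear_comp[OF this cbilinearD(3)[OF T.pure_bilinear x, of y]]
      show "linmap A (tensor A OU1) (\<lambda>v. pure A OU1 (x \<otimes> v) y)" by simp
      fix p assume p: "p \<in> keys (\<tau> n)"
      show "?can (S.pu (x \<otimes> fst p) (snd p)) = pure A OU1 (x \<otimes> (fst p \<otimes> snd p)) y"
        using x tau_carrier[OF p] cH[OF _ tau(2)[OF p], of "x \<otimes> fst p"] by (simp add: can2 y A.m_assoc)
    qed
    finally show "?can (?inv (pure A OU1 x y)) = pure A OU1 x y" using x by simp
  qed
  show ?thesis
    unfolding car
    by (rule bij_betw_byWitness[of _ ?inv])
       (use left right semilinearD(1)[OF can1] semilinearD(1)[OF inv(1)] in auto)
qed

text \<open>The section is \<open>x \<mapsto> \<Sum> x r \<otimes> s\<close> on elements of degree \<open>n\<close>. The projection of \<open>x r\<close> to degree zero does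
  nothing for these \<open>x\<close>, but makes the formula a linear map on all of \<open>A\<close> with values in the tensor
  product of the coinvariants with \<open>A\<close>.\<close>

lemma splitting: "\<exists>s. mult_splitting OU1 A \<rho> (H 0) s"
proof
  interpret B: complex_algebra B' by (rule B_algebra)
  interpret BA: tensor_pair B' A by unfold_locales
  let ?BA = "tensor B' A"
  interpret BAc: cspace ?BA by (rule BA.tensor_cspace)
  interpret BAU: tensor_pair ?BA OU1 by unfold_locales
  interpret B_AU: tensor_pair B' "tensor A OU1" by unfold_locales
  interpret BAUc: cspace "tensor B' (tensor A OU1)" by (rule B_AU.tensor_cspace)
  note U = OU1.cspace_axioms and A = A.cspace_axioms and B = B.cspace_axioms
  have B_carrier: "carrier B' = H 0" by simp
  let ?f = "\<lambda>x y. pure B' A (proj0 x) y"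
  have f: "cbilinear A A ?BA ?f"
    by (rule cbilinear_comp[OF BA.pure_bilinear proj0_linmap_B linmap_id])
  define s where "s x = translate ?BA ?f (\<rho> x)" for x
  note tr = translate[OF BAc.cspace_axioms f]
  have s_lin: "linmap A ?BA s"
    unfolding s_def using semilinear_comp[OF coaction_linmap tr(1)] .
  have pure_H: "pure B' A x y \<in> carrier ?BA" if "x \<in> H 0" "y \<in> carrier A" for x y
    using that by (intro BA.pure_closed) auto
  have xr: "x \<otimes> fst p \<in> H 0" if "x \<in> H n" "p \<in> keys (\<tau> n)" for x p n
    using H_mult[OF that(1) tau(1)[OF that(2)]] by simp
  have s_H: "s x = lin ?BA (\<lambda>p. pure B' A (x \<otimes> fst p) (snd p)) (\<tau> n)" if x: "x \<in> H n" for x n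
  proof -
    have "s x = lin ?BA (\<lambda>p. ?f (x \<otimes> fst p) (snd p)) (\<tau> n)"
      using x by (simp add: s_def H_coaction H_carrier tr(2))
    also have "\<dots> = lin ?BA (\<lambda>p. pure B' A (x \<otimes> fst p) (snd p)) (\<tau> n)"
      by (rule BAc.lin_cong) (use xr[OF x] tau_carrier pure_H in \<open>auto simp: proj0_H[where n = 0]\<close>)
    finally show ?thesis .
  qed
  have push: "g (s x) = lin V (\<lambda>p. g (pure B' A (x \<otimes> fst p) (snd p))) (\<tau> n)"
    if "linmap ?BA V g" "cspace V" "x \<in> H n" for g x n and V :: "(complex, 'v, 'k) module_scheme"
    unfolding s_H[OF that(3)]
    by (rule linmap_lin[OF that(1) BAc.cspace_axioms that(2)]) (use xr[OF that(3)] tau_carrier pure_H in auto)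
  have mult: "cbilinear B' A A (\<lambda>b y. b \<otimes> y)"
    by (rule cbilinearI; rule semilinearI)
       (auto simp: H_carrier A.l_distr A.r_distr A.smult_mult_left A.smult_mult_right)
  show "mult_splitting OU1 A \<rho> (H 0) s"
    unfolding mult_splitting_def Let_def
  proof (intro conjI ballI)
    show "s \<in> carrier A \<rightarrow> carrier ?BA" using semilinearD(1)[OF s_lin] by auto
    show "s (x \<oplus> y) = s x \<oplus>\<^bsub>?BA\<^esub> s y" if "x \<in> carrier A" "y \<in> carrier A" for x y
      using semilinearD(2)[OF s_lin that] .
  next
    fix b x assume b: "b \<in> H 0" and x: "x \<in> carrier A"
    have bA: "b \<in> carrier A" using b H_carrier by auto
    have lb: "linmap B' B' (\<lambda>b'. b \<otimes> b')"
      using H_mult[OF b, of _ 0] by (intro semilinearI) (auto simp: H_carrier bA A.r_distr A.smult_mult_right)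
    have lA: "linmap A A (\<lambda>b'. b \<otimes> b')"
      using bA by (intro semilinearI) (auto simp: A.r_distr A.smult_mult_right)
    note tm = tensor_map_linmap[OF B A B A lb linmap_id]
    show "s (b \<otimes> x) = tensor_map B' A (\<lambda>b'. b \<otimes> b') (\<lambda>y. y) (s x)"
    proof (rule homogeneous_ext[OF semilinear_comp[OF lA s_lin] semilinear_comp[OF s_lin tm(1)] BAc.cspace_axioms _ x])
      fix n x assume x: "x \<in> H n"
      have bx: "b \<otimes> x \<in> H n" using H_mult[OF b x] by simp
      show "s (b \<otimes> x) = tensor_map B' A (\<lambda>b'. b \<otimes> b') (\<lambda>y. y) (s x)"
        unfolding push[OF tm(1) BAc.cspace_axioms x] s_H[OF bx]
        by (rule BAc.lin_cong)
           (use xr[OF x] xr[OF bx] tau_carrier x in \<open>auto simp: tm(2) H_carrier bA A.m_assoc[symmetric] intro!: pure_H\<close>)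
    qed
  next
    fix x assume x: "x \<in> carrier A"
    note tm1 = tensor_map_linmap[OF BAc.cspace_axioms U A U s_lin linmap_id]
    note as = tensor_assoc_linmap[OF B A U]
    note tm2 = tensor_map_linmap[OF B AU.cspace_axioms B A linmap_id coaction_linmap]
    show "tensor_assoc B' A OU1 (tensor_map ?BA OU1 s (\<lambda>h. h) (\<rho> x)) =
        tensor_map B' (tensor A OU1) (\<lambda>b. b) \<rho> (s x)"
    proof (rule homogeneous_ext[OF semilinear_comp[OF semilinear_comp[OF coaction_linmap tm1(1)] as(1)]
            semilinear_comp[OF s_lin tm2(1)] BAUc.cspace_axioms _ x])
      fix n x assume x: "x \<in> H n"
      have sx: "s x \<in> carrier ?BA" using x semilinearD(1)[OF s_lin] H_carrier by auto
      have l: "linmap ?BA (tensor B' (tensor A OU1)) (\<lambda>v. tensor_assoc B' A OU1 (pure ?BA OU1 v (upow n)))"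
        using semilinear_comp[OF cbilinearD(3)[OF BAU.pure_bilinear sx, of "upow n"] as(1)] by simp
      have "tensor_assoc B' A OU1 (tensor_map ?BA OU1 s (\<lambda>h. h) (\<rho> x)) =
          tensor_assoc B' A OU1 (pure ?BA OU1 (s x) (upow n))"
        using x by (simp add: H_coaction H_carrier tm1(2))
      also have "\<dots> = lin (tensor B' (tensor A OU1))
          (\<lambda>p. tensor_assoc B' A OU1 (pure ?BA OU1 (pure B' A (x \<otimes> fst p) (snd p)) (upow n))) (\<tau> n)"
        by (rule push[OF l BAUc.cspace_axioms x])
      also have "\<dots> = lin (tensor B' (tensor A OU1))
          (\<lambda>p. tensor_map B' (tensor A OU1) (\<lambda>b. b) \<rho> (pure B' A (x \<otimes> fst p) (snd p))) (\<tau> n)"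
        by (rule BAUc.lin_cong)
           (use xr[OF x] tau_carrier tau(2) in \<open>auto simp: as(2) tm2(2) H_coaction[OF tau(2)] intro!: B_AU.pure_closed T.pure_closed\<close>)
      also have "\<dots> = tensor_map B' (tensor A OU1) (\<lambda>b. b) \<rho> (s x)"
        by (rule push[OF tm2(1) BAUc.cspace_axioms x, symmetric])
      finally show "tensor_assoc B' A OU1 (tensor_map ?BA OU1 s (\<lambda>h. h) (\<rho> x)) =
        tensor_map B' (tensor A OU1) (\<lambda>b. b) \<rho> (s x)" .
    qed
  next
    fix x assume x: "x \<in> carrier A"
    note lm = BA.lift_linmap[OF A mult]
    show "tensor_lift A (\<lambda>b y. b \<otimes> y) (s x) = x"
    proof (rule homogeneous_ext[OF semilinear_comp[OF s_lin lm] linmap_id A _ x])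
      fix n x assume x: "x \<in> H n"
      have xA: "x \<in> carrier A" using x H_carrier by auto
      have "tensor_lift A (\<lambda>b y. b \<otimes> y) (s x) =
          lin A (\<lambda>p. tensor_lift A (\<lambda>b y. b \<otimes> y) (pure B' A (x \<otimes> fst p) (snd p))) (\<tau> n)"
        by (rule push[OF lm A x])
      also have "\<dots> = x \<otimes> \<one>"
      proof (rule lin_tau[OF A])
        show "linmap A A (\<lambda>v. x \<otimes> v)"
          using xA by (intro semilinearI) (auto simp: A.r_distr A.smult_mult_right)
        fix p assume p: "p \<in> keys (\<tau> n)"
        show "tensor_lift A (\<lambda>b y. b \<otimes> y) (pure B' A (x \<otimes> fst p) (snd p)) = x \<otimes> (fst p \<otimes> snd p)"
          using xr[OF x p] tau_carrier[OF p] xA by (subst BA.lift_pure[OF A mult]) (auto simp: A.m_assoc)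
      qed
      finally show "tensor_lift A (\<lambda>b y. b \<otimes> y) (s x) = x" using xA by simp
    qed
  qed
qed

theorem principal: "principal_comodule_algebra OU1 OU1_comult OU1_counit OU1_antipode A \<rho>"
  by (intro principal_comodule_algebra.intro principal_comodule_algebra_axioms.intro comodule_algebra;
      unfold coinvariants_eq; rule canonical_bijective splitting)

end

section \<open>The quantum sphere and its monomials\<close>

interpretation WI: monoid_involution word_adj
  by unfold_locales (auto simp: word_adj_def plus_word_def rev_map o_def apsnd_def map_prod_def split_beta)

lemma free_star_algebra_eq: "free_star_algebra = monoid_star_alg word_adj"
  by (simp add: free_star_algebra_def)

lemma FS_simps:
  "carrier free_star_algebra = UNIV"
  "monoid.mult free_star_algebra = (*)"
  "one free_star_algebra = 1"
  "zero free_star_algebra = 0"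
  "add free_star_algebra = (+)"
  "module.smult free_star_algebra = cscale"
  "star free_star_algebra = WI.st"
  by (simp_all add: free_star_algebra_def type_star_alg_simps)

interpretation FS: star_algebra free_star_algebra
  unfolding free_star_algebra_eq by (rule WI.star_algebra)

lemma FS_minus: "f \<ominus>\<^bsub>free_star_algebra\<^esub> g = f - g"
proof -
  have "\<ominus>\<^bsub>free_star_algebra\<^esub> g = - g"
    using FS.smult_minus_1[of g] by (simp add: FS_simps free_cvs.scale_minus_left)
  then show ?thesis by (simp add: FS.minus_eq FS_simps)
qed

lemma st_free_gen: "WI.st (free_gen g x) = free_gen g (\<not> x)"
  by (simp add: free_gen_def WI.st_single word_adj_def)

lemma st_diff: "WI.st (f - g) = WI.st f - WI.st g"
  using WI.st_add[of "f - g" g] by (simp add: algebra_simps)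

lemma st_one: "WI.st 1 = 1"
  using FS.star_one by (simp add: FS_simps)

lemma st_power: "WI.st (f ^ n) = WI.st f ^ n"
  by (induction n) (simp_all add: st_one WI.st_mult power_commutes)

lemma st_cscale: "WI.st (cscale c f) = cscale (cnj c) (WI.st f)"
  using FS.star_smult[of f c] by (simp add: FS_simps)

lemma word_induct [case_names Nil Cons]:
  assumes "P 1" "\<And>g x w. P (single w 1) \<Longrightarrow> P (free_gen g x * single w 1)"
  shows "P (single (w :: word) (1 :: complex))"
proof -
  have "P (single (Word ls) (1 :: complex))" for ls
  proof (induction ls)
    case Nil
    then show ?case using assms(1) by (simp add: zero_word_def[symmetric])
  next
    case (Cons l ls)
    have "single (Word (l # ls)) (1 :: complex) = free_gen (fst l) (snd l) * single (Word ls) 1"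
      by (simp add: free_gen_def mult_single plus_word_def)
    then show ?case using assms(2)[OF Cons] by simp
  qed
  then show ?thesis by (cases w) auto
qed

abbreviation "ga \<equiv> free_gen Gen_a False"
abbreviation "ga' \<equiv> free_gen Gen_a True"
abbreviation "gb \<equiv> free_gen Gen_b False"
abbreviation "gb' \<equiv> free_gen Gen_b True"

definition "eA = 1 - ga * ga'"
definition "eB = 1 - gb * gb'"

text \<open>The \<open>m\<close>-th power of \<open>x\<close>, with \<open>x'\<close> in the role of the inverse.\<close>

definition pw :: "free_elem \<Rightarrow> free_elem \<Rightarrow> int \<Rightarrow> free_elem"
  where "pw x x' m = (if 0 \<le> m then x ^ nat m else x' ^ nat (- m))"

definition mon :: "nat \<Rightarrow> nat \<Rightarrow> int \<Rightarrow> int \<Rightarrow> free_elem"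
  where "mon r s m n = eA ^ r * eB ^ s * pw ga ga' m * pw gb gb' n"

lemmas cscale_algebra = cscale_mult_left cscale_mult_right free_cvs.scale_right_diff_distrib
  free_cvs.scale_left_diff_distrib free_cvs.scale_right_distrib free_cvs.scale_left_distrib

lemma st_eB: "WI.st eB = eB"
  by (simp add: eB_def st_diff st_one WI.st_mult st_free_gen)

locale sphere =
  fixes p q \<theta> :: real
  assumes p_pos: "0 < p" and q_pos: "0 < q"
begin

sublocale FQ: star_quotient free_star_algebra "S3_rels p q \<theta>"
  by unfold_locales (simp add: FS_simps)

abbreviation "R \<equiv> OS3 p q \<theta>"
abbreviation "I \<equiv> star_ideal free_star_algebra (S3_rels p q \<theta>)"

definition cls :: "free_elem \<Rightarrow> sphere_elem"
  where "cls f = quot_class free_star_algebra (S3_rels p q \<theta>) f"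

lemma cls_coset: "cls f = I +>\<^bsub>free_star_algebra\<^esub> f"
  by (simp add: cls_def quot_class_def)

sublocale R: star_algebra R
  unfolding OS3_def by (rule FQ.S_star_algebra)

lemma cls_simps:
  "cls f \<in> carrier R"
  "cls f \<oplus>\<^bsub>R\<^esub> cls g = cls (f + g)"
  "cls f \<otimes>\<^bsub>R\<^esub> cls g = cls (f * g)"
  "c \<odot>\<^bsub>R\<^esub> cls f = cls (cscale c f)"
  "\<one>\<^bsub>R\<^esub> = cls 1" "\<zero>\<^bsub>R\<^esub> = cls 0"
  "star R (cls f) = cls (WI.st f)"
  using FQ.S_simps(1)[of f] FQ.S_simps(2,3)[of f g] FQ.S_simps(4)[of f] FQ.S_simps(5,6) FQ.quot_star[of f]
  by (simp_all add: cls_coset OS3_def FS_simps)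

lemma carrier_R: "carrier R = range cls"
  by (auto simp: OS3_def FQ.S_carrier cls_coset[abs_def] FS_simps)

lemma cls_star_hom: "cls \<in> star_hom free_star_algebra R"
  by (rule star_homI, rule semilinearI) (auto simp: cls_simps FS_simps)

lemma cls_eq: "cls f = cls g \<longleftrightarrow> f - g \<in> I"
  unfolding cls_coset using FQ.Q_eq[of f g] by (simp add: FS_simps FS_minus)

lemma cls_minus: "cls f \<ominus>\<^bsub>R\<^esub> cls g = cls (f - g)"
  using semilinear_minus[OF star_homD(1)[OF cls_star_hom] FS.cspace_axioms R.cspace_axioms, of f g]
  by (simp add: FS_simps FS_minus)

lemma cls_pow: "cls f [^]\<^bsub>R\<^esub> (n :: nat) = cls (f ^ n)"
  by (induction n) (simp_all add: cls_simps power_commutes[symmetric] power_Suc2 del: power_Suc)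

lemma gen_a_eq: "gen_a p q \<theta> = cls ga" and gen_b_eq: "gen_b p q \<theta> = cls gb"
  by (simp_all add: gen_a_def gen_b_def cls_def)

lemma elem_A_eq: "elem_A p q \<theta> = cls eA" and elem_B_eq: "elem_B p q \<theta> = cls eB"
  by (simp_all add: elem_A_def elem_B_def Let_def gen_a_eq gen_b_eq cls_simps cls_minus st_free_gen eA_def eB_def)

subsection \<open>Congruence modulo the relations\<close>

text \<open>Calculations are done with representatives in the free algebra, where ring identities are within
  reach of the simplifier.\<close>

definition cong :: "free_elem \<Rightarrow> free_elem \<Rightarrow> bool" (infix "\<approx>" 50)
  where "f \<approx> g \<longleftrightarrow> cls f = cls g"

lemma cong_refl [simp, intro]: "f \<approx> f" by (simp add: cong_def)
lemma cong_trans [trans]: "f \<approx> g \<Longrightarrow> g \<approx> h \<Longrightarrow> f \<approx> h" by (simp add: cong_def)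
lemma cong_add: "f \<approx> f' \<Longrightarrow> g \<approx> g' \<Longrightarrow> f + g \<approx> f' + g'"
  by (simp add: cong_def cls_simps(2)[symmetric])
lemma cong_mult: "f \<approx> f' \<Longrightarrow> g \<approx> g' \<Longrightarrow> f * g \<approx> f' * g'"
  by (simp add: cong_def cls_simps(3)[symmetric])
lemma cong_cscale: "f \<approx> f' \<Longrightarrow> cscale c f \<approx> cscale c f'"
  by (simp add: cong_def cls_simps(4)[symmetric])
lemma cong_diff: "f \<approx> f' \<Longrightarrow> g \<approx> g' \<Longrightarrow> f - g \<approx> f' - g'"
  by (simp add: cong_def cls_minus[symmetric])
lemma cong_st: "f \<approx> f' \<Longrightarrow> WI.st f \<approx> WI.st f'"
  by (simp add: cong_def cls_simps(7)[symmetric])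

lemma cong_rel: "r \<in> S3_rels p q \<theta> \<Longrightarrow> r \<approx> 0"
  using FQ.relation_in_ideal[of r] by (simp add: cong_def cls_eq)

text \<open>The scalars \<open>e\<^bsup>2\<pi>i\<theta>\<^esup>\<close> and \<open>e\<^bsup>-2\<pi>i\<theta>\<^esup>\<close> of the relations.\<close>

definition L :: complex where "L = cis (2 * pi * \<theta>)"
definition L' :: complex where "L' = cis (- (2 * pi * \<theta>))"

lemma LL: "L * L' = 1" "L' * L = 1"
  by (simp_all add: L_def L'_def cis_mult)

lemma cnj_L: "cnj L = L'" "cnj L' = L"
  by (simp_all add: L_def L'_def cis_cnj)

lemma exp_L: "exp (2 * of_real pi * \<i> * of_real \<theta>) = L" "exp (- 2 * of_real pi * \<i> * of_real \<theta>) = L'"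
  by (simp_all add: L_def L'_def cis_conv_exp mult_ac)

lemma rel_ab: "ga * gb - cscale L (gb * ga) \<approx> 0"
  and rel_ab': "ga * gb' - cscale L' (gb' * ga) \<approx> 0"
  and rel_a: "ga' * ga - cscale (of_real p) (ga * ga') - cscale (of_real (1 - p)) 1 \<approx> 0"
  and rel_b: "gb' * gb - cscale (of_real q) (gb * gb') - cscale (of_real (1 - q)) 1 \<approx> 0"
  and rel_AB: "eA * eB \<approx> 0"
  unfolding eA_def eB_def by (rule cong_rel; simp add: S3_rels_def Let_def exp_L[simplified])+

lemma cong_iff_diff: "f \<approx> g \<longleftrightarrow> f - g \<approx> 0"
  by (simp add: cong_def cls_eq)

definition qcomm :: "complex \<Rightarrow> free_elem \<Rightarrow> free_elem \<Rightarrow> bool"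
  where "qcomm c f g \<longleftrightarrow> f * g \<approx> cscale c (g * f)"

lemma qcomm_one [simp]: "qcomm 1 f 1"
  by (simp add: qcomm_def)

lemma qcomm_mult:
  assumes "qcomm c f g" "qcomm d f h"
  shows "qcomm (c * d) f (g * h)"
proof -
  have "f * (g * h) = (f * g) * h" by (simp add: mult.assoc)
  also have "\<dots> \<approx> cscale c (g * f) * h" using assms unfolding qcomm_def by (intro cong_mult) auto
  also have "\<dots> = cscale c (g * (f * h))" by (simp add: cscale_mult_left mult.assoc)
  also have "\<dots> \<approx> cscale c (g * cscale d (h * f))" using assms unfolding qcomm_def by (intro cong_cscale cong_mult) auto
  also have "\<dots> = cscale (c * d) ((g * h) * f)" by (simp add: cscale_mult_right mult.assoc)
  finally show ?thesis by (simp add: qcomm_def)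
qed

lemma qcomm_power: "qcomm c f g \<Longrightarrow> qcomm (c ^ n) f (g ^ n)"
  by (induction n) (auto intro: qcomm_mult)

lemma qcomm_sym: "qcomm c f g \<Longrightarrow> c * d = 1 \<Longrightarrow> qcomm d g f"
proof -
  assume "qcomm c f g" "c * d = 1"
  then have "cscale d (f * g) \<approx> cscale d (cscale c (g * f))"
    unfolding qcomm_def by (intro cong_cscale) auto
  then show ?thesis using \<open>c * d = 1\<close> by (simp add: qcomm_def mult.commute cong_def)
qed

lemma qcomm_st: "qcomm c f g \<Longrightarrow> qcomm (cnj c) (WI.st g) (WI.st f)"
  unfolding qcomm_def using cong_st[of "f * g" "cscale c (g * f)"] by (simp add: WI.st_mult st_cscale)

lemma qcomm_diff: "qcomm c f g \<Longrightarrow> qcomm c f h \<Longrightarrow> qcomm c f (g - h)"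
  unfolding qcomm_def using cong_diff[of "f * g" _ "f * h"] by (simp add: algebra_simps cscale_algebra)

lemma qcomm_ab: "qcomm L ga gb" and qcomm_ab': "qcomm L' ga gb'"
  using rel_ab rel_ab' by (simp_all add: qcomm_def cong_iff_diff[of "_ * _"])

lemma qcomm_ba: "qcomm L' gb ga" and qcomm_b'a: "qcomm L gb' ga"
  using qcomm_sym[OF qcomm_ab LL(1)] qcomm_sym[OF qcomm_ab' LL(2)] by auto

lemma qcomm_ba': "qcomm L gb ga'" and qcomm_b'a': "qcomm L' gb' ga'"
  using qcomm_st[OF qcomm_ab'] qcomm_st[OF qcomm_ab] by (simp_all add: st_free_gen cnj_L)

lemma qcomm_a'b: "qcomm L' ga' gb" and qcomm_a'b': "qcomm L ga' gb'"
  using qcomm_sym[OF qcomm_ba' LL(1)] qcomm_sym[OF qcomm_b'a' LL(2)] by auto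

text \<open>The scalars for \<open>a\<close> and \<open>a\<^sup>*\<close> are inverse to each other, so \<open>b\<close> and \<open>b\<^sup>*\<close> commute with \<open>a a\<^sup>*\<close>.\<close>

lemma qcomm_b_eA: "qcomm 1 gb eA" "qcomm 1 gb' eA"
  unfolding eA_def
  using qcomm_mult[OF qcomm_ba qcomm_ba'] qcomm_mult[OF qcomm_b'a qcomm_b'a'] by (auto simp: LL intro!: qcomm_diff)

lemma qcomm_a_eB: "qcomm 1 ga eB" "qcomm 1 ga' eB"
  unfolding eB_def
  using qcomm_mult[OF qcomm_ab qcomm_ab'] qcomm_mult[OF qcomm_a'b qcomm_a'b'] by (auto simp: LL intro!: qcomm_diff)

lemma qcomm_eB_eA: "qcomm 1 eB eA"
proof -
  have "qcomm 1 eB ga" "qcomm 1 eB ga'" using qcomm_a_eB by (auto intro: qcomm_sym)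
  from qcomm_mult[OF this] show ?thesis unfolding eA_def by (auto intro!: qcomm_diff)
qed

lemma a'a: "ga' * ga \<approx> 1 - cscale (of_real p) eA"
proof -
  have "ga' * ga - (1 - cscale (of_real p) eA) =
      ga' * ga - cscale (of_real p) (ga * ga') - cscale (of_real (1 - p)) 1"
    by (simp add: eA_def cscale_algebra algebra_simps)
  then show ?thesis using rel_a cong_iff_diff by metis
qed

lemma b'b: "gb' * gb \<approx> 1 - cscale (of_real q) eB"
proof -
  have "gb' * gb - (1 - cscale (of_real q) eB) =
      gb' * gb - cscale (of_real q) (gb * gb') - cscale (of_real (1 - q)) 1"
    by (simp add: eB_def cscale_algebra algebra_simps)
  then show ?thesis using rel_b cong_iff_diff by metis
qed

text \<open>Compare \<open>x (x' x)\<close> with \<open>(x x') x\<close>, and \<open>(x' x) x'\<close> with \<open>x' (x x')\<close>. The lemmas about such a pair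
  apply to \<open>a, a\<^sup>*\<close> with \<open>e = A\<close>, \<open>t = p\<close> and to \<open>b, b\<^sup>*\<close> with \<open>e = B\<close>, \<open>t = q\<close>.\<close>

lemma pair_commutation:
  assumes "e = 1 - x * x'" "x' * x \<approx> 1 - cscale t e"
  shows "qcomm t e x" "qcomm t x' e"
proof -
  have "e * x = x - x * (x' * x)" by (simp add: assms(1) algebra_simps)
  also have "\<dots> \<approx> x - x * (1 - cscale t e)" using assms by (intro cong_diff cong_mult) auto
  also have "\<dots> = cscale t (x * e)" by (simp add: algebra_simps cscale_algebra)
  finally show "qcomm t e x" by (simp add: qcomm_def)
  have "x' * e = x' - (x' * x) * x'" by (simp add: assms(1) algebra_simps)
  also have "\<dots> \<approx> x' - (1 - cscale t e) * x'" using assms by (intro cong_diff cong_mult) auto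
  also have "\<dots> = cscale t (e * x')" by (simp add: algebra_simps cscale_algebra)
  finally show "qcomm t x' e" by (simp add: qcomm_def)
qed

lemma qcomm_A: "qcomm (of_real p) eA ga" "qcomm (of_real p) ga' eA"
  using pair_commutation[OF eA_def a'a] by auto

lemma qcomm_B: "qcomm (of_real q) eB gb" "qcomm (of_real q) gb' eB"
  using pair_commutation[OF eB_def b'b] by auto

lemma qcomm_A': "qcomm (1 / of_real p) ga eA" "qcomm (1 / of_real p) eA ga'"
  using qcomm_sym[OF qcomm_A(1)] qcomm_sym[OF qcomm_A(2)] p_pos by auto

lemma qcomm_B': "qcomm (1 / of_real q) gb eB" "qcomm (1 / of_real q) eB gb'"
  using qcomm_sym[OF qcomm_B(1)] qcomm_sym[OF qcomm_B(2)] q_pos by auto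

text \<open>For spanning statements the scalar does not matter.\<close>

definition scomm :: "free_elem \<Rightarrow> free_elem \<Rightarrow> bool"
  where "scomm f g \<longleftrightarrow> (\<exists>c. qcomm c f g)"

lemma scommI: "qcomm c f g \<Longrightarrow> scomm f g" by (auto simp: scomm_def)
lemma scomm_mult: "scomm f g \<Longrightarrow> scomm f h \<Longrightarrow> scomm f (g * h)"
  by (auto simp: scomm_def intro: qcomm_mult)
lemma scomm_power: "scomm f g \<Longrightarrow> scomm f (g ^ n)"
  by (auto simp: scomm_def intro: qcomm_power)
lemma scomm_pw: "scomm f x \<Longrightarrow> scomm f x' \<Longrightarrow> scomm f (pw x x' m)"
  by (auto simp: pw_def intro: scomm_power)

text \<open>Either the exponent just moves, or a product \<open>x x'\<close> or \<open>x' x\<close> is cancelled and leaves a factor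
  \<open>1 + c e\<close>.\<close>

lemma pair_step:
  assumes "e = 1 - x * x'" "x' * x \<approx> 1 - cscale t e"
  shows "\<exists>c. x * pw x x' m \<approx> pw x x' (m + 1) + cscale c (e * pw x x' (m + 1))"
    and "\<exists>c. x' * pw x x' m \<approx> pw x x' (m - 1) + cscale c (e * pw x x' (m - 1))"
proof -
  show "\<exists>c. x * pw x x' m \<approx> pw x x' (m + 1) + cscale c (e * pw x x' (m + 1))"
  proof (cases "0 \<le> m")
    case True
    then have "x * pw x x' m = pw x x' (m + 1)" by (simp add: pw_def nat_add_distrib)
    then show ?thesis by (intro exI[of _ 0]) simp
  next
    case False
    define k where "k = nat (- m) - 1"
    have k: "nat (- m) = Suc k" "pw x x' (m + 1) = x' ^ k" using False by (auto simp: k_def pw_def nat_diff_distrib)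
    have "x * pw x x' m = (x * x') * x' ^ k" using False k by (simp add: pw_def mult.assoc)
    also have "\<dots> = x' ^ k + cscale (-1) (e * x' ^ k)"
      by (simp add: assms(1) cscale_algebra algebra_simps free_cvs.scale_minus_left)
    finally show ?thesis by (intro exI[of _ "-1"]) (simp add: k)
  qed
  show "\<exists>c. x' * pw x x' m \<approx> pw x x' (m - 1) + cscale c (e * pw x x' (m - 1))"
  proof (cases "0 < m")
    case False
    then have "x' * pw x x' m = pw x x' (m - 1)"
      by (cases "m = 0") (auto simp: pw_def nat_diff_distrib Suc_nat_eq_nat_zadd1 simp flip: power_Suc)
    then show ?thesis by (intro exI[of _ 0]) simp
  next
    case True
    define k where "k = nat m - 1"
    have k: "nat m = Suc k" "pw x x' (m - 1) = x ^ k" using True by (auto simp: k_def pw_def nat_diff_distrib)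
    have "x' * pw x x' m = (x' * x) * x ^ k" using True k by (simp add: pw_def mult.assoc)
    also have "\<dots> \<approx> (1 - cscale t e) * x ^ k" using assms by (intro cong_mult) auto
    also have "\<dots> = x ^ k + cscale (- t) (e * x ^ k)"
      by (simp add: cscale_algebra algebra_simps free_cvs.scale_minus_left)
    finally show ?thesis by (intro exI[of _ "- t"]) (simp add: k)
  qed
qed

subsection \<open>Monomials span\<close>

definition mon_span :: "free_elem set"
  where "mon_span = {f. \<exists>g\<in>free_cvs.span {mon r s m n | r s m n. True}. f \<approx> g}"

lemma mon_span_subspace: "free_cvs.subspace mon_span"
proof (rule free_cvs.subspaceI)
  show "0 \<in> mon_span" unfolding mon_span_def using free_cvs.span_zero by blast
  show "x + y \<in> mon_span" if "x \<in> mon_span" "y \<in> mon_span" for x y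
    using that unfolding mon_span_def by (blast intro: free_cvs.span_add cong_add)
  show "cscale c x \<in> mon_span" if "x \<in> mon_span" for c x
    using that unfolding mon_span_def by (blast intro: free_cvs.span_scale cong_cscale)
qed

lemmas mon_span_add = free_cvs.subspace_add[OF mon_span_subspace]
lemmas mon_span_cscale = free_cvs.subspace_scale[OF mon_span_subspace]

lemma mon_span_cong: "f \<approx> g \<Longrightarrow> g \<in> mon_span \<Longrightarrow> f \<in> mon_span"
  unfolding mon_span_def by (blast intro: cong_trans)

lemma mon_span_mon: "mon r s m n \<in> mon_span"
  unfolding mon_span_def by (blast intro: free_cvs.span_base)

text \<open>How a generator acts on a monomial from the left: it passes \<open>P\<close>, moves the exponent, and the factor
  \<open>e\<close> that may arise is absorbed by \<open>P\<close>.\<close>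

lemma pair_mult_mon:
  assumes e: "e = 1 - x * x'" "x' * x \<approx> 1 - cscale t e"
    and g: "g = x \<and> m' = m + 1 \<or> g = x' \<and> m' = m - 1"
    and P: "scomm g P" "P * e \<approx> P'"
  shows "\<exists>c d. g * (P * pw x x' m * Q) \<approx> cscale c (P * pw x x' m' * Q + cscale d (P' * pw x x' m' * Q))"
proof -
  obtain c where c: "g * P \<approx> cscale c (P * g)"
    using P by (auto simp: scomm_def qcomm_def)
  obtain d where d: "g * pw x x' m \<approx> pw x x' m' + cscale d (e * pw x x' m')"
    using g pair_step[OF e, of m] by auto
  have "g * (P * pw x x' m * Q) = (g * P) * pw x x' m * Q"
    by (simp add: mult.assoc)
  also have "\<dots> \<approx> cscale c (P * g) * pw x x' m * Q"
    using c by (intro cong_mult) auto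
  also have "\<dots> = cscale c (P * (g * pw x x' m) * Q)"
    by (simp add: cscale_mult_left mult.assoc)
  also have "\<dots> \<approx> cscale c (P * (pw x x' m' + cscale d (e * pw x x' m')) * Q)"
    using d by (intro cong_cscale cong_mult) auto
  also have "\<dots> = cscale c (P * pw x x' m' * Q + cscale d ((P * e) * pw x x' m' * Q))"
    by (simp add: algebra_simps cscale_algebra)
  also have "\<dots> \<approx> cscale c (P * pw x x' m' * Q + cscale d (P' * pw x x' m' * Q))"
    by (intro cong_cscale cong_add cong_refl cong_mult P)
  finally show ?thesis by blast
qed

lemma a_mon:
  assumes g: "g = ga \<and> m' = m + 1 \<or> g = ga' \<and> m' = m - 1"
  shows "g * mon r s m n \<in> mon_span"
proof -
  have "scomm g (eA ^ r * eB ^ s)"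
    using g qcomm_A qcomm_A' qcomm_a_eB by (auto intro!: scomm_mult scomm_power intro: scommI)
  moreover have "eA ^ r * eB ^ s * eA \<approx> eA ^ Suc r * eB ^ s"
  proof -
    have "qcomm 1 (eB ^ s) eA"
      using qcomm_power[OF qcomm_sym[OF qcomm_eB_eA, of 1], of s] by (auto intro: qcomm_sym)
    then have "eA ^ r * (eB ^ s * eA) \<approx> eA ^ r * (eA * eB ^ s)"
      by (intro cong_mult[OF cong_refl]) (simp add: qcomm_def)
    then show ?thesis by (simp add: mult.assoc power_Suc2 del: power_Suc)
  qed
  ultimately obtain c d where
    "g * mon r s m n \<approx> cscale c (mon r s m' n + cscale d (mon (Suc r) s m' n))"
    using pair_mult_mon[OF eA_def a'a g] unfolding mon_def by blast
  then show ?thesis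
    by (rule mon_span_cong) (intro mon_span_add mon_span_cscale mon_span_mon)
qed

lemma b_mon:
  assumes g: "g = gb \<and> n' = n + 1 \<or> g = gb' \<and> n' = n - 1"
  shows "g * mon r s m n \<in> mon_span"
proof -
  have "scomm g (eA ^ r * eB ^ s * pw ga ga' m)"
    using g qcomm_B qcomm_B' qcomm_b_eA qcomm_ba qcomm_ba' qcomm_b'a qcomm_b'a'
    by (auto intro!: scomm_mult scomm_power scomm_pw intro: scommI)
  moreover have "eA ^ r * eB ^ s * pw ga ga' m * eB \<approx> eA ^ r * eB ^ Suc s * pw ga ga' m"
  proof -
    have "qcomm 1 eB ga" "qcomm 1 eB ga'" using qcomm_a_eB by (auto intro: qcomm_sym)
    then have "qcomm 1 eB (pw ga ga' m)"
      using qcomm_power[of 1 eB ga] qcomm_power[of 1 eB ga'] by (auto simp: pw_def)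
    from qcomm_sym[OF this, of 1]
    have "eA ^ r * eB ^ s * (pw ga ga' m * eB) \<approx> eA ^ r * eB ^ s * (eB * pw ga ga' m)"
      by (intro cong_mult[OF cong_refl]) (simp add: qcomm_def)
    then show ?thesis by (simp add: mult.assoc power_Suc2 del: power_Suc)
  qed
  ultimately obtain c d where
    "g * (eA ^ r * eB ^ s * pw ga ga' m * pw gb gb' n * 1) \<approx>
      cscale c (eA ^ r * eB ^ s * pw ga ga' m * pw gb gb' n' * 1 +
        cscale d (eA ^ r * eB ^ Suc s * pw ga ga' m * pw gb gb' n' * 1))"
    using pair_mult_mon[OF eB_def b'b g] by blast
  then have "g * mon r s m n \<approx> cscale c (mon r s m n' + cscale d (mon r (Suc s) m n'))"
    by (simp only: mon_def mult_1_right)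
  then show ?thesis
    by (rule mon_span_cong) (intro mon_span_add mon_span_cscale mon_span_mon)
qed

lemma gen_T: "f \<in> mon_span \<Longrightarrow> free_gen g x * f \<in> mon_span"
proof -
  assume "f \<in> mon_span"
  then obtain h where h: "h \<in> free_cvs.span {mon r s m n | r s m n. True}" "f \<approx> h"
    by (auto simp: mon_span_def)
  have mon: "free_gen g x * mon r s m n \<in> mon_span" for r s m n
    using a_mon[of ga "m + 1" m] a_mon[of ga' "m - 1" m] b_mon[of gb "n + 1" n] b_mon[of gb' "n - 1" n]
    by (cases g; cases x) auto
  have "free_cvs.span {mon r s m n | r s m n. True} \<subseteq> {h. free_gen g x * h \<in> mon_span}"
    by (rule free_cvs.span_minimal)
       (auto simp: mon free_cvs.subspace_def distrib_left cscale_mult_right free_cvs.subspace_0[OF mon_span_subspace]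
         intro: mon_span_add mon_span_cscale)
  then have "free_gen g x * h \<in> mon_span" using h by auto
  then show ?thesis using h by (auto intro: mon_span_cong[of _ "free_gen g x * h"] cong_mult)
qed

lemma mon_span_UNIV: "f \<in> mon_span"
proof (induction f rule: poly_mapping_induct)
  case zero
  then show ?case by (rule free_cvs.subspace_0[OF mon_span_subspace])
next
  case (add w c f)
  have "single w 1 \<in> mon_span"
  proof (induction w rule: word_induct)
    case Nil
    then show ?case using mon_span_mon[of 0 0 0 0] by (simp add: mon_def pw_def)
  next
    case (Cons g x w)
    then show ?case by (rule gen_T)
  qed
  from mon_span_cscale[OF this, of c] add show ?case by (auto intro: mon_span_add)
qed

text \<open>The span of the monomials contains 1 and is stable under left multiplication by the generators.\<close>

lemma monomials_span:
  assumes "z \<in> carrier R"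
  shows "z \<in> cspan R {cls (mon r s m n) | r s m n. True}"
proof -
  let ?S = "{cls (mon r s m n) | r s m n. True}"
  have S: "?S \<subseteq> carrier R" by (auto simp: cls_simps)
  obtain f where f: "z = cls f" using assms by (auto simp: carrier_R)
  from mon_span_UNIV[of f] obtain g where g: "g \<in> free_cvs.span {mon r s m n | r s m n. True}" "z = cls g"
    by (auto simp: mon_span_def cong_def f)
  have "free_cvs.span {mon r s m n | r s m n. True} \<subseteq> {g. cls g \<in> cspan R ?S}"
  proof (rule free_cvs.span_minimal)
    show "free_cvs.subspace {g. cls g \<in> cspan R ?S}"
      using cspan.zero[of R ?S] R.cspan_add[OF S] R.cspan_smult[OF S]
      by (auto simp: free_cvs.subspace_def cls_simps(2,4)[symmetric] cls_simps(6))
  qed (use R.cspan_base[OF S] in fast)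
  then show ?thesis using g by auto
qed

subsection \<open>The consequence of \<open>A B = 0\<close>\<close>

text \<open>Peel off one factor on each side:
  \<open>1 - x\<^bsup>n+1\<^esup> x'\<^bsup>n+1\<^esup> = (1 - x\<^bsup>n\<^esup> x'\<^bsup>n\<^esup>) + x\<^bsup>n\<^esup> e x'\<^bsup>n\<^esup>\<close>, where \<open>e\<close> can be moved to the right end.\<close>

lemma pair_one_minus_powers:
  assumes e: "e = 1 - x * x'" "x' * x \<approx> 1 - cscale t e" and t: "t \<noteq> 0"
  shows "\<exists>f. 1 - x ^ n * x' ^ n \<approx> f * e" "\<exists>f. 1 - x' ^ n * x ^ n \<approx> f * e"
proof -
  note qcomm = pair_commutation[OF e]
  show "\<exists>f. 1 - x ^ n * x' ^ n \<approx> f * e"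
  proof (induction n)
    case 0
    show ?case by (rule exI[of _ 0]) simp
  next
    case (Suc n)
    then obtain f where f: "1 - x ^ n * x' ^ n \<approx> f * e" by auto
    obtain c where c: "e * x' ^ n \<approx> cscale c (x' ^ n * e)"
      using qcomm_power[OF qcomm_sym[OF qcomm(2), of "1 / t"], of n] t by (auto simp: qcomm_def)
    have "1 - x ^ Suc n * x' ^ Suc n = (1 - x ^ n * x' ^ n) + x ^ n * (e * x' ^ n)"
      by (simp add: e(1) algebra_simps power_Suc2[of x] del: power_Suc) (simp add: algebra_simps)
    also have "\<dots> \<approx> f * e + x ^ n * cscale c (x' ^ n * e)"
      using f c by (intro cong_add cong_mult) auto
    also have "\<dots> = (f + cscale c (x ^ n * x' ^ n)) * e"
      by (simp add: algebra_simps cscale_algebra)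
    finally show ?case by blast
  qed
  show "\<exists>f. 1 - x' ^ n * x ^ n \<approx> f * e"
  proof (induction n)
    case 0
    show ?case by (rule exI[of _ 0]) simp
  next
    case (Suc n)
    then obtain f where f: "1 - x' ^ n * x ^ n \<approx> f * e" by auto
    obtain c where c: "e * x ^ n \<approx> cscale c (x ^ n * e)"
      using qcomm_power[OF qcomm(1), of n] by (auto simp: qcomm_def)
    have "1 - x' ^ Suc n * x ^ Suc n = 1 - x' ^ n * ((x' * x) * x ^ n)"
      by (simp add: power_Suc2[of x'] mult.assoc del: power_Suc) (simp add: mult.assoc)
    also have "\<dots> \<approx> 1 - x' ^ n * ((1 - cscale t e) * x ^ n)"
      using e(2) by (intro cong_diff cong_mult) auto
    also have "\<dots> = (1 - x' ^ n * x ^ n) + cscale t (x' ^ n * (e * x ^ n))"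
      by (simp add: algebra_simps cscale_algebra)
    also have "\<dots> \<approx> f * e + cscale t (x' ^ n * cscale c (x ^ n * e))"
      using f c by (intro cong_add cong_mult cong_cscale) auto
    also have "\<dots> = (f + cscale (t * c) (x' ^ n * x ^ n)) * e"
      by (simp add: algebra_simps cscale_algebra)
    finally show ?case by blast
  qed
qed

lemma one_minus_powers_A:
  "\<exists>f. 1 - ga ^ n * ga' ^ n \<approx> f * eA" "\<exists>f. 1 - ga' ^ n * ga ^ n \<approx> f * eA"
  using pair_one_minus_powers[OF eA_def a'a] p_pos by auto

text \<open>The adjoint moves the factor \<open>B\<close> to the left.\<close>

lemma one_minus_powers_B:
  "\<exists>f. 1 - gb ^ n * gb' ^ n \<approx> eB * f" "\<exists>f. 1 - gb' ^ n * gb ^ n \<approx> eB * f"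
proof -
  have swap: "\<exists>f. u \<approx> eB * f" if "\<exists>f. u \<approx> f * eB" "WI.st u = u" for u
  proof -
    from that obtain f where "u \<approx> f * eB" by auto
    from cong_st[OF this] that(2) have "u \<approx> eB * WI.st f" by (simp add: WI.st_mult st_eB)
    then show ?thesis by blast
  qed
  note e = pair_one_minus_powers[OF eB_def b'b, of n]
  show "\<exists>f. 1 - gb ^ n * gb' ^ n \<approx> eB * f" "\<exists>f. 1 - gb' ^ n * gb ^ n \<approx> eB * f"
    using e q_pos by (auto intro!: swap simp: st_diff st_one WI.st_mult st_power st_free_gen)
qed

lemma product_zero:
  assumes "u \<approx> f * eA" "v \<approx> eB * g"
  shows "u * v \<approx> 0"
proof -
  have "u * v \<approx> (f * eA) * (eB * g)" using assms by (intro cong_mult)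
  also have "\<dots> = f * (eA * eB) * g" by (simp add: mult.assoc)
  also have "\<dots> \<approx> f * 0 * g" using rel_AB by (intro cong_mult) auto
  finally show ?thesis by simp
qed

text \<open>Since \<open>A B = 0\<close>, a left multiple of \<open>A\<close> times a right multiple of \<open>B\<close> vanishes. Expand
  \<open>1 - (1 - x x\<^sup>*) (1 - y y\<^sup>*)\<close> for \<open>x = a\<^bsup>l\<^esup>\<close>, \<open>y = b\<^bsup>k\<^esup>\<close>, and the same with \<open>x\<^sup>*\<close>, \<open>y\<^sup>*\<close> in place of
  \<open>x\<close>, \<open>y\<close>.\<close>

lemma unit_decomposition:
  "ga ^ l * ga' ^ l + (gb ^ k - ga ^ l * ga' ^ l * gb ^ k) * gb' ^ k \<approx> 1"
  "ga' ^ l * ga ^ l + (gb' ^ k - ga' ^ l * ga ^ l * gb' ^ k) * gb ^ k \<approx> 1"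
proof -
  obtain f g where "1 - ga ^ l * ga' ^ l \<approx> f * eA" "1 - gb ^ k * gb' ^ k \<approx> eB * g"
    using one_minus_powers_A(1) one_minus_powers_B(1) by blast
  from cong_diff[OF cong_refl[of 1] product_zero[OF this]]
  have "1 - (1 - ga ^ l * ga' ^ l) * (1 - gb ^ k * gb' ^ k) \<approx> 1" by simp
  then show "ga ^ l * ga' ^ l + (gb ^ k - ga ^ l * ga' ^ l * gb ^ k) * gb' ^ k \<approx> 1"
    by (simp add: algebra_simps)
  obtain f g where "1 - ga' ^ l * ga ^ l \<approx> f * eA" "1 - gb' ^ k * gb ^ k \<approx> eB * g"
    using one_minus_powers_A(2) one_minus_powers_B(2) by blast
  from cong_diff[OF cong_refl[of 1] product_zero[OF this]]
  have "1 - (1 - ga' ^ l * ga ^ l) * (1 - gb' ^ k * gb ^ k) \<approx> 1" by simp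
  then show "ga' ^ l * ga ^ l + (gb' ^ k - ga' ^ l * ga ^ l * gb' ^ k) * gb ^ k \<approx> 1"
    by (simp add: algebra_simps)
qed

end

section \<open>Weighted coactions\<close>

definition letter_weight :: "nat \<Rightarrow> nat \<Rightarrow> gen \<times> bool \<Rightarrow> int"
  where "letter_weight k l x = (if snd x then -1 else 1) * (case fst x of Gen_a \<Rightarrow> int k | Gen_b \<Rightarrow> int l)"

definition weight :: "nat \<Rightarrow> nat \<Rightarrow> word \<Rightarrow> int"
  where "weight k l w = sum_list (map (letter_weight k l) (letters w))"

lemma weight_simps [simp]:
  "weight k l 0 = 0" "weight k l (v + w) = weight k l v + weight k l w"
  "weight k l (word_adj w) = - weight k l w"
proof -
  have "sum_list (map (\<lambda>x. letter_weight k l (apsnd Not x)) xs) = - sum_list (map (letter_weight k l) xs)" for xs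
    by (induction xs) (auto simp: letter_weight_def)
  then show "weight k l (word_adj w) = - weight k l w"
    by (simp add: weight_def word_adj_def rev_map[symmetric] o_def sum_list_rev)
qed (auto simp: weight_def zero_word_def plus_word_def)

text \<open>The elements \<open>U n\<close> are the powers of a unitary, namely of the generator of the Laurent polynomials or
  of their cyclic quotient.\<close>

locale weighted = sphere + H: star_algebra H for H :: "'h star_alg" +
  fixes U :: "int \<Rightarrow> 'h" and k l :: nat
  assumes U_closed [simp]: "U n \<in> carrier H" and U_zero: "U 0 = \<one>\<^bsub>H\<^esub>"
    and U_add: "U (m + n) = U m \<otimes>\<^bsub>H\<^esub> U n" and U_star: "star H (U n) = U (- n)"
begin

sublocale RH: star_algebras R H
  by unfold_locales

sublocale RHt: complex_algebra "tensor R H"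
  by (rule RH.tensor_algebra)

abbreviation "RH \<equiv> star_tensor R H"

text \<open>The coaction on the free algebra: a word is tensored with the power of the unitary given by its
  weight.\<close>

definition \<delta> :: "free_elem \<Rightarrow> (sphere_elem, 'h) tensor"
  where "\<delta> = lin RH (\<lambda>w. pure R H (cls (single w 1)) (U (weight k l w)))"

lemma delta_hom: "\<delta> \<in> star_hom free_star_algebra RH"
  unfolding \<delta>_def free_star_algebra_eq
proof (rule WI.star_hom_lin[OF star_tensor_algebra[OF R.star_algebra_axioms H.star_algebra_axioms]])
  fix v w
  show "pure R H (cls (single w 1)) (U (weight k l w)) \<in> carrier RH"
    by (simp add: star_tensor_simps cls_simps)
  show "pure R H (cls (single 0 1)) (U (weight k l 0)) = \<one>\<^bsub>RH\<^esub>"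
    by (simp add: star_tensor_simps cls_simps RH.tensor_one U_zero)
  show "pure R H (cls (single (v + w) 1)) (U (weight k l (v + w))) =
      pure R H (cls (single v 1)) (U (weight k l v)) \<otimes>\<^bsub>RH\<^esub>
      pure R H (cls (single w 1)) (U (weight k l w))"
    by (simp add: star_tensor_simps cls_simps U_add mult_single)
  show "star RH (pure R H (cls (single w 1)) (U (weight k l w))) =
      pure R H (cls (single (word_adj w) 1)) (U (weight k l (word_adj w)))"
    by (simp add: cls_simps U_star WI.st_single)
qed

lemmas delta_linmap = star_homD(1)[OF delta_hom]

lemma delta_simps:
  "\<delta> f \<in> carrier (tensor R H)"
  "\<delta> (f + g) = \<delta> f \<oplus>\<^bsub>tensor R H\<^esub> \<delta> g"
  "\<delta> (cscale c f) = c \<odot>\<^bsub>tensor R H\<^esub> \<delta> f"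
  "\<delta> (f * g) = \<delta> f \<otimes>\<^bsub>tensor R H\<^esub> \<delta> g"
  "\<delta> 1 = \<one>\<^bsub>tensor R H\<^esub>"
  "\<delta> (WI.st f) = star RH (\<delta> f)"
  "\<delta> 0 = \<zero>\<^bsub>tensor R H\<^esub>"
proof -
  show "\<delta> f \<in> carrier (tensor R H)"
    "\<delta> (f + g) = \<delta> f \<oplus>\<^bsub>tensor R H\<^esub> \<delta> g"
    "\<delta> (cscale c f) = c \<odot>\<^bsub>tensor R H\<^esub> \<delta> f"
    "\<delta> (f * g) = \<delta> f \<otimes>\<^bsub>tensor R H\<^esub> \<delta> g"
    "\<delta> 1 = \<one>\<^bsub>tensor R H\<^esub>"
    "\<delta> (WI.st f) = star RH (\<delta> f)"
    using semilinearD[OF delta_linmap] star_homD(2,3,4)[OF delta_hom]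
    by (simp_all add: FS_simps star_tensor_simps)
  have "\<delta> \<zero>\<^bsub>free_star_algebra\<^esub> = \<zero>\<^bsub>tensor R H\<^esub>"
    by (rule semilinear_zero[OF _ FS.cspace_axioms RHt.cspace_axioms])
       (use delta_linmap in \<open>simp add: linmap_star_tensor\<close>)
  then show "\<delta> 0 = \<zero>\<^bsub>tensor R H\<^esub>" by (simp add: FS_simps)
qed

text \<open>Elements of the free algebra that are homogeneous modulo the relations. Equality holds in the tensor
  product, where the first factor is already the sphere.\<close>

definition homog :: "int \<Rightarrow> free_elem \<Rightarrow> bool"
  where "homog n f \<longleftrightarrow> \<delta> f = pure R H (cls f) (U n)"

lemma homog_mult: "homog m f \<Longrightarrow> homog n g \<Longrightarrow> homog (m + n) (f * g)"
  by (simp add: homog_def delta_simps cls_simps U_add)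

lemma homog_add: "homog n f \<Longrightarrow> homog n g \<Longrightarrow> homog n (f + g)"
  by (simp add: homog_def delta_simps cls_simps(2)[symmetric] RH.pure_add_left cls_simps(1))

lemma homog_cscale: "homog n f \<Longrightarrow> homog n (cscale c f)"
  by (simp add: homog_def delta_simps cls_simps(4)[symmetric] RH.pure_smult_left cls_simps(1))

lemma homog_diff: "homog n f \<Longrightarrow> homog n g \<Longrightarrow> homog n (f - g)"
  using homog_add[of n f "cscale (-1) g"] homog_cscale[of n g "-1"] by (simp add: free_cvs.scale_minus_left)

lemma homog_one: "homog 0 1"
  by (simp add: homog_def delta_simps U_zero RH.tensor_one cls_simps)

lemma homog_gen: "homog (letter_weight k l (g, x)) (free_gen g x)"
proof -
  interpret RHs: complex_algebra RH
    by (rule star_tensor_algebra(1)[OF R.star_algebra_axioms H.star_algebra_axioms])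
  show ?thesis
    unfolding homog_def \<delta>_def free_gen_def
    by (subst RHs.lin_single) (auto simp: star_tensor_simps cls_simps weight_def)
qed

lemma homog_ab:
  "homog (int k) ga" "homog (- int k) ga'" "homog (int l) gb" "homog (- int l) gb'"
  using homog_gen[of Gen_a False] homog_gen[of Gen_a True] homog_gen[of Gen_b False] homog_gen[of Gen_b True]
  by (simp_all add: letter_weight_def)

lemma homog_power: "homog n f \<Longrightarrow> homog (int m * n) (f ^ m)"
  by (induction m) (auto simp: homog_one distrib_right intro: homog_mult)

lemma homog_eA: "homog 0 eA" and homog_eB: "homog 0 eB"
  unfolding eA_def eB_def
  using homog_mult[OF homog_ab(1,2)] homog_mult[OF homog_ab(3,4)] by (auto intro!: homog_diff homog_one)

lemma homog_pw:
  assumes "homog n x" "homog (- n) x'"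
  shows "homog (m * n) (pw x x' m)"
  using homog_power[OF assms(1), of "nat m"] homog_power[OF assms(2), of "nat (- m)"]
  by (auto simp: pw_def)

lemma homog_mon: "homog (int k * m + int l * n) (mon r s m n)"
proof -
  have "homog (0 + 0 + m * int k + n * int l) (mon r s m n)"
    unfolding mon_def
    using homog_power[OF homog_eA, of r] homog_power[OF homog_eB, of s]
    by (intro homog_mult homog_pw homog_ab) auto
  then show ?thesis by (simp add: mult.commute)
qed

text \<open>A relation \<open>r\<close> is homogeneous, so it is sent to \<open>[r] \<otimes> U n\<close> with \<open>[r] = 0\<close>.\<close>

lemma delta_relation: "r \<in> S3_rels p q \<theta> \<Longrightarrow> \<delta> r = \<zero>\<^bsub>tensor R H\<^esub>"
proof -
  assume r: "r \<in> S3_rels p q \<theta>"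
  then have "\<exists>n. homog n r"
    unfolding S3_rels_def Let_def
  proof (elim insertE emptyE; hypsubst)
    show "\<exists>n. homog n (ga * gb - cscale (exp (2 * complex_of_real pi * \<i> * complex_of_real \<theta>)) (gb * ga))"
      using homog_mult[OF homog_ab(1,3)] homog_mult[OF homog_ab(3,1)]
      by (intro exI[of _ "int k + int l"] homog_diff homog_cscale) (auto simp: add.commute)
    show "\<exists>n. homog n (ga * gb' - cscale (exp (- 2 * complex_of_real pi * \<i> * complex_of_real \<theta>)) (gb' * ga))"
      using homog_mult[OF homog_ab(1,4)] homog_mult[OF homog_ab(4,1)]
      by (intro exI[of _ "int k - int l"] homog_diff homog_cscale) (auto simp: add.commute)
    show "\<exists>n. homog n (ga' * ga - cscale (complex_of_real p) (ga * ga') - cscale (complex_of_real (1 - p)) 1)"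
      using homog_mult[OF homog_ab(1,2)] homog_mult[OF homog_ab(2,1)]
      by (intro exI[of _ 0] homog_diff homog_cscale homog_one) auto
    show "\<exists>n. homog n (gb' * gb - cscale (complex_of_real q) (gb * gb') - cscale (complex_of_real (1 - q)) 1)"
      using homog_mult[OF homog_ab(3,4)] homog_mult[OF homog_ab(4,3)]
      by (intro exI[of _ 0] homog_diff homog_cscale homog_one) auto
    show "\<exists>n. homog n ((1 - ga * ga') * (1 - gb * gb'))"
      using homog_mult[OF homog_eA homog_eB] by (auto simp: eA_def eB_def)
  qed
  then obtain n where "\<delta> r = pure R H (cls r) (U n)" by (auto simp: homog_def)
  also have "cls r = 0 \<odot>\<^bsub>R\<^esub> cls 0" using cong_rel[OF r] by (simp add: cong_def cls_simps)
  also have "pure R H \<dots> (U n) = \<zero>\<^bsub>tensor R H\<^esub>"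
    using RH.pure_closed[of "cls 0" "U n"] by (subst RH.pure_smult_left) (auto simp: cls_simps)
  finally show ?thesis .
qed

lemma delta_I: "f \<in> I \<Longrightarrow> \<delta> f = \<zero>\<^bsub>tensor R H\<^esub>"
proof -
  define K where "K = {f. \<delta> f = \<zero>\<^bsub>tensor R H\<^esub>}"
  have "linear_sub free_star_algebra K"
    by (simp add: linear_sub_def K_def FS_simps delta_simps)
  then interpret K: cspace_quot free_star_algebra K by unfold_locales
  have id: "ideal K free_star_algebra"
  proof (rule idealI[OF FS.ring_axioms K.W.a_subgroup])
    show "x \<otimes>\<^bsub>free_star_algebra\<^esub> f \<in> K" "f \<otimes>\<^bsub>free_star_algebra\<^esub> x \<in> K" if "f \<in> K" for f x
      using that by (simp_all add: K_def FS_simps delta_simps)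
  qed
  have rels: "S3_rels p q \<theta> \<subseteq> K" using delta_relation by (auto simp: K_def)
  have "star RH \<zero>\<^bsub>tensor R H\<^esub> = \<zero>\<^bsub>tensor R H\<^esub>"
    by (rule semilinear_zero[OF RH.star_tensor_semilinear RHt.cspace_axioms RHt.cspace_axioms])
  then have "star free_star_algebra ` S3_rels p q \<theta> \<subseteq> K"
    using delta_relation by (auto simp: K_def FS_simps delta_simps)
  from FQ.I_minimal[OF id rels this] show "f \<in> I \<Longrightarrow> \<delta> f = \<zero>\<^bsub>tensor R H\<^esub>"
    by (auto simp: K_def)
qed

definition "\<Phi> = qlift \<delta>"

lemma Phi_cls [simp]: "\<Phi> (cls f) = \<delta> f"
  unfolding \<Phi>_def cls_coset
  by (rule qlift_coset[OF _ FQ.cspace_quot_axioms RHt.cspace_axioms])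
     (use delta_linmap delta_I in \<open>auto simp: linmap_star_tensor FS_simps\<close>)

lemma Phi_hom: "\<Phi> \<in> star_hom R RH"
  by (rule star_homI, rule semilinearI)
     (auto simp: carrier_R cls_simps delta_simps star_tensor_simps)

lemma U_pow: "U 1 [^]\<^bsub>H\<^esub> (n :: nat) = U (int n)"
proof (induction n)
  case (Suc n)
  then show ?case using U_add[of "int n" 1] by (simp add: add.commute)
qed (simp add: U_zero)

text \<open>The free *-algebra maps onto the sphere, and a *-homomorphism on it is determined by the letters.\<close>

lemma generator_unique:
  assumes "h \<in> star_hom R B" "h' \<in> star_hom R B" "complex_algebra B"
    and "h (cls ga) = h' (cls ga)" "h (cls gb) = h' (cls gb)" "x \<in> carrier R"
  shows "h x = h' x"
proof -
  interpret B: complex_algebra B by fact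
  note h = star_homD[OF assms(1)] and h' = star_homD[OF assms(2)]
  obtain f where f: "x = cls f" using assms(6) by (auto simp: carrier_R)
  have gen: "h (cls (free_gen g b)) = h' (cls (free_gen g b))" for g b
  proof -
    have 1: "h (cls (free_gen g False)) = h' (cls (free_gen g False))" for g
      using assms(4,5) by (cases g) auto
    have "h (star R (cls (free_gen g False))) = h' (star R (cls (free_gen g False)))" for g
      using h(4) h'(4) 1 cls_simps(1) by metis
    then have "h (cls (free_gen g True)) = h' (cls (free_gen g True))" for g
      by (simp add: cls_simps st_free_gen)
    with 1 show ?thesis by (cases b) auto
  qed
  have word: "h (cls (single w 1)) = h' (cls (single w 1))" for w
  proof (induction w rule: word_induct)
    case Nil
    then show ?case using h(3) h'(3) by (simp add: cls_simps)
  next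
    case (Cons g b w)
    then show ?case
      using gen[of g b] h(2)[of "cls (free_gen g b)" "cls (single w 1)"]
        h'(2)[of "cls (free_gen g b)" "cls (single w 1)"]
      by (simp add: cls_simps)
  qed
  have "(\<lambda>f. h (cls f)) f = (\<lambda>f. h' (cls f)) f"
  proof (rule semilinear_ext[OF _ _ FS.cspace_axioms B.cspace_axioms])
    show "linmap free_star_algebra B (\<lambda>f. h (cls f))" "linmap free_star_algebra B (\<lambda>f. h' (cls f))"
      using semilinear_comp[OF star_homD(1)[OF cls_star_hom] h(1)]
        semilinear_comp[OF star_homD(1)[OF cls_star_hom] h'(1)] by auto
    show "f \<in> cspan free_star_algebra (range (\<lambda>w. single w 1))"
      unfolding free_star_algebra_eq by (rule WI.span_singles)
  qed (auto simp: FS_simps word)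
  then show ?thesis by (simp add: f)
qed

lemma weighted_coaction_eq:
  "weighted_coaction p q \<theta> k l H (U 1) = restrict \<Phi> (carrier R)"
  unfolding weighted_coaction_def Let_def
proof (rule the_star_hom_eq[OF R.star_algebra_axioms Phi_hom])
  have ab: "\<Phi> (cls ga) = pure R H (cls ga) (U (int k))" "\<Phi> (cls gb) = pure R H (cls gb) (U (int l))"
    using homog_ab by (simp_all add: homog_def)
  then show "\<Phi> g = v" if "(g, v) \<in> {(gen_a p q \<theta>, pure R H (gen_a p q \<theta>) (U 1 [^]\<^bsub>H\<^esub> k)),
      (gen_b p q \<theta>, pure R H (gen_b p q \<theta>) (U 1 [^]\<^bsub>H\<^esub> l))}" for g v
    using that by (auto simp: gen_a_eq gen_b_eq U_pow)
  fix h x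
  assume h: "h \<in> star_hom R RH" "\<And>g v. (g, v) \<in> {(gen_a p q \<theta>, pure R H (gen_a p q \<theta>) (U 1 [^]\<^bsub>H\<^esub> k)),
      (gen_b p q \<theta>, pure R H (gen_b p q \<theta>) (U 1 [^]\<^bsub>H\<^esub> l))} \<Longrightarrow> h g = v" and x: "x \<in> carrier R"
  have "h (cls ga) = \<Phi> (cls ga)" "h (cls gb) = \<Phi> (cls gb)"
    using h(2)[of "cls ga" "pure R H (cls ga) (U (int k))"] h(2)[of "cls gb" "pure R H (cls gb) (U (int l))"] ab
    by (auto simp: gen_a_eq gen_b_eq U_pow)
  then show "h x = \<Phi> x"
    by (intro generator_unique[OF h(1) Phi_hom star_tensor_algebra(1)[OF R.star_algebra_axioms H.star_algebra_axioms] _ _ x])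
qed (auto simp: gen_a_eq gen_b_eq cls_simps)

lemma Phi_mon: "\<Phi> (cls (mon r s m n)) = pure R H (cls (mon r s m n)) (U (int k * m + int l * n))"
  using homog_mon by (simp add: homog_def)

lemma Phi_linmap: "linmap R (tensor R H) \<Phi>"
  using star_homD(1)[OF Phi_hom] by (simp add: linmap_star_tensor)

lemma coinvariants_coaction:
  "coinvariants H R (weighted_coaction p q \<theta> k l H (U 1)) = {x \<in> carrier R. \<Phi> x = pure R H x \<one>\<^bsub>H\<^esub>}"
  by (auto simp: coinvariants_def weighted_coaction_eq)

text \<open>The coaction followed by \<open>id \<otimes> \<chi>\<close>, an averaging operator when \<open>\<chi>\<close> picks out some of the weights.\<close>

definition contract :: "('h \<Rightarrow> complex) \<Rightarrow> sphere_elem \<Rightarrow> sphere_elem"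
  where "contract \<chi> x = tensor_lift R (\<lambda>y h. \<chi> h \<odot>\<^bsub>R\<^esub> y) (\<Phi> x)"

lemma contract:
  assumes "linmap H complex_star_alg \<chi>"
  shows "linmap R R (contract \<chi>)"
    and "\<lbrakk>x \<in> carrier R; h \<in> carrier H; \<Phi> x = pure R H x h\<rbrakk> \<Longrightarrow> contract \<chi> x = \<chi> h \<odot>\<^bsub>R\<^esub> x"
  unfolding contract_def
proof -
  note b = functional_bilinear(1)[OF R.cspace_axioms assms]
  show "linmap R R (\<lambda>x. tensor_lift R (\<lambda>y h. \<chi> h \<odot>\<^bsub>R\<^esub> y) (\<Phi> x))"
    by (rule linmap_lift[OF Phi_linmap R.cspace_axioms H.cspace_axioms R.cspace_axioms b])
  show "\<lbrakk>x \<in> carrier R; h \<in> carrier H; \<Phi> x = pure R H x h\<rbrakk> \<Longrightarrow>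
      tensor_lift R (\<lambda>y h. \<chi> h \<odot>\<^bsub>R\<^esub> y) (\<Phi> x) = \<chi> h \<odot>\<^bsub>R\<^esub> x"
    by (simp add: RH.lift_pure[OF R.cspace_axioms b])
qed

text \<open>Contraction with \<open>\<chi>\<close> fixes \<open>x\<close> and multiplies a monomial by the value of \<open>\<chi>\<close> at its weight. Apply it to
  an expression of \<open>x\<close> through monomials.\<close>

lemma fixed_in_span:
  assumes chi: "linmap H complex_star_alg \<chi>" "\<chi> \<one>\<^bsub>H\<^esub> = 1"
    and x: "x \<in> carrier R" "\<Phi> x = pure R H x \<one>\<^bsub>H\<^esub>"
  shows "x \<in> cspan R {cls (mon r s m n) | r s m n. \<chi> (U (int k * m + int l * n)) \<noteq> 0}"
proof -
  let ?S = "{cls (mon r s m n) | r s m n. \<chi> (U (int k * m + int l * n)) \<noteq> 0}"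
  have S: "?S \<subseteq> carrier R" by (auto simp: cls_simps)
  note c = contract[OF chi(1)]
  have "contract \<chi> x \<in> cspan R ?S"
  proof (rule semilinear_cspan[OF c(1) R.cspace_axioms R.cspace_axioms _ S _ monomials_span[OF x(1)]])
    fix z assume "z \<in> {cls (mon r s m n) | r s m n. True}"
    then obtain r s m n where z: "z = cls (mon r s m n)" by auto
    have cz: "contract \<chi> z = \<chi> (U (int k * m + int l * n)) \<odot>\<^bsub>R\<^esub> z"
      by (rule c(2)) (auto simp: z cls_simps(1) Phi_mon simp del: Phi_cls)
    show "contract \<chi> z \<in> cspan R ?S"
    proof (cases "\<chi> (U (int k * m + int l * n)) = 0")
      case True
      then show ?thesis unfolding cz by (simp add: z cls_simps(1) cspan.zero)
    next
      case False
      then have "z \<in> ?S" using z by blast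
      then show ?thesis unfolding cz by (intro R.cspan_smult[OF S] R.cspan_base[OF S])
    qed
  qed (auto simp: cls_simps)
  moreover have "contract \<chi> x = x"
    using c(2)[OF x(1) _ x(2)] chi(2) x(1) by simp
  ultimately show ?thesis by simp
qed

lemma fixed_csub: "linear_sub R {x \<in> carrier R. \<Phi> x = pure R H x (U n)}"
proof -
  note D = semilinearD[OF Phi_linmap]
  have "\<Phi> \<zero>\<^bsub>R\<^esub> = pure R H \<zero>\<^bsub>R\<^esub> (U n)"
    using D(3)[of "\<zero>\<^bsub>R\<^esub>" 0] RH.pure_smult_left[of "\<zero>\<^bsub>R\<^esub>" "U n" 0] D(1)[of "\<zero>\<^bsub>R\<^esub>"] by simp
  then show ?thesis
    by (simp add: linear_sub_def D RH.pure_add_left RH.pure_smult_left)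
qed

end

section \<open>The cyclic quotient of the Laurent polynomials\<close>

lemma u1_power: "u1 ^ m = upow (int m)"
  by (induction m) (auto simp: u1_def mult_single)

lemma OU1_minus: "f \<ominus>\<^bsub>OU1\<^esub> g = f - g"
proof -
  have "\<ominus>\<^bsub>OU1\<^esub> g = - g"
    using OU1.smult_minus_1[of g] by (simp add: OU1_simps free_cvs.scale_minus_left)
  then show ?thesis by (simp add: OU1.minus_eq OU1_simps)
qed

locale cyclic =
  fixes m :: nat
begin

sublocale Z: star_quotient OU1 "{u1 ^ m - 1}"
  by unfold_locales simp

abbreviation "J \<equiv> star_ideal OU1 {u1 ^ m - 1}"

definition U :: "int \<Rightarrow> (int \<Rightarrow>\<^sub>0 complex) set"
  where "U n = J +>\<^bsub>OU1\<^esub> upow n"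

lemma OZ_star_algebra: "star_algebra (OZ m)"
  unfolding OZ_def by (rule Z.S_star_algebra)

lemma uZ_eq: "uZ m = U 1"
  by (simp add: uZ_def quot_class_def U_def u1_def)

lemma U_props:
  "U n \<in> carrier (OZ m)" "U 0 = \<one>\<^bsub>OZ m\<^esub>" "U (n + n') = U n \<otimes>\<^bsub>OZ m\<^esub> U n'" "star (OZ m) (U n) = U (- n)"
  using Z.S_simps(1)[of "upow n"] Z.S_simps(3)[of "upow n" "upow n'"] Z.S_simps(5) Z.quot_star[of "upow n"]
  by (simp_all add: U_def OZ_def OU1_one del: single_one)

lemma U_m: "U (int m) = \<one>\<^bsub>OZ m\<^esub>"
proof -
  have "upow (int m) - upow 0 \<in> J" using Z.relation_in_ideal[of "u1 ^ m - 1"] by (simp add: u1_power)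
  then have "U (int m) = U 0"
    unfolding U_def using Z.Q_eq[of "upow (int m)" "upow 0"] by (simp add: OU1_minus del: single_one)
  then show ?thesis by (simp add: U_props)
qed

lemma U_multiple: "U (int m * t) = \<one>\<^bsub>OZ m\<^esub>"
proof -
  interpret OZ: star_algebra "OZ m" by (rule OZ_star_algebra)
  have minus: "U (- int m) = \<one>\<^bsub>OZ m\<^esub>" using U_props(4)[of "int m"] U_m by simp
  show ?thesis
  proof (induction t rule: int_induct[where k = 0])
    case base
    then show ?case by (simp add: U_props)
  next
    case (step1 t)
    then show ?case using U_props(3)[of "int m * t" "int m"] U_m by (simp add: distrib_left)
  next
    case (step2 t)
    then show ?case using U_props(3)[of "int m * t" "- int m"] minus by (simp add: right_diff_distrib)
  qed
qed

definition indic :: "(int \<Rightarrow>\<^sub>0 complex) \<Rightarrow> complex"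
  where "indic = lin complex_star_alg (\<lambda>n. if int m dvd n then 1 else 0)"

lemma indic_linmap: "linmap OU1 complex_star_alg indic"
  unfolding indic_def
  by (rule OU1_lin_linmap[OF CC.cspace_axioms]) (simp add: CC_simps)

lemma indic_simps:
  "indic (f + g) = indic f + indic g" "indic (cscale c f) = c * indic f" "indic 0 = 0"
  using semilinearD(2,3)[OF indic_linmap] semilinear_zero[OF indic_linmap OU1.cspace_axioms CC.cspace_axioms]
  by (simp_all add: OU1_simps CC_simps)

lemma indic_upow: "indic (upow n) = (if int m dvd n then 1 else 0)"
proof -
  have "indic (upow n) = 1 \<odot>\<^bsub>complex_star_alg\<^esub> (if int m dvd n then 1 else 0)"
    unfolding indic_def
    by (rule CC.lin_single) (simp add: CC_simps)
  then show ?thesis by (simp add: CC_simps)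
qed

lemma indic_shift: "int m dvd t \<Longrightarrow> indic (g * (upow t - 1)) = 0"
proof -
  assume t: "int m dvd t"
  have "linmap OU1 complex_star_alg (\<lambda>g. indic (g * upow t))"
    by (rule semilinearI)
       (auto simp: OU1_simps indic_simps distrib_right cscale_mult_left CC_simps)
  from OU1_ext[OF this indic_linmap CC.cspace_axioms, of g]
  have "indic (g * upow t) = indic g"
    using t by (simp add: mult_single indic_upow dvd_add_left_iff)
  moreover have "indic (g * upow t) = indic (g * (upow t - 1)) + indic g"
    by (simp add: indic_simps(1)[symmetric] algebra_simps)
  ultimately show ?thesis by simp
qed

text \<open>The largest ideal in the kernel of \<open>indic\<close> contains \<open>u\<^bsup>m\<^esup> - 1\<close> and its star.\<close>

lemma indic_J: "f \<in> J \<Longrightarrow> indic f = 0"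
proof -
  define K where "K = {f. \<forall>g. indic (g * f) = 0}"
  have "linear_sub OU1 K"
    by (simp add: linear_sub_def K_def OU1_simps indic_simps distrib_left cscale_mult_right)
  then interpret K: cspace_quot OU1 K by unfold_locales
  have id: "ideal K OU1"
  proof (rule idealI[OF OU1.ring_axioms K.W.a_subgroup])
    show "x \<otimes>\<^bsub>OU1\<^esub> f \<in> K" if "f \<in> K" for f x
      using that by (simp add: K_def OU1_simps mult.assoc[symmetric])
    then show "f \<otimes>\<^bsub>OU1\<^esub> x \<in> K" if "f \<in> K" for f x
      using that by (simp add: OU1_simps mult.commute)
  qed
  have rels: "{u1 ^ m - 1} \<subseteq> K"
    using indic_shift[of "int m"] by (simp add: K_def u1_power)
  have "star OU1 (u1 ^ m - 1) = upow (- int m) - 1"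
    using OU1.star_minus[of "upow (int m)" "upow 0"] OU1.star_one[unfolded OU1_simps(3)]
    by (simp add: OU1_minus u1_power)
  then have "star OU1 ` {u1 ^ m - 1} \<subseteq> K"
    using indic_shift[of "- int m"] by (simp add: K_def)
  from Z.I_minimal[OF id rels this] have "f \<in> J \<Longrightarrow> indic (1 * f) = 0"
    unfolding K_def by blast
  then show "f \<in> J \<Longrightarrow> indic f = 0" by simp
qed

text \<open>The functional on the cyclic quotient that is 1 at the unit and 0 at the other powers of the
  generator.\<close>

definition "\<chi> = qlift indic"

lemma chi_linmap: "linmap (OZ m) complex_star_alg \<chi>"
  unfolding \<chi>_def OZ_def linmap_star_quot
  by (rule qlift_semilinear[OF indic_linmap Z.cspace_quot_axioms CC.cspace_axioms])
     (simp add: indic_J CC_simps)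

lemma chi_U: "\<chi> (U n) = (if int m dvd n then 1 else 0)"
proof -
  have "\<chi> (U n) = indic (upow n)"
    unfolding \<chi>_def U_def
    by (rule qlift_coset[OF indic_linmap Z.cspace_quot_axioms CC.cspace_axioms])
       (auto simp: indic_J CC_simps)
  then show ?thesis by (simp add: indic_upow)
qed

end

section \<open>The quantum lens space and its circle coaction\<close>

lemma cspan_carrier_update: "cspan (A\<lparr>carrier := B\<rparr>) S = cspan A S"
proof -
  have "x \<in> cspan A S" if "x \<in> cspan (A\<lparr>carrier := B\<rparr>) S" for x
    using that by induction (auto intro: cspan.intros)
  moreover have "x \<in> cspan (A\<lparr>carrier := B\<rparr>) S" if "x \<in> cspan A S" for x
    using that
  proof induction
    case zero
    then show ?case using cspan.zero[of "A\<lparr>carrier := B\<rparr>" S] by simp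
  next
    case (step x s c)
    then show ?case using cspan.step[of x "A\<lparr>carrier := B\<rparr>" S s c] by simp
  qed
  ultimately show ?thesis by auto
qed

lemma cspan_in_csub: "\<lbrakk>linear_sub V W; S \<subseteq> W; x \<in> cspan V S\<rbrakk> \<Longrightarrow> x \<in> W"
proof -
  assume W: "linear_sub V W" "S \<subseteq> W" and x: "x \<in> cspan V S"
  from x show "x \<in> W"
    by induction (use W in \<open>auto simp: linear_sub_def\<close>)
qed

locale lens = sphere + fixes k l :: nat
  assumes kl_pos: "0 < k" "0 < l" and coprime: "coprime k l"
begin

sublocale WU: weighted p q \<theta> OU1 upow k l
  by unfold_locales (simp_all add: OU1_one)

sublocale C: cyclic "k * l" .

sublocale OZ: star_algebra "OZ (k * l)"
  by (rule C.OZ_star_algebra)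

sublocale WZ: weighted p q \<theta> "OZ (k * l)" C.U k l
  by unfold_locales (simp_all add: C.U_props)

abbreviation "A \<equiv> A_kl p q \<theta> k l"

lemma A_eq: "A = R\<lparr>carrier := {x \<in> carrier R. WZ.\<Phi> x = pure R (OZ (k * l)) x \<one>\<^bsub>OZ (k * l)\<^esub>}\<rparr>"
  by (simp add: A_kl_def C.uZ_eq WZ.coinvariants_coaction)

lemma A_carrier: "x \<in> carrier A \<longleftrightarrow> x \<in> carrier R \<and> WZ.\<Phi> x = pure R (OZ (k * l)) x \<one>\<^bsub>OZ (k * l)\<^esub>"
  by (simp add: A_eq)

lemma A_simps:
  "monoid.mult A = monoid.mult R" "one A = one R" "zero A = zero R" "add A = add R"
  "module.smult A = module.smult R" "star A = star R"
  by (simp_all add: A_kl_def)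

sublocale A: star_algebra A
  unfolding A_eq
proof (rule sub_star_algebra[OF R.star_algebra_axioms])
  note h = star_homD[OF WZ.Phi_hom]
  let ?C = "{x \<in> carrier R. WZ.\<Phi> x = pure R (OZ (k * l)) x \<one>\<^bsub>OZ (k * l)\<^esub>}"
  show "linear_sub R ?C"
    using WZ.fixed_csub[of 0] by (simp add: C.U_props)
  show "\<one>\<^bsub>R\<^esub> \<in> ?C" using h(3) by (simp add: star_tensor_simps WZ.RH.tensor_one)
  show "x \<otimes>\<^bsub>R\<^esub> y \<in> ?C" if "x \<in> ?C" "y \<in> ?C" for x y
    using that h(2)[of x y] by (simp add: star_tensor_simps)
  show "star R x \<in> ?C" if "x \<in> ?C" for x
    using that h(4)[of x] by simp
qed

lemma A_in_R: "x \<in> carrier A \<Longrightarrow> x \<in> carrier R"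
  by (simp add: A_carrier)

lemma A_csub: "linear_sub R (carrier A)"
  using WZ.fixed_csub[of 0] by (simp add: C.U_props A_eq)

lemma R_A_linmap: "semilinear \<sigma> V R f \<Longrightarrow> (\<And>x. x \<in> carrier V \<Longrightarrow> f x \<in> carrier A) \<Longrightarrow> semilinear \<sigma> V A f"
  by (auto simp: semilinear_def A_simps)

lemma kl_dvd_iff: "int (k * l) dvd int k * m + int l * n \<longleftrightarrow> int l dvd m \<and> int k dvd n"
proof
  assume d: "int (k * l) dvd int k * m + int l * n"
  have co: "coprime (int k) (int l)" using coprime by simp
  have "int l dvd int k * m + int l * n" "int k dvd int k * m + int l * n"
    using d by (auto intro: dvd_trans[rotated])
  then have "int l dvd int k * m" "int k dvd int l * n"
    by (simp_all add: dvd_add_left_iff dvd_add_right_iff)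
  then show "int l dvd m \<and> int k dvd n"
    using co by (simp add: coprime_dvd_mult_right_iff coprime_commute)
next
  assume "int l dvd m \<and> int k dvd n"
  then obtain i j where "m = int l * i" "n = int k * j" by (auto elim!: dvdE)
  then have "int k * m + int l * n = int (k * l) * (i + j)" by (simp add: algebra_simps)
  then show "int (k * l) dvd int k * m + int l * n" by simp
qed

text \<open>By \<open>kl_dvd_iff\<close> these are the monomials of \<open>A_kl\<close>. The degree of \<open>amon r s i j\<close> will be \<open>i + j\<close>.\<close>

abbreviation amon :: "nat \<Rightarrow> nat \<Rightarrow> int \<Rightarrow> int \<Rightarrow> sphere_elem"
  where "amon r s i j \<equiv> cls (mon r s (int l * i) (int k * j))"

lemma amon_weight: "int k * (int l * i) + int l * (int k * j) = int (k * l) * (i + j)"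
  by (simp add: algebra_simps)

lemma amon_A: "amon r s i j \<in> carrier A"
  unfolding A_carrier WZ.Phi_mon amon_weight C.U_multiple by (simp add: cls_simps)

lemma A_span:
  assumes "x \<in> carrier A"
  shows "x \<in> cspan R {amon r s i j | r s i j. True}"
proof -
  have "x \<in> cspan R {cls (mon r s m n) | r s m n. C.\<chi> (C.U (int k * m + int l * n)) \<noteq> 0}"
    by (rule WZ.fixed_in_span[OF C.chi_linmap])
       (use assms C.chi_U[of 0] in \<open>auto simp: A_carrier C.U_props\<close>)
  also have "{cls (mon r s m n) | r s m n. C.\<chi> (C.U (int k * m + int l * n)) \<noteq> 0} \<subseteq>
      {amon r s i j | r s i j. True}"
  proof
    fix z assume "z \<in> {cls (mon r s m n) | r s m n. C.\<chi> (C.U (int k * m + int l * n)) \<noteq> 0}"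
    then obtain r s m n where z: "z = cls (mon r s m n)" and "C.\<chi> (C.U (int k * m + int l * n)) \<noteq> 0"
      by blast
    then have "int (k * l) dvd int k * m + int l * n"
      unfolding C.chi_U by presburger
    then have "int l dvd m \<and> int k dvd n" unfolding kl_dvd_iff .
    then obtain i j where "m = int l * i" "n = int k * j" by (auto elim!: dvdE)
    with z show "z \<in> {amon r s i j | r s i j. True}" by blast
  qed
  from subsetD[OF cspan_mono[OF this]] calculation show ?thesis by blast
qed

subsection \<open>Existence of the coaction\<close>

abbreviation "proj_A \<equiv> WZ.contract C.\<chi>"

lemma prA_A: "x \<in> carrier A \<Longrightarrow> proj_A x = x"
  using WZ.contract(2)[OF C.chi_linmap, of x "C.U 0"] C.chi_U[of 0] R.smult_1[of x]
  by (simp add: A_carrier C.U_props)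

lemma prA_closed: "x \<in> carrier R \<Longrightarrow> proj_A x \<in> carrier A"
proof -
  assume x: "x \<in> carrier R"
  note c = WZ.contract[OF C.chi_linmap]
  have A: "carrier A \<subseteq> carrier R" by (auto simp: A_in_R)
  have "proj_A x \<in> cspan R (carrier A)"
  proof (rule semilinear_cspan[OF c(1) R.cspace_axioms R.cspace_axioms _ A _ monomials_span[OF x]])
    fix z assume "z \<in> {cls (mon r s m n) | r s m n. True}"
    then obtain r s m n where z: "z = cls (mon r s m n)" by auto
    let ?w = "int k * m + int l * n"
    have cz: "proj_A z = C.\<chi> (C.U ?w) \<odot>\<^bsub>R\<^esub> z"
      by (rule c(2)) (auto simp: z cls_simps(1) WZ.Phi_mon C.U_props simp del: WZ.Phi_cls)
    show "proj_A z \<in> cspan R (carrier A)"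
    proof (cases "int (k * l) dvd ?w")
      case False
      then have "proj_A z = \<zero>\<^bsub>R\<^esub>" unfolding cz C.chi_U by (simp add: z cls_simps(1))
      then show ?thesis by (simp add: cspan.zero)
    next
      case True
      then have "proj_A z = z" unfolding cz C.chi_U by (simp add: z cls_simps(1))
      moreover have "z \<in> carrier A"
        using True WZ.Phi_mon[of r s m n] C.U_multiple by (auto simp: z A_carrier cls_simps(1) elim!: dvdE simp del: WZ.Phi_cls)
      ultimately show ?thesis by (auto intro: R.cspan_base[OF A])
    qed
  qed (auto simp: cls_simps)
  then show "proj_A x \<in> carrier A"
    by (rule cspan_in_csub[OF A_csub subset_refl])
qed

lemma prA_linmap: "linmap R A proj_A"
  by (rule R_A_linmap[OF WZ.contract(1)[OF C.chi_linmap] prA_closed])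

text \<open>On \<open>A_kl\<close> the coaction of the sphere only involves exponents divisible by \<open>kl\<close>. There
  this map is the isomorphism that takes \<open>u\<^bsup>kl\<^esup>\<close> to \<open>u\<close>.\<close>

definition divide :: "(int \<Rightarrow>\<^sub>0 complex) \<Rightarrow> (int \<Rightarrow>\<^sub>0 complex)"
  where "divide = lin OU1 (\<lambda>n. upow (n div int (k * l)))"

lemma divide_linmap: "linmap OU1 OU1 divide"
  unfolding divide_def by (rule OU1_lin_linmap[OF OU1.cspace_axioms]) simp

lemma divide_upow: "divide (upow (int (k * l) * n)) = upow n"
proof -
  have "divide (upow (int (k * l) * n)) = upow (int (k * l) * n div int (k * l))"
    unfolding divide_def by (subst OU1.lin_single) auto
  then show ?thesis using kl_pos by simp
qed

text \<open>The coaction of the sphere on \<open>A_kl\<close>, with exponents divided by \<open>kl\<close>. The projection \<open>proj_A\<close>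
  is the identity on \<open>A_kl\<close> and turns the first tensor factor into an element of \<open>A_kl\<close>.\<close>

definition \<rho> :: "sphere_elem \<Rightarrow> (sphere_elem, int \<Rightarrow>\<^sub>0 complex) tensor"
  where "\<rho> x = tensor_map A OU1 proj_A divide (WU.\<Phi> x)"

sublocale AU: star_algebras A OU1
  by unfold_locales

sublocale AUt: complex_algebra "tensor A OU1"
  by (rule AU.tensor_algebra)

lemmas tm = tensor_map_linmap[OF A.cspace_axioms OU1.cspace_axioms R.cspace_axioms OU1.cspace_axioms prA_linmap divide_linmap]

lemma rho_linmap_R: "linmap R (tensor A OU1) \<rho>"
  unfolding \<rho>_def using semilinear_comp[OF WU.Phi_linmap tm(1)] .

lemma rho_linmap: "linmap A (tensor A OU1) \<rho>"
  using semilinearD[OF rho_linmap_R] by (intro semilinearI) (auto simp: A_in_R A_simps)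

definition deg :: "int \<Rightarrow> sphere_elem set"
  where "deg n = {x \<in> carrier A. WU.\<Phi> x = pure R OU1 x (upow (int (k * l) * n))}"

lemma rho_deg: "x \<in> deg n \<Longrightarrow> \<rho> x = pure A OU1 x (upow n)"
  unfolding \<rho>_def deg_def by (auto simp: tm(2) A_in_R divide_upow prA_A simp del: of_nat_mult)

lemma deg_carrier: "x \<in> deg n \<Longrightarrow> x \<in> carrier A"
  by (simp add: deg_def)

lemma deg_mult: "x \<in> deg m \<Longrightarrow> y \<in> deg n \<Longrightarrow> x \<otimes>\<^bsub>R\<^esub> y \<in> deg (m + n)"
  using star_homD(2)[OF WU.Phi_hom, of x y] A.m_closed[of x y]
  by (auto simp: deg_def A_in_R star_tensor_simps A_simps distrib_left)

lemma deg_star: "x \<in> deg n \<Longrightarrow> star R x \<in> deg (- n)"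
  using star_homD(4)[OF WU.Phi_hom, of x] A.star_closed[of x]
  by (auto simp: deg_def A_in_R star_tensor_simps A_simps)

lemma deg_one: "\<one>\<^bsub>R\<^esub> \<in> deg 0"
  using star_homD(3)[OF WU.Phi_hom] A.one_closed
  by (auto simp: deg_def star_tensor_simps A_simps WU.RH.tensor_one OU1_one)

lemma amon_deg: "amon r s i j \<in> deg (i + j)"
  unfolding deg_def using amon_A[of r s i j] WU.Phi_mon[of r s "int l * i" "int k * j"]
  unfolding amon_weight by simp

lemma deg_span: "x \<in> carrier A \<Longrightarrow> x \<in> cspan A (\<Union>n. deg n)"
proof -
  assume "x \<in> carrier A"
  from A_span[OF this] have "x \<in> cspan A {amon r s i j | r s i j. True}"
    by (simp add: A_eq cspan_carrier_update)
  moreover have "{amon r s i j | r s i j. True} \<subseteq> (\<Union>n. deg n)"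
    using amon_deg by blast
  ultimately show ?thesis using cspan_mono by blast
qed

lemma deg_subset: "(\<Union>n. deg n) \<subseteq> carrier A"
  by (auto simp: deg_def)

lemma A_ext:
  assumes "semilinear \<sigma> A V f" "semilinear \<sigma> A V g" "cspace V" "\<And>n x. x \<in> deg n \<Longrightarrow> f x = g x" "x \<in> carrier A"
  shows "f x = g x"
  by (rule semilinear_ext[OF assms(1,2) A.cspace_axioms assms(3) deg_subset _ deg_span[OF assms(5)]])
     (use assms(4) in auto)

text \<open>Products and adjoints of homogeneous elements are homogeneous, and on these \<open>\<rho>\<close> is explicit.\<close>

lemma rho_hom: "\<rho> \<in> star_hom A (star_tensor A OU1)"
proof (rule star_homI)
  show "linmap A (star_tensor A OU1) \<rho>" using rho_linmap by (simp add: linmap_star_tensor)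
  show "\<rho> \<one>\<^bsub>A\<^esub> = \<one>\<^bsub>star_tensor A OU1\<^esub>"
    using rho_deg[OF deg_one] by (simp add: star_tensor_simps A_simps AU.tensor_one OU1_one)
  have mult: "cbilinear A A (tensor A OU1) (\<lambda>x y. \<rho> (x \<otimes>\<^bsub>A\<^esub> y))"
    using cbilinear_post[OF mult_bilinear[OF A.complex_algebra_axioms] rho_linmap] .
  have mult': "cbilinear A A (tensor A OU1) (\<lambda>x y. \<rho> x \<otimes>\<^bsub>tensor A OU1\<^esub> \<rho> y)"
    using cbilinear_comp[OF mult_bilinear[OF AUt.complex_algebra_axioms] rho_linmap rho_linmap] .
  have dm: "\<rho> (x \<otimes>\<^bsub>A\<^esub> y) = \<rho> x \<otimes>\<^bsub>tensor A OU1\<^esub> \<rho> y" if "x \<in> deg m" "y \<in> deg n" for x y m n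
    using that deg_mult[OF that] by (simp add: rho_deg deg_carrier A_simps)
  have dm2: "\<rho> (x \<otimes>\<^bsub>A\<^esub> y) = \<rho> x \<otimes>\<^bsub>tensor A OU1\<^esub> \<rho> y" if x: "x \<in> deg m" and y: "y \<in> carrier A" for x y m
    by (rule A_ext[OF cbilinearD(2)[OF mult deg_carrier[OF x] y] cbilinearD(2)[OF mult' deg_carrier[OF x] y]
          AUt.cspace_axioms dm[OF x] y])
  show "\<rho> (x \<otimes>\<^bsub>A\<^esub> y) = \<rho> x \<otimes>\<^bsub>star_tensor A OU1\<^esub> \<rho> y" if x: "x \<in> carrier A" and y: "y \<in> carrier A" for x y
    unfolding star_tensor_simps
    by (rule A_ext[OF cbilinearD(3)[OF mult x y] cbilinearD(3)[OF mult' x y] AUt.cspace_axioms dm2[OF _ y] x])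
  show "\<rho> (star A x) = star (star_tensor A OU1) (\<rho> x)" if x: "x \<in> carrier A" for x
  proof (rule A_ext[OF semilinear_comp[OF A.star_semilinear rho_linmap] _ AUt.cspace_axioms _ x])
    show "semilinear cnj A (tensor A OU1) (\<lambda>x. star (star_tensor A OU1) (\<rho> x))"
      using semilinear_comp[OF rho_linmap AU.star_tensor_semilinear] .
    show "\<rho> (star A x) = star (star_tensor A OU1) (\<rho> x)" if "x \<in> deg n" for x n
      using that deg_star[OF that] by (simp add: A_simps rho_deg AU.star_tensor_pure deg_carrier)
  qed
qed

subsection \<open>Uniqueness of the coaction\<close>

lemma gens_deg:
  "cls (ga ^ l) \<in> deg 1" "cls (gb ^ k) \<in> deg 1" "cls eA \<in> deg 0" "cls eB \<in> deg 0"
  using amon_deg[of 0 0 1 0] amon_deg[of 0 0 0 1] amon_deg[of 1 0 0 0] amon_deg[of 0 1 0 0]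
  by (simp_all add: mon_def pw_def)

text \<open>A monomial of \<open>A_kl\<close> is a product of powers of the four generators and of the adjoints of \<open>a\<^bsup>l\<^esup>\<close>
  and \<open>b\<^bsup>k\<^esup>\<close>.\<close>

lemma A_generated:
  assumes h: "h \<in> star_hom A B" "h' \<in> star_hom A B" "complex_algebra B"
    and gens: "\<And>z. z \<in> {cls (ga ^ l), cls (gb ^ k), cls eA, cls eB} \<Longrightarrow> h z = h' z"
    and x: "x \<in> carrier A"
  shows "h x = h' x"
proof -
  interpret B: complex_algebra B by fact
  note d = star_homD[OF h(1)] and d' = star_homD[OF h(2)]
  define E where "E f \<longleftrightarrow> cls f \<in> carrier A \<and> h (cls f) = h' (cls f)" for f
  have E_mult: "E (f * g)" if "E f" "E g" for f g
    using that d(2)[of "cls f" "cls g"] d'(2)[of "cls f" "cls g"] A.m_closed[of "cls f" "cls g"]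
    by (simp add: E_def A_simps cls_simps)
  have E_one: "E 1"
    using d(3) d'(3) A.one_closed by (simp add: E_def A_simps cls_simps)
  have E_st: "E (WI.st f)" if "E f" for f
    using that d(4)[of "cls f"] d'(4)[of "cls f"] A.star_closed[of "cls f"]
    by (simp add: E_def A_simps cls_simps)
  have E_power: "E (f ^ n)" if "E f" for f n
    by (induction n) (auto simp: E_one intro: E_mult that)
  have E_gens: "E (ga ^ l)" "E (gb ^ k)" "E eA" "E eB"
    using gens gens_deg deg_carrier by (auto simp: E_def)
  have E_st_gens: "E (ga' ^ l)" "E (gb' ^ k)"
    using E_st[OF E_gens(1)] E_st[OF E_gens(2)] by (simp_all add: st_power st_free_gen)
  have E_pw: "E (pw x x' (int t * i))" if "E (x ^ t)" "E (x' ^ t)" "0 < t" for x x' t i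
    using E_power[OF that(1), of "nat i"] E_power[OF that(2), of "nat (- i)"] that(3)
    by (auto simp: pw_def power_mult[symmetric] nat_mult_distrib zero_le_mult_iff
        minus_mult_right simp del: mult_minus_right)
  have E_amon: "h (amon r s i j) = h' (amon r s i j)" for r s i j
  proof -
    have "E (mon r s (int l * i) (int k * j))"
      unfolding mon_def
      by (intro E_mult E_power[OF E_gens(3)] E_power[OF E_gens(4)]
          E_pw[OF E_gens(1) E_st_gens(1) kl_pos(2)] E_pw[OF E_gens(2) E_st_gens(2) kl_pos(1)])
    then show ?thesis by (simp add: E_def)
  qed
  have S: "{amon r s i j | r s i j. True} \<subseteq> carrier A" using amon_A by auto
  have "x \<in> cspan A {amon r s i j | r s i j. True}"
    using A_span[OF x] by (simp add: A_eq cspan_carrier_update)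
  from semilinear_ext[OF d(1) d'(1) A.cspace_axioms B.cspace_axioms S _ this] E_amon
  show ?thesis by blast
qed

lemma A_pow: "cls f [^]\<^bsub>A\<^esub> (n :: nat) = cls (f ^ n)"
  using cls_pow[of f n] by (simp add: nat_pow_def A_simps)

lemma rho_kl_eq: "rho_kl p q \<theta> k l = restrict \<rho> (carrier A)"
  unfolding rho_kl_def Let_def gen_a_eq gen_b_eq elem_A_eq elem_B_eq A_pow
proof (rule the_star_hom_eq[OF A.star_algebra_axioms rho_hom])
  let ?G = "{(cls (ga ^ l), pure A OU1 (cls (ga ^ l)) u1), (cls (gb ^ k), pure A OU1 (cls (gb ^ k)) u1),
     (cls eA, pure A OU1 (cls eA) \<one>\<^bsub>OU1\<^esub>), (cls eB, pure A OU1 (cls eB) \<one>\<^bsub>OU1\<^esub>)}"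
  show "fst ` ?G \<subseteq> carrier A" using gens_deg deg_carrier by auto
  show v: "\<rho> g = v" if "(g, v) \<in> ?G" for g v
    using that rho_deg[OF gens_deg(1)] rho_deg[OF gens_deg(2)] rho_deg[OF gens_deg(3)] rho_deg[OF gens_deg(4)]
    by (auto simp: u1_def OU1_one)
  fix h x assume h: "h \<in> star_hom A (star_tensor A OU1)" "\<And>g v. (g, v) \<in> ?G \<Longrightarrow> h g = v" and x: "x \<in> carrier A"
  show "h x = \<rho> x"
  proof (rule A_generated[OF h(1) rho_hom star_tensor_algebra(1)[OF A.star_algebra_axioms OU1.star_algebra_axioms] _ x])
    fix z assume "z \<in> {cls (ga ^ l), cls (gb ^ k), cls eA, cls eB}"
    then obtain v where "(z, v) \<in> ?G" by auto
    then show "h z = \<rho> z" using h(2) v by metis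
  qed
qed

subsection \<open>Strong grading\<close>

abbreviation "rk \<equiv> rho_kl p q \<theta> k l"

lemma rk_A: "x \<in> carrier A \<Longrightarrow> rk x = \<rho> x"
  by (simp add: rho_kl_eq)

lemma rk_deg: "x \<in> deg n \<Longrightarrow> x \<in> carrier A \<and> rk x = pure A OU1 x (upow n)"
  by (simp add: rk_A deg_carrier rho_deg)

sublocale G: graded_coaction A rk
proof
  have "rk \<in> star_hom A (star_tensor A OU1)"
    unfolding rho_kl_eq by (rule star_hom_restrict[OF A.star_algebra_axioms rho_hom])
  then show "rk \<in> alg_hom A (tensor A OU1)"
    by (simp add: star_hom_def alg_hom_star_tensor)
  have "(\<Union>n. deg n) \<subseteq> (\<Union>n. {x \<in> carrier A. rk x = pure A OU1 x (upow n)})"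
    using rk_deg by blast
  from cspan_mono[OF this] deg_span
  show "carrier A \<subseteq> cspan A (\<Union>n. {x \<in> carrier A. rk x = pure A OU1 x (upow n)})"
    by (intro subsetI) (rule subsetD)
qed

lemma deg_H: "x \<in> deg n \<Longrightarrow> x \<in> G.H n"
  using rk_deg by (simp add: G.H_def)

lemma two_products:
  assumes "r \<in> deg (-n)" "s \<in> deg n" "r' \<in> deg (-n)" "s' \<in> deg n"
    and "r \<otimes>\<^bsub>R\<^esub> s \<oplus>\<^bsub>R\<^esub> r' \<otimes>\<^bsub>R\<^esub> s' = \<one>\<^bsub>R\<^esub>"
  shows "\<one>\<^bsub>A\<^esub> \<in> cspan A {r \<otimes>\<^bsub>A\<^esub> s | r s. r \<in> G.H (-n) \<and> s \<in> G.H n}"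
proof -
  let ?S = "{r \<otimes>\<^bsub>A\<^esub> s | r s. r \<in> G.H (-n) \<and> s \<in> G.H n}"
  have S: "?S \<subseteq> carrier A" by (auto simp: G.H_carrier)
  have "r \<otimes>\<^bsub>A\<^esub> s \<oplus>\<^bsub>A\<^esub> r' \<otimes>\<^bsub>A\<^esub> s' \<in> cspan A ?S"
    using assms(1-4) deg_H by (intro A.cspan_add[OF S] A.cspan_base[OF S]) blast+
  then show ?thesis using assms(5) by (simp add: A_simps)
qed

lemma csub_deg: "linear_sub R (deg n)"
proof -
  have "deg n = carrier A \<inter> {x \<in> carrier R. WU.\<Phi> x = pure R OU1 x (upow (int (k * l) * n))}"
    by (auto simp: deg_def A_in_R)
  then show ?thesis
    using A_csub WU.fixed_csub[of "int (k * l) * n"] by (auto simp: linear_sub_def)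
qed

lemma deg_diff: "cls f \<in> deg n \<Longrightarrow> cls g \<in> deg n \<Longrightarrow> cls (f - g) \<in> deg n"
proof -
  assume fg: "cls f \<in> deg n" "cls g \<in> deg n"
  have "cls f \<oplus>\<^bsub>R\<^esub> (-1) \<odot>\<^bsub>R\<^esub> cls g \<in> deg n" using csub_deg[of n] fg by (auto simp: linear_sub_def)
  then show ?thesis by (simp add: cls_simps free_cvs.scale_minus_left)
qed

lemma deg_mult_cls: "cls f \<in> deg m \<Longrightarrow> cls g \<in> deg n \<Longrightarrow> cls (f * g) \<in> deg (m + n)"
  using deg_mult[of "cls f" m "cls g" n] by (simp add: cls_simps)

lemma gens_deg': "cls (ga' ^ l) \<in> deg (-1)" "cls (gb' ^ k) \<in> deg (-1)"
  using deg_star[OF gens_deg(1)] deg_star[OF gens_deg(2)] by (simp_all add: cls_simps st_power st_free_gen)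

sublocale G: strongly_graded_coaction A rk
proof
  note d = gens_deg(1,2) and d' = gens_deg'
  have 1: "cls (ga' ^ l) \<otimes>\<^bsub>R\<^esub> cls (ga ^ l) \<oplus>\<^bsub>R\<^esub> cls (gb' ^ k - ga' ^ l * ga ^ l * gb' ^ k) \<otimes>\<^bsub>R\<^esub> cls (gb ^ k) = \<one>\<^bsub>R\<^esub>"
    using unit_decomposition(2)[of l k] by (simp add: cong_def cls_simps)
  have "cls (gb' ^ k - ga' ^ l * ga ^ l * gb' ^ k) \<in> deg (-1)"
    using deg_mult_cls[OF deg_mult_cls[OF d'(1) d(1)] d'(2)] by (intro deg_diff d') simp
  from two_products[OF d'(1) d(1) this d(2) 1]
  show "\<one>\<^bsub>A\<^esub> \<in> cspan A {r \<otimes>\<^bsub>A\<^esub> s | r s. r \<in> G.H (-1) \<and> s \<in> G.H 1}" .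
  have 2: "cls (ga ^ l) \<otimes>\<^bsub>R\<^esub> cls (ga' ^ l) \<oplus>\<^bsub>R\<^esub> cls (gb ^ k - ga ^ l * ga' ^ l * gb ^ k) \<otimes>\<^bsub>R\<^esub> cls (gb' ^ k) = \<one>\<^bsub>R\<^esub>"
    using unit_decomposition(1)[of l k] by (simp add: cong_def cls_simps)
  have "cls (gb ^ k - ga ^ l * ga' ^ l * gb ^ k) \<in> deg 1"
    using deg_mult_cls[OF deg_mult_cls[OF d(1) d'(1)] d(2)] by (intro deg_diff d) simp
  with two_products[of "cls (ga ^ l)" "-1" "cls (ga' ^ l)" "cls (gb ^ k - ga ^ l * ga' ^ l * gb ^ k)" "cls (gb' ^ k)"] d d' 2
  show "\<one>\<^bsub>A\<^esub> \<in> cspan A {r \<otimes>\<^bsub>A\<^esub> s | r s. r \<in> G.H 1 \<and> s \<in> G.H (-1)}" by simp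
qed

subsection \<open>Coinvariants\<close>

text \<open>Both sides are spanned by the monomials with \<open>km + ln = 0\<close>, which is \<open>i + j = 0\<close> for
  \<open>amon r s i j\<close>.\<close>

lemma coinvariants_rho:
  "coinvariants OU1 A rk = {x \<in> carrier R. WU.\<Phi> x = pure R OU1 x \<one>\<^bsub>OU1\<^esub>}" (is "_ = ?C")
proof (intro subset_antisym subsetI)
  fix x assume "x \<in> coinvariants OU1 A rk"
  then have x: "x \<in> G.H 0" by (simp add: G.coinvariants_eq)
  then have xA: "x \<in> carrier A" by (rule G.H_carrier)
  let ?S = "{amon r s i j | r s i j. True}"
  have S: "?S \<subseteq> carrier A" using amon_A by auto
  have "x \<in> cspan A ?S" using A_span[OF xA] by (simp add: A_eq cspan_carrier_update)
  then have "G.proj0 x \<in> cspan A (deg 0)"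
  proof (rule semilinear_cspan[OF G.proj0_linmap A.cspace_axioms A.cspace_axioms S, rotated 2])
    show "deg 0 \<subseteq> carrier A" by (auto simp: deg_def)
    then have base: "y \<in> cspan A (deg 0)" if "y \<in> deg 0" for y using that by (rule A.cspan_base)
    fix z assume "z \<in> ?S"
    then obtain r s i j where z: "z = amon r s i j" by auto
    show "G.proj0 z \<in> cspan A (deg 0)"
      using G.proj0_H[OF deg_H[OF amon_deg[of r s i j]]] amon_deg[of r s i j] base
      by (cases "i + j = 0") (auto simp: z cspan.zero)
  qed
  then have "x \<in> cspan R (deg 0)"
    using G.proj0_H[OF x] by (simp add: A_eq cspan_carrier_update)
  then have "x \<in> deg 0" by (rule cspan_in_csub[OF csub_deg subset_refl])
  then show "x \<in> ?C" by (auto simp: deg_def A_in_R OU1_one)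
next
  fix x assume x: "x \<in> ?C"
  have "x \<in> cspan R {cls (mon r s m n) | r s m n. lookup (upow (int k * m + int l * n)) 0 \<noteq> 0}"
    by (rule WU.fixed_in_span[OF G.lookup_linmap]) (use x in \<open>auto simp: OU1_one\<close>)
  moreover have "{cls (mon r s m n) | r s m n. lookup (upow (int k * m + int l * n)) 0 \<noteq> (0 :: complex)} \<subseteq> carrier A"
  proof
    fix z assume "z \<in> {cls (mon r s m n) | r s m n. lookup (upow (int k * m + int l * n)) 0 \<noteq> (0 :: complex)}"
    then obtain r s m n where z: "z = cls (mon r s m n)" "int k * m + int l * n = 0"
      by (auto simp: lookup_single when_def split: if_splits)
    then show "z \<in> carrier A"
      using WZ.Phi_mon[of r s m n] by (simp add: A_carrier cls_simps(1) C.U_props)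
  qed
  ultimately have "x \<in> carrier A" by (rule cspan_in_csub[OF A_csub, rotated])
  then have "x \<in> deg 0" using x by (simp add: deg_def OU1_one)
  then show "x \<in> coinvariants OU1 A rk" by (simp add: G.coinvariants_eq deg_H)
qed

lemma coinvariants_OS2: "A\<lparr>carrier := coinvariants OU1 A rk\<rparr> = OS2 p q \<theta> k l"
  unfolding coinvariants_rho OS2_def u1_def WU.coinvariants_coaction by (simp add: A_kl_def)

end

theorem theorem3p1:
  fixes p q \<theta> :: real and k l :: nat
  assumes "0 < p" "p < 1" "0 < q" "q < 1" "0 < \<theta>" "\<theta> < 1" "\<theta> \<notin> \<rat>"
    and "0 < k" "0 < l" "coprime k l"
  shows "principal_comodule_algebra OU1 OU1_comult OU1_counit OU1_antipode
           (A_kl p q \<theta> k l) (rho_kl p q \<theta> k l)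
       \<and> (A_kl p q \<theta> k l)\<lparr>carrier := coinvariants OU1 (A_kl p q \<theta> k l) (rho_kl p q \<theta> k l)\<rparr>
         = OS2 p q \<theta> k l"
proof -
  interpret lens p q \<theta> k l
    by unfold_locales (use assms in auto)
  show ?thesis using G.principal coinvariants_OS2 by simp
qed

end
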